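(* Let $\mathcal{C}$ be a Markov category. Then the Markov category $\mathsf{ProDet}(\mathcal{C})$ has all small Kolmogorov products: every small family $(X_i)_{i\in I}$ of objects of $\mathsf{ProDet}(\mathcal{C})$ has a Kolmogorov product in $\mathsf{ProDet}(\mathcal{C})$.
   Context: A Markov category is a symmetric monoidal category in which the monoidal unit is terminal and every object $X$ carries a commutative comonoid structure $\mathsf{copy}_X : X\to X\otimes X$, $\mathsf{del}_X : X\to 1$, compatible with the monoidal product. A morphism $f:X\to Y$ is deterministic if $\mathsf{copy}_Y\circ f=(f\otimes f)\circ \mathsf{copy}_X$. $\mathsf{det}(\mathcal{C})$ is the wide subcategory of deterministic morphisms of $\mathcal{C}$; it is cartesian monoidal. $\mathsf{Pro}(-)$ denotes the category of pro-objects, i.e. the free completion under (small) cofiltered limits; its morphisms are $\mathsf{Pro}(\mathcal{C})(\lim_i X_i,\lim_j Y_j)=\lim_j\operatorname{colim}_i\mathcal{C}(X_i,Y_j)$. $\mathsf{ProDet}(\mathcal{C})$ is the full subcategory of $\mathsf{Pro}(\mathcal{C})$ on the limits of cofiltered diagrams that factorize through $\mathsf{det}(\mathcal{C})$; equivalently, it is the full image of the functor $\mathsf{Pro}(\mathsf{det}(\mathcal{C}))\to\mathsf{Pro}(\mathcal{C})$. It is a Markov category with tensor $$X\otimes Y=\lim_{X\to X',\ Y\to Y'} X'\otimes Y',$$ where $X\to X'$ and $Y\to Y'$ range over maps in $\mathsf{Pro}(\mathsf{det}(\mathcal{C}))$ with $X',Y'$ objects of $\mathcal{C}$ (i.e.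 the cartesian product in $\mathsf{Pro}(\mathsf{det}(\mathcal{C}))$); the tensor of morphisms is determined by tensoring representatives in $\mathcal{C}$ of the components, the unit is $1\in\mathcal{C}$, and the copy map of $X$ has components $X\to X'\xrightarrow{\mathsf{copy}}X'\otimes X'$. Its deterministic subcategory is $\mathsf{Pro}(\mathsf{det}(\mathcal{C}))$. Kolmogorov products (Fritz–Rischel): given a family $(X_i)_{i\in I}$ in a Markov category, for finite $F\subseteq I$ put $X^F=\bigotimes_{i\in F}X_i$, and for finite $F\subseteq F'$ let $X^{F'}\to X^F$ be the marginalization map discarding the factors in $F'\setminus F$. An infinite tensor product of the family is an object $X^I$ with maps $\pi_F:X^I\to X^F$ that form a limit cone over this cofiltered diagram, such that this limit is preserved by $-\otimes Y$ for every object $Y$. It is a Kolmogorov product if moreover all marginal projections $\pi_F$ are deterministic. *)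

theory Defs
  imports Main
begin

section \<open>Categories\<close>

record ('o, 'm) cat =
  Obj :: "'o set"
  Arr :: "'m set"
  Dom :: "'m \<Rightarrow> 'o"
  Cod :: "'m \<Rightarrow> 'o"
  Idn :: "'o \<Rightarrow> 'm"
  Cmp :: "'m \<Rightarrow> 'm \<Rightarrow> 'm"  (infixr "\<cdot>\<index>" 70)

definition hom :: "('o, 'm, 'x) cat_scheme \<Rightarrow> 'o \<Rightarrow> 'o \<Rightarrow> 'm set" where
  "hom C A B = {f \<in> Arr C. Dom C f = A \<and> Cod C f = B}"

locale category =
  fixes C :: "('o, 'm, 'x) cat_scheme" (structure)
  assumes Dom_Obj: "f \<in> Arr C \<Longrightarrow> Dom C f \<in> Obj C"
    and Cod_Obj: "f \<in> Arr C \<Longrightarrow> Cod C f \<in> Obj C"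
    and Idn_hom: "X \<in> Obj C \<Longrightarrow> Idn C X \<in> hom C X X"
    and Cmp_hom: "f \<in> hom C X Y \<Longrightarrow> g \<in> hom C Y Z \<Longrightarrow> g \<cdot> f \<in> hom C X Z"
    and Idn_left: "f \<in> hom C X Y \<Longrightarrow> Idn C Y \<cdot> f = f"
    and Idn_right: "f \<in> hom C X Y \<Longrightarrow> f \<cdot> Idn C X = f"
    and Cmp_assoc: "f \<in> hom C W X \<Longrightarrow> g \<in> hom C X Y \<Longrightarrow> h \<in> hom C Y Z \<Longrightarrow>
           (h \<cdot> g) \<cdot> f = h \<cdot> (g \<cdot> f)"

definition inverse_arrows :: "('o, 'm, 'x) cat_scheme \<Rightarrow> 'm \<Rightarrow> 'm \<Rightarrow> bool" where
  "inverse_arrows C f g \<longleftrightarrow> f \<in> Arr C \<and> g \<in> hom C (Cod C f) (Dom C f) \<and>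
     g \<cdot>\<^bsub>C\<^esub> f = Idn C (Dom C f) \<and> f \<cdot>\<^bsub>C\<^esub> g = Idn C (Cod C f)"

definition is_iso :: "('o, 'm, 'x) cat_scheme \<Rightarrow> 'm \<Rightarrow> bool" where
  "is_iso C f \<longleftrightarrow> (\<exists>g. inverse_arrows C f g)"

definition inv_arr :: "('o, 'm, 'x) cat_scheme \<Rightarrow> 'm \<Rightarrow> 'm" where
  "inv_arr C f = (THE g. inverse_arrows C f g)"

definition full_subcat :: "('o, 'm, 'x) cat_scheme \<Rightarrow> 'o set \<Rightarrow> ('o, 'm, 'x) cat_scheme" where
  "full_subcat C S =
     C\<lparr>Obj := Obj C \<inter> S, Arr := {f \<in> Arr C. Dom C f \<in> S \<and> Cod C f \<in> S}\<rparr>"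

definition is_functor ::
  "('i, 'a, 'x) cat_scheme \<Rightarrow> ('o, 'm, 'y) cat_scheme \<Rightarrow> ('i \<Rightarrow> 'o) \<Rightarrow> ('a \<Rightarrow> 'm) \<Rightarrow> bool" where
  "is_functor J C Fo Fa \<longleftrightarrow>
     (\<forall>i\<in>Obj J. Fo i \<in> Obj C) \<and>
     (\<forall>a\<in>Arr J. Fa a \<in> hom C (Fo (Dom J a)) (Fo (Cod J a))) \<and>
     (\<forall>i\<in>Obj J. Fa (Idn J i) = Idn C (Fo i)) \<and>
     (\<forall>a\<in>Arr J. \<forall>b\<in>Arr J. Cod J a = Dom J b \<longrightarrow> Fa (b \<cdot>\<^bsub>J\<^esub> a) = Fa b \<cdot>\<^bsub>C\<^esub> Fa a)"

definition is_cone ::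
  "('i, 'a, 'x) cat_scheme \<Rightarrow> ('o, 'm, 'y) cat_scheme \<Rightarrow> ('i \<Rightarrow> 'o) \<Rightarrow> ('a \<Rightarrow> 'm) \<Rightarrow>
   'o \<Rightarrow> ('i \<Rightarrow> 'm) \<Rightarrow> bool" where
  "is_cone J C Do Da L \<pi> \<longleftrightarrow> L \<in> Obj C \<and> (\<forall>i\<in>Obj J. \<pi> i \<in> hom C L (Do i)) \<and>
     (\<forall>a\<in>Arr J. Da a \<cdot>\<^bsub>C\<^esub> \<pi> (Dom J a) = \<pi> (Cod J a))"

definition is_limit_cone ::
  "('i, 'a, 'x) cat_scheme \<Rightarrow> ('o, 'm, 'y) cat_scheme \<Rightarrow> ('i \<Rightarrow> 'o) \<Rightarrow> ('a \<Rightarrow> 'm) \<Rightarrow>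
   'o \<Rightarrow> ('i \<Rightarrow> 'm) \<Rightarrow> bool" where
  "is_limit_cone J C Do Da L \<pi> \<longleftrightarrow> is_cone J C Do Da L \<pi> \<and>
     (\<forall>T \<tau>. is_cone J C Do Da T \<tau> \<longrightarrow>
        (\<exists>!u. u \<in> hom C T L \<and> (\<forall>i\<in>Obj J. \<pi> i \<cdot>\<^bsub>C\<^esub> u = \<tau> i)))"

definition cofiltered :: "('i, 'a, 'x) cat_scheme \<Rightarrow> bool" where
  "cofiltered J \<longleftrightarrow> category J \<and> Obj J \<noteq> {} \<and>
     (\<forall>i\<in>Obj J. \<forall>j\<in>Obj J. \<exists>k\<in>Obj J. hom J k i \<noteq> {} \<and> hom J k j \<noteq> {}) \<and>
     (\<forall>i\<in>Obj J. \<forall>j\<in>Obj J. \<forall>a\<in>hom J i j. \<forall>b\<in>hom J i j.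
        \<exists>k\<in>Obj J. \<exists>c\<in>hom J k i. a \<cdot>\<^bsub>J\<^esub> c = b \<cdot>\<^bsub>J\<^esub> c)"

section \<open>Markov categories\<close>

text \<open>
  Symmetric monoidal structure is not assumed to be strict. The tensor product is \<open>\<otimes>\<close> on
  objects and \<open>\<odot>\<close> on arrows.
\<close>

record ('o, 'm) markov = "('o, 'm) cat" +
  tenO :: "'o \<Rightarrow> 'o \<Rightarrow> 'o"  (infixr "\<otimes>\<index>" 75)
  tenA :: "'m \<Rightarrow> 'm \<Rightarrow> 'm"  (infixr "\<odot>\<index>" 75)
  unt :: "'o"
  assoc :: "'o \<Rightarrow> 'o \<Rightarrow> 'o \<Rightarrow> 'm"
  lunit :: "'o \<Rightarrow> 'm"
  runit :: "'o \<Rightarrow> 'm"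
  swap :: "'o \<Rightarrow> 'o \<Rightarrow> 'm"
  copy :: "'o \<Rightarrow> 'm"
  del :: "'o \<Rightarrow> 'm"

locale symmetric_monoidal_category = category C
  for C :: "('o, 'm, 'x) markov_scheme" (structure) +
  assumes unt_Obj: "unt C \<in> Obj C"
    and tenO_Obj: "X \<in> Obj C \<Longrightarrow> Y \<in> Obj C \<Longrightarrow> X \<otimes> Y \<in> Obj C"
    and tenA_hom: "f \<in> hom C X X' \<Longrightarrow> g \<in> hom C Y Y' \<Longrightarrow> f \<odot> g \<in> hom C (X \<otimes> Y) (X' \<otimes> Y')"
    and tenA_Idn: "X \<in> Obj C \<Longrightarrow> Y \<in> Obj C \<Longrightarrow> Idn C X \<odot> Idn C Y = Idn C (X \<otimes> Y)"
    and tenA_Cmp: "f \<in> hom C X X' \<Longrightarrow> f' \<in> hom C X' X'' \<Longrightarrow>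
          g \<in> hom C Y Y' \<Longrightarrow> g' \<in> hom C Y' Y'' \<Longrightarrow>
          (f' \<cdot> f) \<odot> (g' \<cdot> g) = (f' \<odot> g') \<cdot> (f \<odot> g)"
    and assoc_hom: "X \<in> Obj C \<Longrightarrow> Y \<in> Obj C \<Longrightarrow> Z \<in> Obj C \<Longrightarrow>
          assoc C X Y Z \<in> hom C ((X \<otimes> Y) \<otimes> Z) (X \<otimes> (Y \<otimes> Z))"
    and assoc_iso: "X \<in> Obj C \<Longrightarrow> Y \<in> Obj C \<Longrightarrow> Z \<in> Obj C \<Longrightarrow> is_iso C (assoc C X Y Z)"
    and assoc_natural: "f \<in> hom C X X' \<Longrightarrow> g \<in> hom C Y Y' \<Longrightarrow> h \<in> hom C Z Z' \<Longrightarrow>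
          assoc C X' Y' Z' \<cdot> ((f \<odot> g) \<odot> h) = (f \<odot> (g \<odot> h)) \<cdot> assoc C X Y Z"
    and lunit_hom: "X \<in> Obj C \<Longrightarrow> lunit C X \<in> hom C (unt C \<otimes> X) X"
    and lunit_iso: "X \<in> Obj C \<Longrightarrow> is_iso C (lunit C X)"
    and lunit_natural: "f \<in> hom C X X' \<Longrightarrow>
          lunit C X' \<cdot> (Idn C (unt C) \<odot> f) = f \<cdot> lunit C X"
    and runit_hom: "X \<in> Obj C \<Longrightarrow> runit C X \<in> hom C (X \<otimes> unt C) X"
    and runit_iso: "X \<in> Obj C \<Longrightarrow> is_iso C (runit C X)"
    and runit_natural: "f \<in> hom C X X' \<Longrightarrow>
          runit C X' \<cdot> (f \<odot> Idn C (unt C)) = f \<cdot> runit C X"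
    and swap_hom: "X \<in> Obj C \<Longrightarrow> Y \<in> Obj C \<Longrightarrow> swap C X Y \<in> hom C (X \<otimes> Y) (Y \<otimes> X)"
    and swap_natural: "f \<in> hom C X X' \<Longrightarrow> g \<in> hom C Y Y' \<Longrightarrow>
          swap C X' Y' \<cdot> (f \<odot> g) = (g \<odot> f) \<cdot> swap C X Y"
    and swap_swap: "X \<in> Obj C \<Longrightarrow> Y \<in> Obj C \<Longrightarrow> swap C Y X \<cdot> swap C X Y = Idn C (X \<otimes> Y)"
    and pentagon: "W \<in> Obj C \<Longrightarrow> X \<in> Obj C \<Longrightarrow> Y \<in> Obj C \<Longrightarrow> Z \<in> Obj C \<Longrightarrow>
          assoc C W X (Y \<otimes> Z) \<cdot> assoc C (W \<otimes> X) Y Z =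
          (Idn C W \<odot> assoc C X Y Z) \<cdot> assoc C W (X \<otimes> Y) Z \<cdot> (assoc C W X Y \<odot> Idn C Z)"
    and triangle: "X \<in> Obj C \<Longrightarrow> Y \<in> Obj C \<Longrightarrow>
          (Idn C X \<odot> lunit C Y) \<cdot> assoc C X (unt C) Y = runit C X \<odot> Idn C Y"
    and hexagon: "X \<in> Obj C \<Longrightarrow> Y \<in> Obj C \<Longrightarrow> Z \<in> Obj C \<Longrightarrow>
          assoc C Y Z X \<cdot> swap C X (Y \<otimes> Z) \<cdot> assoc C X Y Z =
          (Idn C Y \<odot> swap C X Z) \<cdot> assoc C Y X Z \<cdot> (swap C X Y \<odot> Idn C Z)"

definition middle_swap :: "('o, 'm, 'x) markov_scheme \<Rightarrow> 'o \<Rightarrow> 'o \<Rightarrow> 'm" where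
  \<comment> \<open>the coherence map from \<open>(X \<otimes> X) \<otimes> (Y \<otimes> Y)\<close> to \<open>(X \<otimes> Y) \<otimes> (X \<otimes> Y)\<close> exchanging
     the two middle factors\<close>
  "middle_swap C X Y =
     inv_arr C (assoc C X Y (X \<otimes>\<^bsub>C\<^esub> Y)) \<cdot>\<^bsub>C\<^esub>
     (Idn C X \<odot>\<^bsub>C\<^esub>
        (assoc C Y X Y \<cdot>\<^bsub>C\<^esub> (swap C X Y \<odot>\<^bsub>C\<^esub> Idn C Y) \<cdot>\<^bsub>C\<^esub> inv_arr C (assoc C X Y Y))) \<cdot>\<^bsub>C\<^esub>
     assoc C X X (Y \<otimes>\<^bsub>C\<^esub> Y)"

locale markov_category = symmetric_monoidal_category C
  for C :: "('o, 'm, 'x) markov_scheme" (structure) +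
  assumes copy_hom: "X \<in> Obj C \<Longrightarrow> copy C X \<in> hom C X (X \<otimes> X)"
    and del_hom: "X \<in> Obj C \<Longrightarrow> del C X \<in> hom C X (unt C)"
    and unt_terminal: "f \<in> hom C X (unt C) \<Longrightarrow> f = del C X"
    and copy_assoc: "X \<in> Obj C \<Longrightarrow>
          assoc C X X X \<cdot> (copy C X \<odot> Idn C X) \<cdot> copy C X = (Idn C X \<odot> copy C X) \<cdot> copy C X"
    and copy_comm: "X \<in> Obj C \<Longrightarrow> swap C X X \<cdot> copy C X = copy C X"
    and copy_lunit: "X \<in> Obj C \<Longrightarrow> lunit C X \<cdot> (del C X \<odot> Idn C X) \<cdot> copy C X = Idn C X"
    and copy_runit: "X \<in> Obj C \<Longrightarrow> runit C X \<cdot> (Idn C X \<odot> del C X) \<cdot> copy C X = Idn C X"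
    and copy_tenO: "X \<in> Obj C \<Longrightarrow> Y \<in> Obj C \<Longrightarrow>
          copy C (X \<otimes> Y) = middle_swap C X Y \<cdot> (copy C X \<odot> copy C Y)"
    and del_tenO: "X \<in> Obj C \<Longrightarrow> Y \<in> Obj C \<Longrightarrow>
          del C (X \<otimes> Y) = lunit C (unt C) \<cdot> (del C X \<odot> del C Y)"
    and copy_unt: "lunit C (unt C) \<cdot> copy C (unt C) = Idn C (unt C)"
    and del_unt: "del C (unt C) = Idn C (unt C)"

definition deterministic :: "('o, 'm, 'x) markov_scheme \<Rightarrow> 'm \<Rightarrow> bool" where
  "deterministic C f \<longleftrightarrow> f \<in> Arr C \<and>
     copy C (Cod C f) \<cdot>\<^bsub>C\<^esub> f = (f \<odot>\<^bsub>C\<^esub> f) \<cdot>\<^bsub>C\<^esub> copy C (Dom C f)"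

definition Det :: "('o, 'm, 'x) markov_scheme \<Rightarrow> ('o, 'm, 'x) markov_scheme" where
  "Det C = C\<lparr>Arr := {f. deterministic C f}\<rparr>"

section \<open>Smallness\<close>

text \<open>
  \<open>Sm A\<close> means that the subset \<open>A\<close> of the type \<open>'u\<close> is small. The conditions hold when \<open>'u\<close> is
  a Grothendieck universe with infinite elements and the small sets are its elements; they also
  hold when \<open>'u\<close> is any infinite type and all its subsets are small. Families, index
  categories and their constituents are taken from \<open>'u\<close>; the category \<open>\<C>\<close> itself is not required
  to be small.
\<close>

definition smallness :: "('u set \<Rightarrow> bool) \<Rightarrow> bool" where
  "smallness Sm \<longleftrightarrow>
     (\<exists>A. Sm A \<and> infinite A) \<and>
     (\<forall>A B. Sm A \<longrightarrow> B \<subseteq> A \<longrightarrow> Sm B) \<and>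
     (\<forall>A (f :: 'u \<Rightarrow> 'u). Sm A \<longrightarrow> Sm (f ` A)) \<and>
     (\<forall>A (B :: 'u \<Rightarrow> 'u set). Sm A \<longrightarrow> (\<forall>a\<in>A. Sm (B a)) \<longrightarrow> Sm (\<Union>a\<in>A. B a))"

text \<open>
  Ordered pairs inside \<open>'u\<close>, used to index binary products of diagrams. An injection exists
  since \<open>'u\<close> is infinite whenever it carries a notion of smallness.
\<close>

definition upair :: "'u \<Rightarrow> 'u \<Rightarrow> 'u" where
  "upair = (SOME p. inj (case_prod p))"

definition ufst :: "'u \<Rightarrow> 'u" where
  "ufst c = fst (inv (case_prod upair) c)"

definition usnd :: "'u \<Rightarrow> 'u" where
  "usnd c = snd (inv (case_prod upair) c)"

definition prod_cat :: "('u, 'u) cat \<Rightarrow> ('u, 'u) cat \<Rightarrow> ('u, 'u) cat" where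
  "prod_cat J K =
     \<lparr>Obj = {upair i k | i k. i \<in> Obj J \<and> k \<in> Obj K},
      Arr = {upair a b | a b. a \<in> Arr J \<and> b \<in> Arr K},
      Dom = (\<lambda>c. upair (Dom J (ufst c)) (Dom K (usnd c))),
      Cod = (\<lambda>c. upair (Cod J (ufst c)) (Cod K (usnd c))),
      Idn = (\<lambda>c. upair (Idn J (ufst c)) (Idn K (usnd c))),
      Cmp = (\<lambda>d c. upair (ufst d \<cdot>\<^bsub>J\<^esub> ufst c) (usnd d \<cdot>\<^bsub>K\<^esub> usnd c))\<rparr>"

definition one_cat :: "('u, 'u) cat" where
  "one_cat = \<lparr>Obj = {undefined}, Arr = {undefined}, Dom = (\<lambda>_. undefined), Cod = (\<lambda>_. undefined),
      Idn = (\<lambda>_. undefined), Cmp = (\<lambda>_ _. undefined)\<rparr>"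

section \<open>Pro-objects\<close>

text \<open>
  A pro-object is a small cofiltered diagram, standing for its formal limit.
\<close>

record ('u, 'o, 'm) diagram =
  Shape :: "('u, 'u) cat"
  onObj :: "'u \<Rightarrow> 'o"
  onArr :: "'u \<Rightarrow> 'm"

definition pro_object ::
  "('u set \<Rightarrow> bool) \<Rightarrow> ('o, 'm, 'x) cat_scheme \<Rightarrow> ('u, 'o, 'm) diagram \<Rightarrow> bool" where
  "pro_object Sm C X \<longleftrightarrow> Sm (Obj (Shape X)) \<and> Sm (Arr (Shape X)) \<and> cofiltered (Shape X) \<and>
     is_functor (Shape X) C (onObj X) (onArr X)"

text \<open>
  The set \<open>colim\<^sub>i \<C>(X\<^sub>i, B)\<close> is the quotient of the pairs \<open>(i, f)\<close> with \<open>f : X\<^sub>i \<rightarrow> B\<close> by the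
  equivalence relation generated by \<open>(i, f) \<sim> (i', f \<circ> X(a))\<close> for \<open>a : i' \<rightarrow> i\<close>.
\<close>

definition colim_step ::
  "('o, 'm, 'x) cat_scheme \<Rightarrow> ('u, 'o, 'm) diagram \<Rightarrow> ('u \<times> 'm) rel" where
  "colim_step C X = {((i, f), (i', f \<cdot>\<^bsub>C\<^esub> onArr X a)) | i i' f a.
     a \<in> hom (Shape X) i' i \<and> f \<in> Arr C \<and> Dom C f = onObj X i}"

definition colim_eq ::
  "('o, 'm, 'x) cat_scheme \<Rightarrow> ('u, 'o, 'm) diagram \<Rightarrow> ('u \<times> 'm) rel" where
  "colim_eq C X = (colim_step C X \<union> (colim_step C X)\<inverse>)\<^sup>*"

definition colim_hom ::
  "('o, 'm, 'x) cat_scheme \<Rightarrow> ('u, 'o, 'm) diagram \<Rightarrow> 'o \<Rightarrow> ('u \<times> 'm) set set" where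
  "colim_hom C X B = {(i, f). i \<in> Obj (Shape X) \<and> f \<in> hom C (onObj X i) B} // colim_eq C X"

definition germ ::
  "('o, 'm, 'x) cat_scheme \<Rightarrow> ('u, 'o, 'm) diagram \<Rightarrow> 'u \<Rightarrow> 'm \<Rightarrow> ('u \<times> 'm) set" where
  "germ C X i f = colim_eq C X `` {(i, f)}"

text \<open>
  Below, operations on classes are written as unions over representatives. For the arguments of
  interest all the classes in such a union coincide.
\<close>

definition germ_push ::
  "('o, 'm, 'x) cat_scheme \<Rightarrow> ('u, 'o, 'm) diagram \<Rightarrow> 'm \<Rightarrow> ('u \<times> 'm) set \<Rightarrow> ('u \<times> 'm) set" where
  "germ_push C X g c = (\<Union>(i, f)\<in>c. germ C X i (g \<cdot>\<^bsub>C\<^esub> f))"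

record ('u, 'o, 'm) promor =
  Src :: "('u, 'o, 'm) diagram"
  Tgt :: "('u, 'o, 'm) diagram"
  Comps :: "'u \<Rightarrow> ('u \<times> 'm) set"

text \<open>
  The components are set to \<open>{}\<close> outside the index category of the target, so that equality of
  morphisms is equality of records.
\<close>

definition mk_promor ::
  "('u, 'o, 'm) diagram \<Rightarrow> ('u, 'o, 'm) diagram \<Rightarrow> ('u \<Rightarrow> ('u \<times> 'm) set) \<Rightarrow>
   ('u, 'o, 'm) promor" where
  "mk_promor X Y c =
     \<lparr>Src = X, Tgt = Y, Comps = (\<lambda>j. if j \<in> Obj (Shape Y) then c j else {})\<rparr>"

definition pro_arrow :: "('o, 'm, 'x) cat_scheme \<Rightarrow> ('u, 'o, 'm) promor \<Rightarrow> bool" where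
  \<comment> \<open>elements of \<open>lim\<^sub>j colim\<^sub>i \<C>(X\<^sub>i, Y\<^sub>j)\<close>\<close>
  "pro_arrow C \<phi> \<longleftrightarrow>
     (\<forall>j\<in>Obj (Shape (Tgt \<phi>)). Comps \<phi> j \<in> colim_hom C (Src \<phi>) (onObj (Tgt \<phi>) j)) \<and>
     (\<forall>j. j \<notin> Obj (Shape (Tgt \<phi>)) \<longrightarrow> Comps \<phi> j = {}) \<and>
     (\<forall>j j' b. b \<in> hom (Shape (Tgt \<phi>)) j j' \<longrightarrow>
        germ_push C (Src \<phi>) (onArr (Tgt \<phi>) b) (Comps \<phi> j) = Comps \<phi> j')"

definition pro_id ::
  "('o, 'm, 'x) cat_scheme \<Rightarrow> ('u, 'o, 'm) diagram \<Rightarrow> ('u, 'o, 'm) promor" where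
  "pro_id C X = mk_promor X X (\<lambda>i. germ C X i (Idn C (onObj X i)))"

definition pro_comp ::
  "('o, 'm, 'x) cat_scheme \<Rightarrow> ('u, 'o, 'm) promor \<Rightarrow> ('u, 'o, 'm) promor \<Rightarrow>
   ('u, 'o, 'm) promor" where
  "pro_comp C \<psi> \<phi> = mk_promor (Src \<phi>) (Tgt \<psi>)
     (\<lambda>k. \<Union>(j, g)\<in>Comps \<psi> k. germ_push C (Src \<phi>) g (Comps \<phi> j))"

definition Pro ::
  "('u set \<Rightarrow> bool) \<Rightarrow> ('o, 'm, 'x) cat_scheme \<Rightarrow>
   (('u, 'o, 'm) diagram, ('u, 'o, 'm) promor) cat" where
  "Pro Sm C =
     \<lparr>Obj = {X. pro_object Sm C X},
      Arr = {\<phi>. pro_object Sm C (Src \<phi>) \<and> pro_object Sm C (Tgt \<phi>) \<and> pro_arrow C \<phi>},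
      Dom = Src,
      Cod = Tgt,
      Idn = pro_id C,
      Cmp = pro_comp C\<rparr>"

section \<open>The Markov category of deterministic diagrams\<close>

text \<open>
  The tensor product \<open>lim\<^sub>i X\<^sub>i \<otimes> lim\<^sub>j Y\<^sub>j\<close> is \<open>lim\<^sub>i\<^sub>,\<^sub>j X\<^sub>i \<otimes> Y\<^sub>j\<close>. The pairs of structure maps
  \<open>X \<rightarrow> X\<^sub>i\<close>, \<open>Y \<rightarrow> Y\<^sub>j\<close> form an initial subdiagram of the category of all pairs of maps in
  \<open>Pro(det(\<C>))\<close> from \<open>X\<close> and \<open>Y\<close> to objects of \<open>\<C>\<close>, so that a limit over the latter gives the
  same pro-object, but the latter category need not be small.
\<close>

definition pro_tenO ::
  "('o, 'm, 'x) markov_scheme \<Rightarrow> ('u, 'o, 'm) diagram \<Rightarrow> ('u, 'o, 'm) diagram \<Rightarrow>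
   ('u, 'o, 'm) diagram" where
  "pro_tenO C X Y =
     \<lparr>Shape = prod_cat (Shape X) (Shape Y),
      onObj = (\<lambda>c. onObj X (ufst c) \<otimes>\<^bsub>C\<^esub> onObj Y (usnd c)),
      onArr = (\<lambda>c. onArr X (ufst c) \<odot>\<^bsub>C\<^esub> onArr Y (usnd c))\<rparr>"

definition pro_tenA ::
  "('o, 'm, 'x) markov_scheme \<Rightarrow> ('u, 'o, 'm) promor \<Rightarrow> ('u, 'o, 'm) promor \<Rightarrow>
   ('u, 'o, 'm) promor" where
  "pro_tenA C \<phi> \<psi> = mk_promor (pro_tenO C (Src \<phi>) (Src \<psi>)) (pro_tenO C (Tgt \<phi>) (Tgt \<psi>))
     (\<lambda>c. \<Union>(i, f)\<in>Comps \<phi> (ufst c). \<Union>(k, g)\<in>Comps \<psi> (usnd c).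
        germ C (pro_tenO C (Src \<phi>) (Src \<psi>)) (upair i k) (f \<odot>\<^bsub>C\<^esub> g))"

definition pro_unt :: "('o, 'm, 'x) markov_scheme \<Rightarrow> ('u, 'o, 'm) diagram" where
  "pro_unt C = \<lparr>Shape = one_cat, onObj = (\<lambda>_. unt C), onArr = (\<lambda>_. Idn C (unt C))\<rparr>"

definition pro_assoc ::
  "('o, 'm, 'x) markov_scheme \<Rightarrow> ('u, 'o, 'm) diagram \<Rightarrow> ('u, 'o, 'm) diagram \<Rightarrow>
   ('u, 'o, 'm) diagram \<Rightarrow> ('u, 'o, 'm) promor" where
  "pro_assoc C X Y Z =
     mk_promor (pro_tenO C (pro_tenO C X Y) Z) (pro_tenO C X (pro_tenO C Y Z))
       (\<lambda>c. let i = ufst c; j = ufst (usnd c); k = usnd (usnd c) in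
          germ C (pro_tenO C (pro_tenO C X Y) Z) (upair (upair i j) k)
            (assoc C (onObj X i) (onObj Y j) (onObj Z k)))"

definition pro_lunit ::
  "('o, 'm, 'x) markov_scheme \<Rightarrow> ('u, 'o, 'm) diagram \<Rightarrow> ('u, 'o, 'm) promor" where
  "pro_lunit C X = mk_promor (pro_tenO C (pro_unt C) X) X
     (\<lambda>i. germ C (pro_tenO C (pro_unt C) X) (upair undefined i) (lunit C (onObj X i)))"

definition pro_runit ::
  "('o, 'm, 'x) markov_scheme \<Rightarrow> ('u, 'o, 'm) diagram \<Rightarrow> ('u, 'o, 'm) promor" where
  "pro_runit C X = mk_promor (pro_tenO C X (pro_unt C)) X
     (\<lambda>i. germ C (pro_tenO C X (pro_unt C)) (upair i undefined) (runit C (onObj X i)))"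

definition pro_swap ::
  "('o, 'm, 'x) markov_scheme \<Rightarrow> ('u, 'o, 'm) diagram \<Rightarrow> ('u, 'o, 'm) diagram \<Rightarrow>
   ('u, 'o, 'm) promor" where
  "pro_swap C X Y = mk_promor (pro_tenO C X Y) (pro_tenO C Y X)
     (\<lambda>c. let j = ufst c; i = usnd c in
        germ C (pro_tenO C X Y) (upair i j) (swap C (onObj X i) (onObj Y j)))"

text \<open>
  At the pair \<open>(i, i')\<close>, the component of the copy map is
  \<open>X \<rightarrow> X\<^sub>k \<rightarrow> X\<^sub>k \<otimes> X\<^sub>k \<rightarrow> X\<^sub>i \<otimes> X\<^sub>i\<^sub>'\<close> for any \<open>k\<close> over both \<open>i\<close> and \<open>i'\<close>; on the diagonal this is
  \<open>X \<rightarrow> X\<^sub>i \<rightarrow> X\<^sub>i \<otimes> X\<^sub>i\<close>.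
\<close>

definition pro_copy ::
  "('o, 'm, 'x) markov_scheme \<Rightarrow> ('u, 'o, 'm) diagram \<Rightarrow> ('u, 'o, 'm) promor" where
  "pro_copy C X = mk_promor X (pro_tenO C X X)
     (\<lambda>c. \<Union>k\<in>Obj (Shape X). \<Union>a\<in>hom (Shape X) k (ufst c). \<Union>b\<in>hom (Shape X) k (usnd c).
        germ C X k ((onArr X a \<odot>\<^bsub>C\<^esub> onArr X b) \<cdot>\<^bsub>C\<^esub> copy C (onObj X k)))"

definition pro_del ::
  "('o, 'm, 'x) markov_scheme \<Rightarrow> ('u, 'o, 'm) diagram \<Rightarrow> ('u, 'o, 'm) promor" where
  "pro_del C X = mk_promor X (pro_unt C) (\<lambda>_. \<Union>i\<in>Obj (Shape X). germ C X i (del C (onObj X i)))"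

definition ProDet ::
  "('u set \<Rightarrow> bool) \<Rightarrow> ('o, 'm, 'x) markov_scheme \<Rightarrow>
   (('u, 'o, 'm) diagram, ('u, 'o, 'm) promor) markov" where
  "ProDet Sm C =
     cat.extend
       (full_subcat (Pro Sm C) {X. is_functor (Shape X) (Det C) (onObj X) (onArr X)})
       (markov.fields (pro_tenO C) (pro_tenA C) (pro_unt C) (pro_assoc C) (pro_lunit C)
          (pro_runit C) (pro_swap C) (pro_copy C) (pro_del C))"

section \<open>Kolmogorov products\<close>

text \<open>
  The index set \<open>I\<close> is linearly ordered by \<open>r\<close>, and \<open>X\<^sup>F\<close> for \<open>F = {i\<^sub>1 < \<dots> < i\<^sub>n}\<close> is bracketed as
  \<open>X\<^sub>i\<^sub>1 \<otimes> (X\<^sub>i\<^sub>2 \<otimes> (\<dots> \<otimes> (X\<^sub>i\<^sub>n \<otimes> 1)))\<close>. With this convention marginalization maps are built from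
  \<open>del\<close> and left unitors only, and no permutation of factors is needed.
\<close>

definition sorted_enum :: "'i rel \<Rightarrow> 'i set \<Rightarrow> 'i list" where
  "sorted_enum r F = (THE xs. set xs = F \<and> distinct xs \<and> sorted_wrt (\<lambda>i j. (i, j) \<in> r) xs)"

primrec ten_list :: "('o, 'm, 'x) markov_scheme \<Rightarrow> ('i \<Rightarrow> 'o) \<Rightarrow> 'i list \<Rightarrow> 'o" where
  "ten_list M X [] = unt M"
| "ten_list M X (i # is) = X i \<otimes>\<^bsub>M\<^esub> ten_list M X is"

primrec marg_list :: "('o, 'm, 'x) markov_scheme \<Rightarrow> ('i \<Rightarrow> 'o) \<Rightarrow> 'i set \<Rightarrow> 'i list \<Rightarrow> 'm" where
  \<comment> \<open>keeps the factors with index in \<open>F\<close>\<close>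
  "marg_list M X F [] = Idn M (unt M)"
| "marg_list M X F (i # is) =
     (if i \<in> F then Idn M (X i) \<odot>\<^bsub>M\<^esub> marg_list M X F is
      else lunit M (ten_list M X (filter (\<lambda>j. j \<in> F) is)) \<cdot>\<^bsub>M\<^esub> (del M (X i) \<odot>\<^bsub>M\<^esub> marg_list M X F is))"

definition fin_ten ::
  "('o, 'm, 'x) markov_scheme \<Rightarrow> 'i rel \<Rightarrow> ('i \<Rightarrow> 'o) \<Rightarrow> 'i set \<Rightarrow> 'o" where
  "fin_ten M r X F = ten_list M X (sorted_enum r F)"

definition marginalization ::
  "('o, 'm, 'x) markov_scheme \<Rightarrow> 'i rel \<Rightarrow> ('i \<Rightarrow> 'o) \<Rightarrow> 'i set \<Rightarrow> 'i set \<Rightarrow> 'm" where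
  \<comment> \<open>from \<open>X\<^bsup>F'\<^esup>\<close> to \<open>X\<^sup>F\<close>, where \<open>F \<subseteq> F'\<close>\<close>
  "marginalization M r X F' F = marg_list M X F (sorted_enum r F')"

definition fin_subsets :: "'i set \<Rightarrow> ('i set, 'i set \<times> 'i set) cat" where
  \<comment> \<open>an inclusion \<open>F \<subseteq> F'\<close> is an arrow \<open>F' \<rightarrow> F\<close>, represented by \<open>(F', F)\<close>\<close>
  "fin_subsets I =
     \<lparr>Obj = {F. finite F \<and> F \<subseteq> I},
      Arr = {(F', F). finite F' \<and> F' \<subseteq> I \<and> F \<subseteq> F'},
      Dom = fst,
      Cod = snd,
      Idn = (\<lambda>F. (F, F)),
      Cmp = (\<lambda>b a. (fst a, snd b))\<rparr>"

definition infinite_tensor_product ::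
  "('o, 'm, 'x) markov_scheme \<Rightarrow> 'i set \<Rightarrow> 'i rel \<Rightarrow> ('i \<Rightarrow> 'o) \<Rightarrow> 'o \<Rightarrow> ('i set \<Rightarrow> 'm) \<Rightarrow> bool" where
  "infinite_tensor_product M I r X L \<pi> \<longleftrightarrow>
     is_limit_cone (fin_subsets I) M (fin_ten M r X) (\<lambda>(F', F). marginalization M r X F' F) L \<pi> \<and>
     (\<forall>Y\<in>Obj M.
        is_limit_cone (fin_subsets I) M
          (\<lambda>F. fin_ten M r X F \<otimes>\<^bsub>M\<^esub> Y)
          (\<lambda>(F', F). marginalization M r X F' F \<odot>\<^bsub>M\<^esub> Idn M Y)
          (L \<otimes>\<^bsub>M\<^esub> Y)
          (\<lambda>F. \<pi> F \<odot>\<^bsub>M\<^esub> Idn M Y))"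

definition kolmogorov_product ::
  "('o, 'm, 'x) markov_scheme \<Rightarrow> 'i set \<Rightarrow> 'i rel \<Rightarrow> ('i \<Rightarrow> 'o) \<Rightarrow> 'o \<Rightarrow> ('i set \<Rightarrow> 'm) \<Rightarrow> bool" where
  "kolmogorov_product M I r X L \<pi> \<longleftrightarrow> infinite_tensor_product M I r X L \<pi> \<and>
     (\<forall>F. finite F \<longrightarrow> F \<subseteq> I \<longrightarrow> deterministic M (\<pi> F))"

end

theory Submission
  imports Defs
begin

text \<open>
  The Kolmogorov product is written down as an explicit diagram. For a finite set \<open>F\<close> of indices,
  \<open>X\<^sup>F\<close> is a diagram whose indices are the tuples with one index of \<open>X\<^sub>i\<close> for each \<open>i \<in> F\<close>. For
  \<open>F \<subseteq> F'\<close> the marginalization map is given levelwise: forgetting coordinates sends a tuple over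
  \<open>F'\<close> to one over \<open>F\<close>, and discarding tensor factors in \<open>\<C>\<close> maps the object at the former to the
  object at the latter (\<open>marg_list_level\<close>). Forgetting coordinates is functorial, surjective, and
  lifts arrows, so the index categories of the \<open>X\<^sup>F\<close> form a fibration over the finite subsets.
  The product \<open>L\<close> is indexed by the total category of this fibration: an index is a pair \<open>(F, c)\<close> of
  a finite set and a tuple over it, the object there is that of \<open>X\<^sup>F\<close> at \<open>c\<close>, and an arrow marginalizes
  and then moves inside \<open>X\<^sup>F\<close>. This category is small and cofiltered, and its arrows act by
  deterministic morphisms, since discarding a factor is deterministic. The only point that needs
  coherence is that the left unitor is deterministic (\<open>deterministic_lunit\<close>); it rests on Kelly's
  identities for unitors.

  The universal property is then almost immediate. The projection \<open>\<pi>\<^sub>F\<close> is represented at \<open>c\<close> by the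
  identity of the object at \<open>(F, c)\<close>. Hence a morphism into \<open>L\<close> is a family of components indexed by
  the pairs \<open>(F, c)\<close>, that is, a family of morphisms into the \<open>X\<^sup>F\<close>, and compatibility with the arrows
  of \<open>L\<close> says precisely that this family is a cone (\<open>limit_cone\<close>). For the same reason the
  projections are deterministic. The argument uses \<open>L\<close> only through a description of its
  indices and arrows in terms of those of the \<open>X\<^sup>F\<close>, which is the locale \<open>level_limit\<close>. If \<open>L\<close> has such a
  description over the \<open>X\<^sup>F\<close>, then \<open>L \<otimes> Y\<close> has one over the \<open>X\<^sup>F \<otimes> Y\<close>
  (\<open>level_limit_tenO\<close>), so the limit is preserved by \<open>- \<otimes> Y\<close>.

  Calculations in the pro-category are reduced to \<open>\<C>\<close> by computing the components of composites, tensor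
  products and structure maps on representatives. Independence of the representative of a
  germ is an instance of \<open>germ_UN\<close>, the universal property of the colimits of hom-sets.
\<close>

section \<open>Small sets and pairing\<close>

lemma inj_upair:
  assumes "smallness (Sm :: 'u set \<Rightarrow> bool)"
  shows "inj (case_prod (upair :: 'u \<Rightarrow> 'u \<Rightarrow> 'u))"
proof -
  have "infinite (UNIV :: 'u set)"
    using assms infinite_super[OF subset_UNIV] unfolding smallness_def by blast
  then obtain h :: "'u \<times> 'u \<Rightarrow> 'u" where "bij_betw h (UNIV \<times> UNIV) UNIV"
    using card_of_Times_same_infinite card_of_ordIso by blast
  then have "inj h" by (simp add: bij_betw_def)
  then have "inj (case_prod (curry h))"
    by simp
  then show ?thesis
    unfolding upair_def by (rule someI[of "\<lambda>p. inj (case_prod p)"])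
qed

locale small_universe =
  fixes Sm :: "'u set \<Rightarrow> bool"
  assumes smallness: "smallness Sm"
begin

lemma ufst_upair [simp]: "ufst (upair a b :: 'u) = a"
  and usnd_upair [simp]: "usnd (upair a b :: 'u) = b"
proof -
  have "inv (case_prod upair) (case_prod upair (a, b) :: 'u) = (a, b)"
    by (rule inv_f_f[OF inj_upair[OF smallness]])
  then show "ufst (upair a b :: 'u) = a" "usnd (upair a b :: 'u) = b"
    by (simp_all add: ufst_def usnd_def)
qed

lemma upair_eq_iff [simp]: "upair a b = (upair c d :: 'u) \<longleftrightarrow> a = c \<and> b = d"
  by (metis ufst_upair usnd_upair)

lemma Sm_subset: "Sm A \<Longrightarrow> B \<subseteq> A \<Longrightarrow> Sm B"
  using smallness unfolding smallness_def by blast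

lemma Sm_image: "Sm A \<Longrightarrow> Sm ((f :: 'u \<Rightarrow> 'u) ` A)"
  using smallness unfolding smallness_def by blast

lemma Sm_UN: "Sm A \<Longrightarrow> (\<And>a. a \<in> A \<Longrightarrow> Sm (B a)) \<Longrightarrow> Sm (\<Union>a\<in>A. (B :: 'u \<Rightarrow> 'u set) a)"
  using smallness unfolding smallness_def by blast

lemma Sm_singleton: "Sm {x}"
proof -
  obtain A :: "'u set" where A: "Sm A" "infinite A"
    using smallness unfolding smallness_def by blast
  then have "{x} = (\<lambda>_. x) ` A" using infinite_imp_nonempty by auto
  then show ?thesis using Sm_image[OF A(1), of "\<lambda>_. x"] by simp
qed

lemma Sm_upairs:
  assumes "Sm A" "Sm B"
  shows "Sm {upair a b | a b. a \<in> A \<and> b \<in> B}"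
proof -
  have "{upair a b | a b. a \<in> A \<and> b \<in> B} = (\<Union>a\<in>A. upair a ` B)" by auto
  then show ?thesis using assms by (simp add: Sm_UN Sm_image)
qed

text \<open>
  A small infinite set contains a copy of the natural numbers, which provides small countable unions.
\<close>

lemma ex_small_nat_embedding: "\<exists>n :: nat \<Rightarrow> 'u. inj n \<and> Sm (range n)"
proof -
  obtain A :: "'u set" where A: "Sm A" "infinite A"
    using smallness unfolding smallness_def by blast
  then obtain n :: "nat \<Rightarrow> 'u" where "inj n" "range n \<subseteq> A"
    using infinite_countable_subset by blast
  then show ?thesis using Sm_subset[OF A(1)] by blast
qed

text \<open>
  A list is coded by its length together with the iterated pairing of its entries; the length
  is recorded because iterated pairing alone is injective only on lists of equal length.
\<close>

lemma ex_small_list_code: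
  assumes I: "Sm I"
  shows "\<exists>code :: 'u list \<Rightarrow> 'u. inj code \<and> Sm (code ` lists I)"
proof -
  obtain n :: "nat \<Rightarrow> 'u" where n: "inj n" "Sm (range n)"
    using ex_small_nat_embedding by blast
  define pairing where "pairing xs = foldr upair xs (n 0)" for xs
  define code where "code xs = upair (n (length xs)) (pairing xs)" for xs
  have pairing_inj: "length xs = length ys \<Longrightarrow> pairing xs = pairing ys \<Longrightarrow> xs = ys" for xs ys
    by (induction xs ys rule: list_induct2) (simp_all add: pairing_def)
  have "inj code"
    by (rule injI) (use n(1) pairing_inj in \<open>auto simp: code_def inj_eq\<close>)
  moreover have "Sm (pairing ` {xs \<in> lists I. length xs = k})" for k
  proof (induction k)
    case 0
    have "pairing ` {xs \<in> lists I. length xs = 0} \<subseteq> {n 0}" by (auto simp: pairing_def)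
    then show ?case using Sm_singleton Sm_subset by blast
  next
    case (Suc k)
    have "pairing ` {xs \<in> lists I. length xs = Suc k}
        \<subseteq> {upair x y | x y. x \<in> I \<and> y \<in> pairing ` {xs \<in> lists I. length xs = k}}"
      by (fastforce simp: pairing_def length_Suc_conv)
    then show ?case using Sm_subset[OF Sm_upairs[OF I Suc]] by blast
  qed
  then have "Sm (\<Union>u\<in>range n. pairing ` {xs \<in> lists I. length xs = inv n u})"
    using n by (intro Sm_UN) auto
  from Sm_upairs[OF n(2) this] have "Sm (code ` lists I)"
    by (rule Sm_subset) (use n(1) in \<open>fastforce simp: code_def\<close>)
  ultimately show ?thesis by blast
qed

end

section \<open>Determinism in a Markov category\<close>

lemma homI: "f \<in> Arr C \<Longrightarrow> Dom C f = X \<Longrightarrow> Cod C f = Y \<Longrightarrow> f \<in> hom C X Y"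
  by (simp add: hom_def)

lemma homD: "f \<in> hom C X Y \<Longrightarrow> f \<in> Arr C" "f \<in> hom C X Y \<Longrightarrow> Dom C f = X"
  "f \<in> hom C X Y \<Longrightarrow> Cod C f = Y"
  by (simp_all add: hom_def)

context category
begin

lemma hom_Obj: "f \<in> hom C X Y \<Longrightarrow> X \<in> Obj C" "f \<in> hom C X Y \<Longrightarrow> Y \<in> Obj C"
  using Dom_Obj Cod_Obj by (auto simp: hom_def)

lemma inverse_arrows_unique:
  assumes "inverse_arrows C f g" "inverse_arrows C f h"
  shows "g = h"
proof -
  have f: "f \<in> hom C (Dom C f) (Cod C f)"
    and g: "g \<in> hom C (Cod C f) (Dom C f)" and h: "h \<in> hom C (Cod C f) (Dom C f)"
    using assms by (auto simp: inverse_arrows_def hom_def)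
  have "g = g \<cdot> (f \<cdot> h)"
    using assms(2) Idn_right[OF g] by (simp add: inverse_arrows_def)
  also have "\<dots> = (g \<cdot> f) \<cdot> h" using Cmp_assoc[OF h f g] by simp
  also have "\<dots> = h" using assms(1) Idn_left[OF h] by (simp add: inverse_arrows_def)
  finally show ?thesis .
qed

lemma inv_arr:
  assumes "is_iso C f" "f \<in> hom C X Y"
  shows "inv_arr C f \<in> hom C Y X" "inv_arr C f \<cdot> f = Idn C X" "f \<cdot> inv_arr C f = Idn C Y"
proof -
  have "\<exists>!g. inverse_arrows C f g"
    using assms(1) inverse_arrows_unique unfolding is_iso_def by blast
  then have "inverse_arrows C f (inv_arr C f)"
    unfolding inv_arr_def by (rule theI')
  then show "inv_arr C f \<in> hom C Y X" "inv_arr C f \<cdot> f = Idn C X" "f \<cdot> inv_arr C f = Idn C Y"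
    using assms(2) by (auto simp: inverse_arrows_def hom_def)
qed

lemma iso_cancel_right:
  assumes "is_iso C e" "e \<in> hom C W X" "f \<in> hom C X Y" "g \<in> hom C X Y" "f \<cdot> e = g \<cdot> e"
  shows "f = g"
proof -
  note i = inv_arr[OF assms(1,2)]
  have "(f \<cdot> e) \<cdot> inv_arr C e = (g \<cdot> e) \<cdot> inv_arr C e" using assms by simp
  then show ?thesis
    using Cmp_assoc[OF i(1) assms(2,3)] Cmp_assoc[OF i(1) assms(2,4)] i(3)
      Idn_right[OF assms(3)] Idn_right[OF assms(4)] by simp
qed

lemma iso_cancel_left:
  assumes "is_iso C e" "e \<in> hom C Y Z" "f \<in> hom C X Y" "g \<in> hom C X Y" "e \<cdot> f = e \<cdot> g"
  shows "f = g"
proof -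
  note i = inv_arr[OF assms(1,2)]
  have "inv_arr C e \<cdot> (e \<cdot> f) = inv_arr C e \<cdot> (e \<cdot> g)" using assms by simp
  then show ?thesis
    using Cmp_assoc[OF assms(3,2) i(1)] Cmp_assoc[OF assms(4,2) i(1)] i(2)
      Idn_left[OF assms(3)] Idn_left[OF assms(4)] by simp
qed

lemma inv_arr_natural:
  assumes "is_iso C e" "e \<in> hom C X Y" "is_iso C e'" "e' \<in> hom C X' Y'"
    and "f \<in> hom C X X'" "g \<in> hom C Y Y'" "e' \<cdot> f = g \<cdot> e"
  shows "inv_arr C e' \<cdot> g = f \<cdot> inv_arr C e"
proof -
  note i = inv_arr[OF assms(1,2)] and i' = inv_arr[OF assms(3,4)]
  have "inv_arr C e' \<cdot> (e' \<cdot> f) \<cdot> inv_arr C e = inv_arr C e' \<cdot> (g \<cdot> e) \<cdot> inv_arr C e"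
    using assms(7) by simp
  moreover have "(g \<cdot> e) \<cdot> inv_arr C e = g"
    using Cmp_assoc[OF i(1) assms(2,6)] i(3) Idn_right[OF assms(6)] by simp
  moreover have "inv_arr C e' \<cdot> (e' \<cdot> f) \<cdot> inv_arr C e = f \<cdot> inv_arr C e"
    using Cmp_assoc[OF i(1) assms(5,4)] Cmp_assoc[OF Cmp_hom[OF i(1) assms(5)] assms(4) i'(1)]
      i'(2) Idn_left[OF Cmp_hom[OF i(1) assms(5)]] by simp
  ultimately show ?thesis by simp
qed

end

context symmetric_monoidal_category
begin

lemmas ten_intros = Cmp_hom tenA_hom Idn_hom tenO_Obj unt_Obj

lemma tenA_Cmp_left:
  assumes "f \<in> hom C X X'" "f' \<in> hom C X' X''" "Y \<in> Obj C"
  shows "(f' \<cdot> f) \<odot> Idn C Y = (f' \<odot> Idn C Y) \<cdot> (f \<odot> Idn C Y)"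
  using tenA_Cmp[OF assms(1,2) Idn_hom Idn_hom] Idn_left[OF Idn_hom] assms(3) by simp

lemma tenA_Cmp_right:
  assumes "f \<in> hom C X X'" "f' \<in> hom C X' X''" "Y \<in> Obj C"
  shows "Idn C Y \<odot> (f' \<cdot> f) = (Idn C Y \<odot> f') \<cdot> (Idn C Y \<odot> f)"
  using tenA_Cmp[OF Idn_hom Idn_hom assms(1,2)] Idn_left[OF Idn_hom] assms(3) by simp

lemma tenA_iso:
  assumes "is_iso C f" "f \<in> hom C X X'" "is_iso C g" "g \<in> hom C Y Y'"
  shows "is_iso C (f \<odot> g)"
proof -
  note i = inv_arr[OF assms(1,2)] and j = inv_arr[OF assms(3,4)]
  have "inverse_arrows C (f \<odot> g) (inv_arr C f \<odot> inv_arr C g)"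
    using tenA_hom[OF assms(2,4)] tenA_hom[OF i(1) j(1)] hom_Obj[OF assms(2)] hom_Obj[OF assms(4)]
      tenA_Cmp[OF assms(2) i(1) assms(4) j(1)] tenA_Cmp[OF i(1) assms(2) j(1) assms(4)]
    by (simp add: inverse_arrows_def homD i j tenA_Idn)
  then show ?thesis unfolding is_iso_def by blast
qed

lemma Idn_iso: "X \<in> Obj C \<Longrightarrow> is_iso C (Idn C X)"
  unfolding is_iso_def inverse_arrows_def
  by (rule exI[of _ "Idn C X"]) (use Idn_hom[of X] Idn_left[OF Idn_hom] in \<open>auto simp: homD\<close>)

lemma Cmp_iso:
  assumes "is_iso C f" "f \<in> hom C X Y" "is_iso C g" "g \<in> hom C Y Z"
  shows "is_iso C (g \<cdot> f)"
proof -
  note i = inv_arr[OF assms(1,2)] and j = inv_arr[OF assms(3,4)]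
  have gf: "g \<cdot> f \<in> hom C X Z" and ij: "inv_arr C f \<cdot> inv_arr C g \<in> hom C Z X"
    using assms i j Cmp_hom by blast+
  have "(inv_arr C f \<cdot> inv_arr C g) \<cdot> (g \<cdot> f) = inv_arr C f \<cdot> (inv_arr C g \<cdot> g) \<cdot> f"
    using Cmp_assoc[OF gf j(1) i(1)] Cmp_assoc[OF assms(2,4) j(1)] by simp
  moreover have "(g \<cdot> f) \<cdot> (inv_arr C f \<cdot> inv_arr C g) = g \<cdot> (f \<cdot> inv_arr C f) \<cdot> inv_arr C g"
    using Cmp_assoc[OF ij assms(2,4)] Cmp_assoc[OF j(1) i(1) assms(2)] by simp
  ultimately have "inverse_arrows C (g \<cdot> f) (inv_arr C f \<cdot> inv_arr C g)"
    using gf ij i j Idn_left[OF assms(2)] Idn_left[OF j(1)]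
    by (simp add: inverse_arrows_def homD)
  then show ?thesis unfolding is_iso_def by blast
qed

text \<open>
  Tensoring with the unit is faithful, because the unitors identify it with the identity functor.
\<close>

lemma unt_tenA_cancel:
  assumes "f \<in> hom C X Y" "g \<in> hom C X Y" "Idn C (unt C) \<odot> f = Idn C (unt C) \<odot> g"
  shows "f = g"
  by (rule iso_cancel_right[OF lunit_iso lunit_hom assms(1,2)])
    (use assms lunit_natural[of f X Y] lunit_natural[of g X Y] hom_Obj in auto)

lemma tenA_unt_cancel:
  assumes "f \<in> hom C X Y" "g \<in> hom C X Y" "f \<odot> Idn C (unt C) = g \<odot> Idn C (unt C)"
  shows "f = g"
  by (rule iso_cancel_right[OF runit_iso runit_hom assms(1,2)])
    (use assms runit_natural[of f X Y] runit_natural[of g X Y] hom_Obj in auto)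

text \<open>
  Kelly's consequence of the pentagon and the triangle: after tensoring with the unit, both sides
  can be compared along invertible associators.
\<close>

lemma lunit_tenO:
  assumes X: "X \<in> Obj C" and Y: "Y \<in> Obj C"
  shows "lunit C (X \<otimes> Y) \<cdot> assoc C (unt C) X Y = lunit C X \<odot> Idn C Y"
proof (rule unt_tenA_cancel)
  let ?I = "unt C"
  note O = X Y unt_Obj
  have hl: "lunit C (X \<otimes> Y) \<in> hom C (?I \<otimes> (X \<otimes> Y)) (X \<otimes> Y)"
    and ha: "assoc C ?I X Y \<in> hom C ((?I \<otimes> X) \<otimes> Y) (?I \<otimes> (X \<otimes> Y))"
    and hlx: "lunit C X \<in> hom C (?I \<otimes> X) X" and hr: "runit C ?I \<in> hom C (?I \<otimes> ?I) ?I"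
    and i: "Idn C ?I \<in> hom C ?I ?I" and iY: "Idn C Y \<in> hom C Y Y" and iX: "Idn C X \<in> hom C X X"
    using O by (auto intro!: lunit_hom assoc_hom runit_hom ten_intros)
  show L: "lunit C (X \<otimes> Y) \<cdot> assoc C ?I X Y \<in> hom C ((?I \<otimes> X) \<otimes> Y) (X \<otimes> Y)"
    and R: "lunit C X \<odot> Idn C Y \<in> hom C ((?I \<otimes> X) \<otimes> Y) (X \<otimes> Y)"
    using hl ha hlx iY Cmp_hom tenA_hom by blast+
  let ?a1 = "assoc C ?I (?I \<otimes> X) Y" and ?a2 = "assoc C ?I ?I X \<odot> Idn C Y"
    and ?a3 = "assoc C ?I ?I (X \<otimes> Y)" and ?a4 = "assoc C (?I \<otimes> ?I) X Y"
  have h1: "?a1 \<in> hom C ((?I \<otimes> (?I \<otimes> X)) \<otimes> Y) (?I \<otimes> ((?I \<otimes> X) \<otimes> Y))"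
    and haI: "assoc C ?I ?I X \<in> hom C ((?I \<otimes> ?I) \<otimes> X) (?I \<otimes> (?I \<otimes> X))"
    and h2: "?a2 \<in> hom C (((?I \<otimes> ?I) \<otimes> X) \<otimes> Y) ((?I \<otimes> (?I \<otimes> X)) \<otimes> Y)"
    and h3: "?a3 \<in> hom C ((?I \<otimes> ?I) \<otimes> (X \<otimes> Y)) (?I \<otimes> (?I \<otimes> (X \<otimes> Y)))"
    and h4: "?a4 \<in> hom C (((?I \<otimes> ?I) \<otimes> X) \<otimes> Y) ((?I \<otimes> ?I) \<otimes> (X \<otimes> Y))"
    using O by (auto intro!: assoc_hom ten_intros)
  have hI: "?a1 \<cdot> ?a2 \<in> hom C (((?I \<otimes> ?I) \<otimes> X) \<otimes> Y) (?I \<otimes> ((?I \<otimes> X) \<otimes> Y))"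
    using h1 h2 Cmp_hom by blast
  have iso: "is_iso C (?a1 \<cdot> ?a2)"
    by (rule Cmp_iso[OF _ h2 _ h1]) (use O haI iY in \<open>auto intro!: tenA_iso assoc_iso Idn_iso ten_intros\<close>)
  have "(Idn C ?I \<odot> (lunit C (X \<otimes> Y) \<cdot> assoc C ?I X Y)) \<cdot> (?a1 \<cdot> ?a2)
      = ((Idn C ?I \<odot> lunit C (X \<otimes> Y)) \<cdot> (Idn C ?I \<odot> assoc C ?I X Y)) \<cdot> (?a1 \<cdot> ?a2)"
    using tenA_Cmp_right[OF ha hl unt_Obj] by simp
  also have "\<dots> = (Idn C ?I \<odot> lunit C (X \<otimes> Y)) \<cdot> ((Idn C ?I \<odot> assoc C ?I X Y) \<cdot> (?a1 \<cdot> ?a2))"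
    by (rule Cmp_assoc[OF hI tenA_hom[OF i ha] tenA_hom[OF i hl]])
  also have "\<dots> = (Idn C ?I \<odot> lunit C (X \<otimes> Y)) \<cdot> (?a3 \<cdot> ?a4)"
    using pentagon[OF unt_Obj unt_Obj X Y] by simp
  also have "\<dots> = ((Idn C ?I \<odot> lunit C (X \<otimes> Y)) \<cdot> ?a3) \<cdot> ?a4"
    by (rule Cmp_assoc[OF h4 h3 tenA_hom[OF i hl], symmetric])
  also have "\<dots> = (runit C ?I \<odot> (Idn C X \<odot> Idn C Y)) \<cdot> ?a4"
    using triangle[OF unt_Obj tenO_Obj[OF X Y]] tenA_Idn[OF X Y] by simp
  also have "\<dots> = assoc C ?I X Y \<cdot> ((runit C ?I \<odot> Idn C X) \<odot> Idn C Y)"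
    using assoc_natural[OF hr iX iY] by simp
  also have "\<dots> = assoc C ?I X Y \<cdot> (((Idn C ?I \<odot> lunit C X) \<cdot> assoc C ?I ?I X) \<odot> Idn C Y)"
    using triangle[OF unt_Obj X] by simp
  also have "\<dots> = assoc C ?I X Y \<cdot> (((Idn C ?I \<odot> lunit C X) \<odot> Idn C Y) \<cdot> ?a2)"
    using tenA_Cmp_left[OF haI tenA_hom[OF i hlx] Y] by simp
  also have "\<dots> = (assoc C ?I X Y \<cdot> ((Idn C ?I \<odot> lunit C X) \<odot> Idn C Y)) \<cdot> ?a2"
    by (rule Cmp_assoc[OF h2 tenA_hom[OF tenA_hom[OF i hlx] iY] ha, symmetric])
  also have "\<dots> = ((Idn C ?I \<odot> (lunit C X \<odot> Idn C Y)) \<cdot> ?a1) \<cdot> ?a2"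
    using assoc_natural[OF i hlx iY] by simp
  also have "\<dots> = (Idn C ?I \<odot> (lunit C X \<odot> Idn C Y)) \<cdot> (?a1 \<cdot> ?a2)"
    by (rule Cmp_assoc[OF h2 h1 tenA_hom[OF i R]])
  finally have "(Idn C ?I \<odot> (lunit C (X \<otimes> Y) \<cdot> assoc C ?I X Y)) \<cdot> (?a1 \<cdot> ?a2)
      = (Idn C ?I \<odot> (lunit C X \<odot> Idn C Y)) \<cdot> (?a1 \<cdot> ?a2)" .
  then show "Idn C ?I \<odot> (lunit C (X \<otimes> Y) \<cdot> assoc C ?I X Y) = Idn C ?I \<odot> (lunit C X \<odot> Idn C Y)"
    by (rule iso_cancel_right[OF iso hI tenA_hom[OF i L] tenA_hom[OF i R]])
qed

text \<open>
  The hexagon for two unit objects, simplified with the preceding identity, gives the equation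
  tensored with the unit.
\<close>

lemma lunit_swap:
  assumes X: "X \<in> Obj C"
  shows "lunit C X \<cdot> swap C X (unt C) = runit C X"
proof (rule tenA_unt_cancel)
  let ?I = "unt C"
  let ?s = "swap C X ?I"
  have s: "?s \<in> hom C (X \<otimes> ?I) (?I \<otimes> X)" and i: "Idn C ?I \<in> hom C ?I ?I" and iX: "Idn C X \<in> hom C X X"
    and hl: "lunit C X \<in> hom C (?I \<otimes> X) X" and hr: "runit C X \<in> hom C (X \<otimes> ?I) X"
    and hlI: "lunit C ?I \<in> hom C (?I \<otimes> ?I) ?I"
    and hl1: "lunit C (?I \<otimes> X) \<in> hom C (?I \<otimes> (?I \<otimes> X)) (?I \<otimes> X)"
    and hl2: "lunit C (X \<otimes> ?I) \<in> hom C (?I \<otimes> (X \<otimes> ?I)) (X \<otimes> ?I)"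
    and a1: "assoc C ?I ?I X \<in> hom C ((?I \<otimes> ?I) \<otimes> X) (?I \<otimes> (?I \<otimes> X))"
    and a2: "assoc C X ?I ?I \<in> hom C ((X \<otimes> ?I) \<otimes> ?I) (X \<otimes> (?I \<otimes> ?I))"
    and a3: "assoc C ?I X ?I \<in> hom C ((?I \<otimes> X) \<otimes> ?I) (?I \<otimes> (X \<otimes> ?I))"
    and sII: "swap C X (?I \<otimes> ?I) \<in> hom C (X \<otimes> (?I \<otimes> ?I)) ((?I \<otimes> ?I) \<otimes> X)"
    using X by (auto intro!: swap_hom lunit_hom runit_hom assoc_hom ten_intros)
  show L: "lunit C X \<cdot> ?s \<in> hom C (X \<otimes> ?I) X" and R: "runit C X \<in> hom C (X \<otimes> ?I) X"
    using s hl hr Cmp_hom by blast+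
  have "lunit C (?I \<otimes> X) \<cdot> (assoc C ?I ?I X \<cdot> (swap C X (?I \<otimes> ?I) \<cdot> assoc C X ?I ?I))
      = (lunit C ?I \<odot> Idn C X) \<cdot> (swap C X (?I \<otimes> ?I) \<cdot> assoc C X ?I ?I)"
    using Cmp_assoc[OF Cmp_hom[OF a2 sII] a1 hl1] lunit_tenO[OF unt_Obj X] by simp
  also have "\<dots> = ?s \<cdot> ((Idn C X \<odot> lunit C ?I) \<cdot> assoc C X ?I ?I)"
    using Cmp_assoc[OF a2 sII tenA_hom[OF hlI iX]] swap_natural[OF iX hlI]
      Cmp_assoc[OF a2 tenA_hom[OF iX hlI] s] by simp
  also have "\<dots> = ?s \<cdot> (runit C X \<odot> Idn C ?I)"
    using triangle[OF X unt_Obj] by simp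
  finally have 1: "lunit C (?I \<otimes> X) \<cdot> (assoc C ?I ?I X \<cdot> (swap C X (?I \<otimes> ?I) \<cdot> assoc C X ?I ?I))
      = ?s \<cdot> (runit C X \<odot> Idn C ?I)" .
  have "lunit C (?I \<otimes> X) \<cdot> ((Idn C ?I \<odot> ?s) \<cdot> (assoc C ?I X ?I \<cdot> (?s \<odot> Idn C ?I)))
      = (?s \<cdot> lunit C (X \<otimes> ?I)) \<cdot> (assoc C ?I X ?I \<cdot> (?s \<odot> Idn C ?I))"
    using Cmp_assoc[OF Cmp_hom[OF tenA_hom[OF s i] a3] tenA_hom[OF i s] hl1] lunit_natural[OF s]
    by simp
  also have "\<dots> = ?s \<cdot> ((lunit C (X \<otimes> ?I) \<cdot> assoc C ?I X ?I) \<cdot> (?s \<odot> Idn C ?I))"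
    using Cmp_assoc[OF Cmp_hom[OF tenA_hom[OF s i] a3] hl2 s] Cmp_assoc[OF tenA_hom[OF s i] a3 hl2]
    by simp
  also have "\<dots> = ?s \<cdot> ((lunit C X \<cdot> ?s) \<odot> Idn C ?I)"
    using lunit_tenO[OF X unt_Obj] tenA_Cmp_left[OF s hl unt_Obj] by simp
  finally have "?s \<cdot> ((lunit C X \<cdot> ?s) \<odot> Idn C ?I) = ?s \<cdot> (runit C X \<odot> Idn C ?I)"
    using 1 hexagon[OF X unt_Obj unt_Obj] by simp
  moreover have "is_iso C ?s"
    unfolding is_iso_def inverse_arrows_def
    by (rule exI[of _ "swap C ?I X"])
      (use s X swap_swap[of X ?I] swap_swap[of ?I X] swap_hom[of ?I X] unt_Obj in \<open>auto simp: homD\<close>)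
  ultimately show "(lunit C X \<cdot> ?s) \<odot> Idn C ?I = runit C X \<odot> Idn C ?I"
    using iso_cancel_left[OF _ s tenA_hom[OF L i] tenA_hom[OF R i]] by blast
qed

lemma runit_swap:
  assumes X: "X \<in> Obj C"
  shows "runit C X \<cdot> swap C (unt C) X = lunit C X"
proof -
  have "runit C X \<cdot> swap C (unt C) X = lunit C X \<cdot> (swap C X (unt C) \<cdot> swap C (unt C) X)"
    using lunit_swap[OF X] Cmp_assoc[OF swap_hom[OF unt_Obj X] swap_hom[OF X unt_Obj] lunit_hom[OF X]]
    by simp
  then show ?thesis using X unt_Obj swap_swap Idn_right[OF lunit_hom] by simp
qed

end

context category
begin

lemma square_Cmp:
  assumes "a \<in> hom C X Y" "b \<in> hom C Y Z" "a' \<in> hom C X' Y'" "b' \<in> hom C Y' Z'"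
    and "f \<in> hom C X X'" "g \<in> hom C Y Y'" "h \<in> hom C Z Z'"
    and "a' \<cdot> f = g \<cdot> a" "b' \<cdot> g = h \<cdot> b"
  shows "(b' \<cdot> a') \<cdot> f = h \<cdot> (b \<cdot> a)"
  using assms(8,9) Cmp_assoc[OF assms(5,3,4)] Cmp_assoc[OF assms(1,6,4)] Cmp_assoc[OF assms(1,2,7)]
  by simp

end

context symmetric_monoidal_category
begin

lemma square_tenA:
  assumes "a \<in> hom C X Y" "a' \<in> hom C X' Y'" "f \<in> hom C X X'" "g \<in> hom C Y Y'"
    and "b \<in> hom C V W" "b' \<in> hom C V' W'" "h \<in> hom C V V'" "k \<in> hom C W W'"
    and "a' \<cdot> f = g \<cdot> a" "b' \<cdot> h = k \<cdot> b"
  shows "(a' \<odot> b') \<cdot> (f \<odot> h) = (g \<odot> k) \<cdot> (a \<odot> b)"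
  using tenA_Cmp[OF assms(3,2,7,6)] tenA_Cmp[OF assms(1,4,5,8)] assms(9,10) by simp

lemma square_Idn: "f \<in> hom C X Y \<Longrightarrow> Idn C Y \<cdot> f = f \<cdot> Idn C X"
  by (simp add: Idn_left Idn_right)

lemma lunit_tenO_inv:
  assumes "X \<in> Obj C" "Y \<in> Obj C"
  shows "(lunit C X \<odot> Idn C Y) \<cdot> inv_arr C (assoc C (unt C) X Y) = lunit C (X \<otimes> Y)"
proof -
  have a: "assoc C (unt C) X Y \<in> hom C ((unt C \<otimes> X) \<otimes> Y) (unt C \<otimes> (X \<otimes> Y))"
    and l: "lunit C (X \<otimes> Y) \<in> hom C (unt C \<otimes> (X \<otimes> Y)) (X \<otimes> Y)"
    using assms by (auto intro!: assoc_hom lunit_hom ten_intros)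
  note i = inv_arr[OF assoc_iso[OF unt_Obj assms] a]
  show ?thesis
    using lunit_tenO[OF assms] Cmp_assoc[OF i(1) a l] i(3) Idn_right[OF l] by simp
qed

lemma assoc_inv_natural:
  assumes "f \<in> hom C X X'" "g \<in> hom C Y Y'" "h \<in> hom C Z Z'"
  shows "inv_arr C (assoc C X' Y' Z') \<cdot> (f \<odot> (g \<odot> h))
    = ((f \<odot> g) \<odot> h) \<cdot> inv_arr C (assoc C X Y Z)"
  by (rule inv_arr_natural[OF assoc_iso assoc_hom assoc_iso assoc_hom])
    (use assms hom_Obj assoc_natural in \<open>auto intro!: tenA_hom\<close>)

lemma assoc_inv_hom:
  "X \<in> Obj C \<Longrightarrow> Y \<in> Obj C \<Longrightarrow> Z \<in> Obj C \<Longrightarrow>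
    inv_arr C (assoc C X Y Z) \<in> hom C (X \<otimes> (Y \<otimes> Z)) ((X \<otimes> Y) \<otimes> Z)"
  by (rule inv_arr(1)[OF assoc_iso assoc_hom])

text \<open>
  The middle exchange is the composite of this map, acting on the last three of the four factors,
  with associators. Naming it lets naturality be proved one conjugation at a time.
\<close>

definition front_swap :: "'o \<Rightarrow> 'o \<Rightarrow> 'm" where
  "front_swap X Y =
     assoc C Y X Y \<cdot> (swap C X Y \<odot> Idn C Y) \<cdot> inv_arr C (assoc C X Y Y)"

lemma middle_swap_eq:
  "middle_swap C X Y = inv_arr C (assoc C X Y (X \<otimes> Y)) \<cdot>
     (Idn C X \<odot> front_swap X Y) \<cdot> assoc C X X (Y \<otimes> Y)"
  by (simp add: middle_swap_def front_swap_def)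

lemma front_swap_hom:
  assumes "X \<in> Obj C" "Y \<in> Obj C"
  shows "front_swap X Y \<in> hom C (X \<otimes> (Y \<otimes> Y)) (Y \<otimes> (X \<otimes> Y))"
  unfolding front_swap_def
  by (rule Cmp_hom[OF Cmp_hom[OF assoc_inv_hom tenA_hom[OF swap_hom Idn_hom]] assoc_hom])
    (use assms in auto)

lemma front_swap_natural:
  assumes f: "f \<in> hom C X X'" and g: "g \<in> hom C Y Y'"
  shows "front_swap X' Y' \<cdot> (f \<odot> (g \<odot> g)) = (g \<odot> (f \<odot> g)) \<cdot> front_swap X Y"
proof -
  note O = hom_Obj[OF f] hom_Obj[OF g]
  show ?thesis
    unfolding front_swap_def
    by (rule square_Cmp[OF Cmp_hom[OF assoc_inv_hom tenA_hom[OF swap_hom Idn_hom]] assoc_hom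
          Cmp_hom[OF assoc_inv_hom tenA_hom[OF swap_hom Idn_hom]] assoc_hom _ _ _
          square_Cmp[OF assoc_inv_hom tenA_hom[OF swap_hom Idn_hom]
            assoc_inv_hom tenA_hom[OF swap_hom Idn_hom] _ _ _ assoc_inv_natural
            square_tenA[OF swap_hom swap_hom _ _ Idn_hom Idn_hom _ _ swap_natural square_Idn]]
          assoc_natural])
      (use f g O in \<open>auto intro!: tenA_hom\<close>)
qed

lemma middle_swap_hom:
  assumes "X \<in> Obj C" "Y \<in> Obj C"
  shows "middle_swap C X Y \<in> hom C ((X \<otimes> X) \<otimes> (Y \<otimes> Y)) ((X \<otimes> Y) \<otimes> (X \<otimes> Y))"
  unfolding middle_swap_eq
  by (rule Cmp_hom[OF Cmp_hom[OF assoc_hom tenA_hom[OF Idn_hom front_swap_hom]] assoc_inv_hom])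
    (use assms in \<open>auto intro: tenO_Obj\<close>)

lemma middle_swap_natural:
  assumes f: "f \<in> hom C X X'" and g: "g \<in> hom C Y Y'"
  shows "middle_swap C X' Y' \<cdot> ((f \<odot> f) \<odot> (g \<odot> g)) = ((f \<odot> g) \<odot> (f \<odot> g)) \<cdot> middle_swap C X Y"
proof -
  note O = hom_Obj[OF f] hom_Obj[OF g]
  show ?thesis
    unfolding middle_swap_eq
    by (rule square_Cmp[OF Cmp_hom[OF assoc_hom tenA_hom[OF Idn_hom front_swap_hom]] assoc_inv_hom
          Cmp_hom[OF assoc_hom tenA_hom[OF Idn_hom front_swap_hom]] assoc_inv_hom _ _ _
          square_Cmp[OF assoc_hom tenA_hom[OF Idn_hom front_swap_hom]
            assoc_hom tenA_hom[OF Idn_hom front_swap_hom] _ _ _ assoc_natural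
            square_tenA[OF Idn_hom Idn_hom _ _ front_swap_hom front_swap_hom _ _
              square_Idn front_swap_natural]]
          assoc_inv_natural])
      (use f g O in \<open>auto intro!: tenA_hom tenO_Obj\<close>)
qed

text \<open>
  Erasing both unit factors after the exchange erases the first pair before it: the left unitor is
  moved past each of the constituents of the exchange.
\<close>

lemma lunit_middle_swap:
  assumes X: "X \<in> Obj C"
  shows "(lunit C X \<odot> lunit C X) \<cdot> middle_swap C (unt C) X
    = lunit C (X \<otimes> X) \<cdot> (lunit C (unt C) \<odot> Idn C (X \<otimes> X))"
proof -
  let ?I = "unt C" and ?l = "lunit C X"
  let ?A = "inv_arr C (assoc C ?I X (?I \<otimes> X))" and ?D = "inv_arr C (assoc C ?I X X)"
  let ?E = "assoc C ?I ?I (X \<otimes> X)" and ?N = "front_swap ?I X"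
  have XX: "X \<otimes> X \<in> Obj C" and IX: "?I \<otimes> X \<in> Obj C"
    using X by (auto intro: ten_intros)
  have l: "?l \<in> hom C (?I \<otimes> X) X" and iX: "Idn C X \<in> hom C X X"
    and iIX: "Idn C (?I \<otimes> X) \<in> hom C (?I \<otimes> X) (?I \<otimes> X)" and i: "Idn C ?I \<in> hom C ?I ?I"
    and A: "?A \<in> hom C (?I \<otimes> (X \<otimes> (?I \<otimes> X))) ((?I \<otimes> X) \<otimes> (?I \<otimes> X))"
    and D: "?D \<in> hom C (?I \<otimes> (X \<otimes> X)) ((?I \<otimes> X) \<otimes> X)"
    and E: "?E \<in> hom C ((?I \<otimes> ?I) \<otimes> (X \<otimes> X)) (?I \<otimes> (?I \<otimes> (X \<otimes> X)))"
    and N: "?N \<in> hom C (?I \<otimes> (X \<otimes> X)) (X \<otimes> (?I \<otimes> X))"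
    and s: "swap C ?I X \<in> hom C (?I \<otimes> X) (X \<otimes> ?I)"
    and a: "assoc C X ?I X \<in> hom C ((X \<otimes> ?I) \<otimes> X) (X \<otimes> (?I \<otimes> X))"
    and r: "runit C X \<in> hom C (X \<otimes> ?I) X"
    and l1: "lunit C (X \<otimes> (?I \<otimes> X)) \<in> hom C (?I \<otimes> (X \<otimes> (?I \<otimes> X))) (X \<otimes> (?I \<otimes> X))"
    and l2: "lunit C (?I \<otimes> (X \<otimes> X)) \<in> hom C (?I \<otimes> (?I \<otimes> (X \<otimes> X))) (?I \<otimes> (X \<otimes> X))"
    using X XX IX unt_Obj
    by (auto intro!: lunit_hom runit_hom assoc_hom assoc_inv_hom swap_hom front_swap_hom ten_intros)
  have "(?l \<odot> ?l) \<cdot> ?A = ((Idn C X \<odot> ?l) \<cdot> (?l \<odot> Idn C (?I \<otimes> X))) \<cdot> ?A"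
    using tenA_Cmp[OF l iX iIX l] Idn_left[OF l] Idn_right[OF l] by simp
  also have "\<dots> = (Idn C X \<odot> ?l) \<cdot> lunit C (X \<otimes> (?I \<otimes> X))"
    using Cmp_assoc[OF A tenA_hom[OF l iIX] tenA_hom[OF iX l]] lunit_tenO_inv[OF X IX] by simp
  finally have 1: "(?l \<odot> ?l) \<cdot> ?A = (Idn C X \<odot> ?l) \<cdot> lunit C (X \<otimes> (?I \<otimes> X))" .
  have "(Idn C X \<odot> ?l) \<cdot> ?N
      = (runit C X \<odot> Idn C X) \<cdot> ((swap C ?I X \<odot> Idn C X) \<cdot> ?D)"
    unfolding front_swap_def
    using Cmp_assoc[OF Cmp_hom[OF D tenA_hom[OF s iX]] a tenA_hom[OF iX l]] triangle[OF X X] by simp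
  also have "\<dots> = (?l \<odot> Idn C X) \<cdot> ?D"
    using Cmp_assoc[OF D tenA_hom[OF s iX] tenA_hom[OF r iX]] tenA_Cmp_left[OF s r X]
      runit_swap[OF X] by simp
  also have "\<dots> = lunit C (X \<otimes> X)" by (rule lunit_tenO_inv[OF X X])
  finally have 2: "(Idn C X \<odot> ?l) \<cdot> ?N = lunit C (X \<otimes> X)" .
  have "(?l \<odot> ?l) \<cdot> middle_swap C ?I X = ((?l \<odot> ?l) \<cdot> ?A) \<cdot> ((Idn C ?I \<odot> ?N) \<cdot> ?E)"
    unfolding middle_swap_eq
    using Cmp_assoc[OF Cmp_hom[OF E tenA_hom[OF i N]] A tenA_hom[OF l l]] by simp
  also have "\<dots> = (Idn C X \<odot> ?l) \<cdot> ((lunit C (X \<otimes> (?I \<otimes> X)) \<cdot> (Idn C ?I \<odot> ?N)) \<cdot> ?E)"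
    using 1 Cmp_assoc[OF Cmp_hom[OF E tenA_hom[OF i N]] l1 tenA_hom[OF iX l]]
      Cmp_assoc[OF E tenA_hom[OF i N] l1] by simp
  also have "\<dots> = ((Idn C X \<odot> ?l) \<cdot> ?N) \<cdot> (lunit C (?I \<otimes> (X \<otimes> X)) \<cdot> ?E)"
    using lunit_natural[OF N] Cmp_assoc[OF E l2 N]
      Cmp_assoc[OF Cmp_hom[OF E l2] N tenA_hom[OF iX l]] by simp
  finally show ?thesis using 2 lunit_tenO[OF unt_Obj XX] by simp
qed

end

context markov_category
begin

lemma deterministicI:
  "f \<in> hom C X Y \<Longrightarrow> copy C Y \<cdot> f = (f \<odot> f) \<cdot> copy C X \<Longrightarrow> deterministic C f"
  by (simp add: deterministic_def homD)

lemma deterministicD: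
  "deterministic C f \<Longrightarrow> f \<in> hom C X Y \<Longrightarrow> copy C Y \<cdot> f = (f \<odot> f) \<cdot> copy C X"
  by (simp add: deterministic_def homD)

lemma del_natural: "f \<in> hom C X Y \<Longrightarrow> del C Y \<cdot> f = del C X"
  by (meson Cmp_hom del_hom hom_Obj unt_terminal)

lemma deterministic_Idn: "X \<in> Obj C \<Longrightarrow> deterministic C (Idn C X)"
  by (rule deterministicI[OF Idn_hom])
    (simp_all add: tenA_Idn Idn_left[OF copy_hom] Idn_right[OF copy_hom])

lemma deterministic_Cmp:
  assumes "deterministic C f" "f \<in> hom C X Y" "deterministic C g" "g \<in> hom C Y Z"
  shows "deterministic C (g \<cdot> f)"
proof (rule deterministicI[OF Cmp_hom[OF assms(2,4)]])
  note O = hom_Obj[OF assms(2)] hom_Obj[OF assms(4)]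
  show "copy C Z \<cdot> (g \<cdot> f) = ((g \<cdot> f) \<odot> (g \<cdot> f)) \<cdot> copy C X"
    using square_Cmp[OF assms(2,4) tenA_hom[OF assms(2,2)] tenA_hom[OF assms(4,4)]
        copy_hom copy_hom copy_hom] O
      deterministicD[OF assms(1,2)] deterministicD[OF assms(3,4)] tenA_Cmp[OF assms(2,4,2,4)]
    by simp
qed

text \<open>
  Copy maps of tensor products are copy maps of the factors followed by the middle exchange, which
  is natural.
\<close>

lemma deterministic_tenA:
  assumes "deterministic C f" "f \<in> hom C X X'" "deterministic C g" "g \<in> hom C Y Y'"
  shows "deterministic C (f \<odot> g)"
proof (rule deterministicI[OF tenA_hom[OF assms(2,4)]])
  note O = hom_Obj[OF assms(2)] hom_Obj[OF assms(4)]
  show "copy C (X' \<otimes> Y') \<cdot> (f \<odot> g) = ((f \<odot> g) \<odot> (f \<odot> g)) \<cdot> copy C (X \<otimes> Y)"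
    unfolding copy_tenO[OF O(1,3)] copy_tenO[OF O(2,4)]
    by (rule square_Cmp[OF tenA_hom[OF copy_hom copy_hom] middle_swap_hom
          tenA_hom[OF copy_hom copy_hom] middle_swap_hom _ _ _
          square_tenA[OF copy_hom copy_hom _ _ copy_hom copy_hom _ _
            deterministicD[OF assms(1)] deterministicD[OF assms(3)]] middle_swap_natural])
      (use assms O in \<open>auto intro!: tenA_hom\<close>)
qed

text \<open>
  Both sides of the determinism equation become equal after the invertible left unitor of the unit,
  because the unit is terminal.
\<close>

lemma deterministic_del:
  assumes X: "X \<in> Obj C"
  shows "deterministic C (del C X)"
proof (rule deterministicI[OF del_hom[OF X]])
  have L: "copy C (unt C) \<cdot> del C X \<in> hom C X (unt C \<otimes> unt C)"
    and R: "(del C X \<odot> del C X) \<cdot> copy C X \<in> hom C X (unt C \<otimes> unt C)"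
    using X unt_Obj by (auto intro!: Cmp_hom[OF del_hom copy_hom] Cmp_hom[OF copy_hom tenA_hom] del_hom)
  have "lunit C (unt C) \<cdot> (copy C (unt C) \<cdot> del C X)
      = lunit C (unt C) \<cdot> ((del C X \<odot> del C X) \<cdot> copy C X)"
    using unt_terminal Cmp_hom[OF L lunit_hom[OF unt_Obj]] Cmp_hom[OF R lunit_hom[OF unt_Obj]]
    by metis
  then show "copy C (unt C) \<cdot> del C X = (del C X \<odot> del C X) \<cdot> copy C X"
    by (rule iso_cancel_left[OF lunit_iso[OF unt_Obj] lunit_hom[OF unt_Obj] L R])
qed

text \<open>
  The copy map of \<open>1 \<otimes> X\<close> is the middle exchange after the two copy maps; applying the unitors
  to it removes the exchange by \<open>lunit_middle_swap\<close>, and copying the unit is undone by its unitor.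
\<close>

lemma deterministic_lunit:
  assumes X: "X \<in> Obj C"
  shows "deterministic C (lunit C X)"
proof (rule deterministicI[OF lunit_hom[OF X]])
  let ?I = "unt C" and ?l = "lunit C X"
  have l: "?l \<in> hom C (?I \<otimes> X) X" and m: "middle_swap C ?I X \<in> hom C ((?I \<otimes> ?I) \<otimes> (X \<otimes> X)) ((?I \<otimes> X) \<otimes> (?I \<otimes> X))"
    and c: "copy C X \<in> hom C X (X \<otimes> X)" and cI: "copy C ?I \<in> hom C ?I (?I \<otimes> ?I)"
    and lI: "lunit C ?I \<in> hom C (?I \<otimes> ?I) ?I"
    and lXX: "lunit C (X \<otimes> X) \<in> hom C (?I \<otimes> (X \<otimes> X)) (X \<otimes> X)"
    and iXX: "Idn C (X \<otimes> X) \<in> hom C (X \<otimes> X) (X \<otimes> X)"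
    using X by (auto intro!: lunit_hom middle_swap_hom copy_hom ten_intros)
  have "(?l \<odot> ?l) \<cdot> copy C (?I \<otimes> X) = ((?l \<odot> ?l) \<cdot> middle_swap C ?I X) \<cdot> (copy C ?I \<odot> copy C X)"
    using copy_tenO[OF unt_Obj X] Cmp_assoc[OF tenA_hom[OF cI c] m tenA_hom[OF l l]] by simp
  also have "\<dots> = lunit C (X \<otimes> X) \<cdot> ((lunit C ?I \<odot> Idn C (X \<otimes> X)) \<cdot> (copy C ?I \<odot> copy C X))"
    using lunit_middle_swap[OF X] Cmp_assoc[OF tenA_hom[OF cI c] tenA_hom[OF lI iXX] lXX] by simp
  also have "\<dots> = lunit C (X \<otimes> X) \<cdot> (Idn C ?I \<odot> copy C X)"
    using tenA_Cmp[OF cI lI c iXX] copy_unt Idn_left[OF c] by simp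
  also have "\<dots> = copy C X \<cdot> ?l" by (rule lunit_natural[OF c])
  finally show "copy C X \<cdot> ?l = (?l \<odot> ?l) \<cdot> copy C (?I \<otimes> X)" by simp
qed

end

section \<open>Cofiltered categories and products\<close>

lemma cofilteredE_span:
  assumes "cofiltered J" "i \<in> Obj J" "j \<in> Obj J"
  obtains k a b where "k \<in> Obj J" "a \<in> hom J k i" "b \<in> hom J k j"
proof -
  have "\<exists>k\<in>Obj J. hom J k i \<noteq> {} \<and> hom J k j \<noteq> {}"
    using assms(1) assms(2,3) unfolding cofiltered_def by simp
  then show ?thesis using that by auto
qed

lemma cofilteredE_equalize:
  assumes J: "cofiltered J" and a: "a \<in> hom J i j" and b: "b \<in> hom J i j"
  obtains k c where "k \<in> Obj J" "c \<in> hom J k i" "a \<cdot>\<^bsub>J\<^esub> c = b \<cdot>\<^bsub>J\<^esub> c"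
proof -
  have "i \<in> Obj J" "j \<in> Obj J" using J category.hom_Obj[OF _ a] by (auto simp: cofiltered_def)
  then have "\<exists>k\<in>Obj J. \<exists>c\<in>hom J k i. a \<cdot>\<^bsub>J\<^esub> c = b \<cdot>\<^bsub>J\<^esub> c"
    using J a b unfolding cofiltered_def by simp
  then show ?thesis using that by auto
qed

lemma cofilteredI:
  assumes "category J" "i0 \<in> Obj J"
    and "\<And>i j. i \<in> Obj J \<Longrightarrow> j \<in> Obj J \<Longrightarrow> \<exists>k a b. a \<in> hom J k i \<and> b \<in> hom J k j"
    and "\<And>i j a b. a \<in> hom J i j \<Longrightarrow> b \<in> hom J i j \<Longrightarrow> \<exists>k. \<exists>c\<in>hom J k i. a \<cdot>\<^bsub>J\<^esub> c = b \<cdot>\<^bsub>J\<^esub> c"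
  shows "cofiltered J"
  unfolding cofiltered_def
proof (intro conjI ballI)
  show "category J" "Obj J \<noteq> {}" using assms(1,2) by auto
next
  fix i j assume "i \<in> Obj J" "j \<in> Obj J"
  then obtain k a b where k: "a \<in> hom J k i" "b \<in> hom J k j" using assms(3) by metis
  then show "\<exists>k\<in>Obj J. hom J k i \<noteq> {} \<and> hom J k j \<noteq> {}"
    using category.hom_Obj(1)[OF assms(1) k(1)] by auto
next
  fix i j a b assume "a \<in> hom J i j" "b \<in> hom J i j"
  then obtain k c where k: "c \<in> hom J k i" "a \<cdot>\<^bsub>J\<^esub> c = b \<cdot>\<^bsub>J\<^esub> c" using assms(4) by metis
  then show "\<exists>k\<in>Obj J. \<exists>c\<in>hom J k i. a \<cdot>\<^bsub>J\<^esub> c = b \<cdot>\<^bsub>J\<^esub> c"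
    using category.hom_Obj(1)[OF assms(1) k(1)] by auto
qed

context small_universe
begin

lemma prod_cat_simps:
  "upair i k \<in> Obj (prod_cat J K) \<longleftrightarrow> i \<in> Obj J \<and> k \<in> Obj K"
  "Dom (prod_cat J K) (upair a b) = upair (Dom J a) (Dom K b)"
  "Cod (prod_cat J K) (upair a b) = upair (Cod J a) (Cod K b)"
  "Idn (prod_cat J K) (upair i k) = upair (Idn J i) (Idn K k)"
  "upair a' b' \<cdot>\<^bsub>prod_cat J K\<^esub> upair a b = upair (a' \<cdot>\<^bsub>J\<^esub> a) (b' \<cdot>\<^bsub>K\<^esub> b)"
  for i k a b a' b' :: 'u
  by (auto simp: prod_cat_def)

lemma prod_cat_ObjE:
  assumes "c \<in> Obj (prod_cat J K)"
  obtains i k :: 'u where "c = upair i k" "i \<in> Obj J" "k \<in> Obj K"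
  using assms by (auto simp: prod_cat_def)

lemma prod_cat_homE:
  assumes "c \<in> hom (prod_cat J K) (upair i k) (upair i' k')"
  obtains a b :: 'u where "c = upair a b" "a \<in> hom J i i'" "b \<in> hom K k k'"
  using assms by (auto simp: prod_cat_def hom_def)

lemma prod_cat_homI:
  "a \<in> hom J i i' \<Longrightarrow> b \<in> hom K k k' \<Longrightarrow> upair a b \<in> hom (prod_cat J K) (upair i k) (upair i' k')"
  for i k i' k' a b :: 'u
  by (auto simp: prod_cat_def hom_def)

lemma prod_cat_hom_cases:
  assumes "c \<in> hom (prod_cat J K) x y"
  obtains a b i k i' k' :: 'u where "x = upair i k" "y = upair i' k'" "c = upair a b"
    "a \<in> hom J i i'" "b \<in> hom K k k'"
  using assms by (fastforce simp: prod_cat_def hom_def)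

lemma category_prod_cat:
  assumes J: "category J" and K: "category (K :: ('u, 'u) cat)"
  shows "category (prod_cat J K)"
proof -
  interpret J: category J by (rule J)
  interpret K: category K by (rule K)
  note E = prod_cat_hom_cases
  show ?thesis
  proof
    fix f assume "f \<in> Arr (prod_cat J K)"
    then show "Dom (prod_cat J K) f \<in> Obj (prod_cat J K)" "Cod (prod_cat J K) f \<in> Obj (prod_cat J K)"
      by (auto simp: prod_cat_def J.Dom_Obj K.Dom_Obj J.Cod_Obj K.Cod_Obj)
  next
    fix X assume "X \<in> Obj (prod_cat J K)"
    then show "Idn (prod_cat J K) X \<in> hom (prod_cat J K) X X"
      by (auto elim!: prod_cat_ObjE simp: prod_cat_simps intro!: prod_cat_homI J.Idn_hom K.Idn_hom)
  next
    fix f g X Y Z assume "f \<in> hom (prod_cat J K) X Y" "g \<in> hom (prod_cat J K) Y Z"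
    then show "g \<cdot>\<^bsub>prod_cat J K\<^esub> f \<in> hom (prod_cat J K) X Z"
      by (auto elim!: E simp: prod_cat_simps intro!: prod_cat_homI J.Cmp_hom K.Cmp_hom)
  next
    fix f X Y assume "f \<in> hom (prod_cat J K) X Y"
    then show "Idn (prod_cat J K) Y \<cdot>\<^bsub>prod_cat J K\<^esub> f = f" "f \<cdot>\<^bsub>prod_cat J K\<^esub> Idn (prod_cat J K) X = f"
      by (auto elim!: E simp: prod_cat_simps J.Idn_left K.Idn_left J.Idn_right K.Idn_right)
  next
    fix f g h W X Y Z
    assume "f \<in> hom (prod_cat J K) W X" "g \<in> hom (prod_cat J K) X Y" "h \<in> hom (prod_cat J K) Y Z"
    then show "(h \<cdot>\<^bsub>prod_cat J K\<^esub> g) \<cdot>\<^bsub>prod_cat J K\<^esub> f = h \<cdot>\<^bsub>prod_cat J K\<^esub> (g \<cdot>\<^bsub>prod_cat J K\<^esub> f)"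
      by (auto elim!: E simp: prod_cat_simps J.Cmp_assoc K.Cmp_assoc)
  qed
qed

lemma cofiltered_prod_cat:
  assumes J: "cofiltered J" and K: "cofiltered (K :: ('u, 'u) cat)"
  shows "cofiltered (prod_cat J K)"
proof -
  have cJ: "category J" and cK: "category K" using J K by (auto simp: cofiltered_def)
  obtain i0 k0 where "i0 \<in> Obj J" "k0 \<in> Obj K" using J K by (auto simp: cofiltered_def)
  then have ne: "upair i0 k0 \<in> Obj (prod_cat J K)" by (simp add: prod_cat_simps)
  show ?thesis
  proof (rule cofilteredI[OF category_prod_cat[OF cJ cK] ne])
    fix x y assume x': "x \<in> Obj (prod_cat J K)" and y': "y \<in> Obj (prod_cat J K)"
    obtain i k where x: "x = upair i k" "i \<in> Obj J" "k \<in> Obj K" using prod_cat_ObjE[OF x'] .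
    obtain i' k' where y: "y = upair i' k'" "i' \<in> Obj J" "k' \<in> Obj K" using prod_cat_ObjE[OF y'] .
    obtain i'' a a' where a: "i'' \<in> Obj J" "a \<in> hom J i'' i" "a' \<in> hom J i'' i'"
      using cofilteredE_span[OF J x(2) y(2)] .
    obtain k'' b b' where b: "k'' \<in> Obj K" "b \<in> hom K k'' k" "b' \<in> hom K k'' k'"
      using cofilteredE_span[OF K x(3) y(3)] .
    show "\<exists>z u v. u \<in> hom (prod_cat J K) z x \<and> v \<in> hom (prod_cat J K) z y"
      using prod_cat_homI[OF a(2) b(2)] prod_cat_homI[OF a(3) b(3)] x(1) y(1) by auto
  next
    fix x y u v
    assume u: "u \<in> hom (prod_cat J K) x y" and v: "v \<in> hom (prod_cat J K) x y"
    obtain a b i k i' k' where 1: "x = upair i k" "y = upair i' k'" "u = upair a b"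
      "a \<in> hom J i i'" "b \<in> hom K k k'" using prod_cat_hom_cases[OF u] .
    obtain a' b' where 2: "v = upair a' b'" "a' \<in> hom J i i'" "b' \<in> hom K k k'"
      using v unfolding 1(1,2) by (rule prod_cat_homE)
    obtain p c where c: "p \<in> Obj J" "c \<in> hom J p i" "a \<cdot>\<^bsub>J\<^esub> c = a' \<cdot>\<^bsub>J\<^esub> c"
      using cofilteredE_equalize[OF J 1(4) 2(2)] .
    obtain q d where d: "q \<in> Obj K" "d \<in> hom K q k" "b \<cdot>\<^bsub>K\<^esub> d = b' \<cdot>\<^bsub>K\<^esub> d"
      using cofilteredE_equalize[OF K 1(5) 2(3)] .
    have "upair c d \<in> hom (prod_cat J K) (upair p q) x"
      using prod_cat_homI[OF c(2) d(2)] 1(1) by simp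
    moreover have "u \<cdot>\<^bsub>prod_cat J K\<^esub> upair c d = v \<cdot>\<^bsub>prod_cat J K\<^esub> upair c d"
      unfolding 1(3) 2(1) prod_cat_simps(5) c(3) d(3) ..
    ultimately show "\<exists>z. \<exists>w\<in>hom (prod_cat J K) z x. u \<cdot>\<^bsub>prod_cat J K\<^esub> w = v \<cdot>\<^bsub>prod_cat J K\<^esub> w"
      by blast
  qed
qed

end

section \<open>Germs and pro-morphisms\<close>

locale pro_markov = markov_category C + small_universe Sm
  for C :: "('o, 'm, 'x) markov_scheme" (structure) and Sm :: "'u set \<Rightarrow> bool"
begin

abbreviation M :: "(('u, 'o, 'm) diagram, ('u, 'o, 'm) promor) markov" where
  "M \<equiv> ProDet Sm C"

lemma ProDet_simps [simp]:
  "Dom M \<phi> = Src \<phi>" "Cod M \<phi> = Tgt \<phi>" "Idn M X = pro_id C X" "Cmp M \<psi> \<phi> = pro_comp C \<psi> \<phi>"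
  "tenO M X Y = pro_tenO C X Y" "tenA M \<phi> \<psi> = pro_tenA C \<phi> \<psi>" "unt M = pro_unt C"
  "lunit M X = pro_lunit C X" "copy M X = pro_copy C X" "del M X = pro_del C X"
  by (simp_all add: ProDet_def full_subcat_def Pro_def cat.defs markov.defs)

lemma Obj_ProDet: "X \<in> Obj M \<longleftrightarrow>
    pro_object Sm C X \<and> is_functor (Shape X) (Det C) (onObj X) (onArr X)"
  by (auto simp: ProDet_def full_subcat_def Pro_def cat.defs markov.defs)

lemma hom_ProDet: "\<phi> \<in> hom M X Y \<longleftrightarrow>
    X \<in> Obj M \<and> Y \<in> Obj M \<and> pro_arrow C \<phi> \<and> Src \<phi> = X \<and> Tgt \<phi> = Y"
  by (auto simp: ProDet_def full_subcat_def Pro_def cat.defs markov.defs hom_def)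

lemma ProDet_hom_Obj: "\<phi> \<in> hom M X Y \<Longrightarrow> X \<in> Obj M" "\<phi> \<in> hom M X Y \<Longrightarrow> Y \<in> Obj M"
  by (simp_all add: hom_ProDet)

lemma hom_Det: "f \<in> hom (Det C) A B \<longleftrightarrow> f \<in> hom C A B \<and> deterministic C f"
  by (auto simp: hom_def Det_def deterministic_def)

lemma Det_simps [simp]: "Obj (Det C) = Obj C" "Idn (Det C) = Idn C" "Cmp (Det C) = Cmp C"
  by (auto simp: Det_def)

lemma ProDet_ObjI:
  assumes "Sm (Obj (Shape X))" "Sm (Arr (Shape X))" "cofiltered (Shape X)"
    and "\<And>i. i \<in> Obj (Shape X) \<Longrightarrow> onObj X i \<in> Obj C"
    and "\<And>a i j. a \<in> hom (Shape X) i j \<Longrightarrow> onArr X a \<in> hom C (onObj X i) (onObj X j)"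
    and "\<And>a i j. a \<in> hom (Shape X) i j \<Longrightarrow> deterministic C (onArr X a)"
    and "\<And>i. i \<in> Obj (Shape X) \<Longrightarrow> onArr X (Idn (Shape X) i) = Idn C (onObj X i)"
    and "\<And>a b i j k. a \<in> hom (Shape X) i j \<Longrightarrow> b \<in> hom (Shape X) j k \<Longrightarrow>
      onArr X (b \<cdot>\<^bsub>Shape X\<^esub> a) = onArr X b \<cdot> onArr X a"
  shows "X \<in> Obj M"
proof -
  have 1: "onArr X a \<in> hom C (onObj X (Dom (Shape X) a)) (onObj X (Cod (Shape X) a))"
    "deterministic C (onArr X a)" if "a \<in> Arr (Shape X)" for a
    using assms(5,6)[OF homI[OF that refl refl]] by auto
  have 2: "onArr X (b \<cdot>\<^bsub>Shape X\<^esub> a) = onArr X b \<cdot> onArr X a"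
    if "a \<in> Arr (Shape X)" "b \<in> Arr (Shape X)" "Cod (Shape X) a = Dom (Shape X) b" for a b
    by (rule assms(8)[OF homI[OF that(1) refl refl] homI[OF that(2) that(3)[symmetric] refl]])
  have "is_functor (Shape X) (Det C) (onObj X) (onArr X)" "is_functor (Shape X) C (onObj X) (onArr X)"
    using assms(4,7) 1 2 by (auto simp: is_functor_def hom_Det)
  then show ?thesis using assms(1-3) by (simp add: Obj_ProDet pro_object_def)
qed

lemma ProDet_Obj_small:
  assumes "X \<in> Obj M"
  shows "Sm (Obj (Shape X))" "Sm (Arr (Shape X))" "cofiltered (Shape X)" "category (Shape X)"
  using assms by (auto simp: Obj_ProDet pro_object_def cofiltered_def)

lemma onObj_Obj: "X \<in> Obj M \<Longrightarrow> i \<in> Obj (Shape X) \<Longrightarrow> onObj X i \<in> Obj C"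
  by (auto simp: Obj_ProDet pro_object_def is_functor_def)

lemma onArr_hom:
  "X \<in> Obj M \<Longrightarrow> a \<in> hom (Shape X) i j \<Longrightarrow> onArr X a \<in> hom C (onObj X i) (onObj X j)"
  by (auto simp: Obj_ProDet pro_object_def is_functor_def hom_def)

lemma onArr_det: "X \<in> Obj M \<Longrightarrow> a \<in> hom (Shape X) i j \<Longrightarrow> deterministic C (onArr X a)"
  by (auto simp: Obj_ProDet is_functor_def hom_Det homD)

lemma onArr_Idn:
  "X \<in> Obj M \<Longrightarrow> i \<in> Obj (Shape X) \<Longrightarrow> onArr X (Idn (Shape X) i) = Idn C (onObj X i)"
  by (auto simp: Obj_ProDet pro_object_def is_functor_def)

lemma onArr_Cmp:
  "X \<in> Obj M \<Longrightarrow> a \<in> hom (Shape X) i j \<Longrightarrow> b \<in> hom (Shape X) j k \<Longrightarrow>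
    onArr X (b \<cdot>\<^bsub>Shape X\<^esub> a) = onArr X b \<cdot> onArr X a"
  by (auto simp: Obj_ProDet pro_object_def is_functor_def hom_def)

lemma shape_hom_Obj:
  assumes "X \<in> Obj M" "a \<in> hom (Shape X) i j"
  shows "i \<in> Obj (Shape X)" "j \<in> Obj (Shape X)"
  using category.hom_Obj[OF ProDet_Obj_small(4)[OF assms(1)] assms(2)] by auto

text \<open>
  This is the universal property of the colimit \<open>colim\<^sub>i \<C>(X\<^sub>i, B)\<close>: a function of pairs that is
  invariant under restriction along the diagram is constant on each germ. It yields the
  well-definedness of pushing germs forward, of composition and of tensor products.
\<close>

lemma germ_invariant:
  assumes X: "X \<in> Obj M"
    and inv: "\<And>i i' a f. a \<in> hom (Shape X) i' i \<Longrightarrow> f \<in> hom C (onObj X i) B \<Longrightarrow>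
      h i' (f \<cdot> onArr X a) = h i f"
    and i: "i \<in> Obj (Shape X)" and f: "f \<in> hom C (onObj X i) B"
    and mem: "(i', f') \<in> germ C X i f"
  shows "i' \<in> Obj (Shape X) \<and> f' \<in> hom C (onObj X i') B \<and> h i' f' = h i f"
proof -
  have "((i, f), (i', f')) \<in> (colim_step C X \<union> (colim_step C X)\<inverse>)\<^sup>*"
    using mem by (simp add: germ_def colim_eq_def)
  then show ?thesis
  proof (induction "(i', f')" arbitrary: i' f' rule: rtrancl_induct)
    case base
    then show ?case using i f by simp
  next
    case (step y)
    obtain k g where y: "y = (k, g)" by (cases y)
    note IH = step(3)[OF y]
    consider a where "a \<in> hom (Shape X) i' k" "f' = g \<cdot> onArr X a"
      | a where "a \<in> hom (Shape X) k i'" "g = f' \<cdot> onArr X a" "f' \<in> Arr C" "Dom C f' = onObj X i'"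
      using step(2) unfolding y colim_step_def by blast
    then show ?case
    proof cases
      case 1
      then show ?thesis
        using IH inv[of a i' k g] Cmp_hom[OF onArr_hom[OF X 1(1)]] shape_hom_Obj[OF X 1(1)] by auto
    next
      case 2
      have f': "f' \<in> hom C (onObj X i') (Cod C f')" using 2 by (simp add: hom_def)
      then have "g \<in> hom C (onObj X k) (Cod C f')"
        using 2 Cmp_hom[OF onArr_hom[OF X 2(1)] f'] by simp
      then have "Cod C f' = B" using IH by (auto simp: hom_def)
      then show ?thesis
        using IH inv[of a k i' f'] 2 f' shape_hom_Obj[OF X 2(1)] by auto
    qed
  qed
qed

lemma germ_self: "(i, f) \<in> germ C X i f"
  by (simp add: germ_def colim_eq_def)

lemma germ_UN:
  assumes X: "X \<in> Obj M"
    and i: "i \<in> Obj (Shape X)" and f: "f \<in> hom C (onObj X i) B"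
    and inv: "\<And>i i' a f. a \<in> hom (Shape X) i' i \<Longrightarrow> f \<in> hom C (onObj X i) B \<Longrightarrow>
      h i' (f \<cdot> onArr X a) = h i f"
  shows "(\<Union>(i', f')\<in>germ C X i f. h i' f') = h i f"
proof -
  have "h i' f' = h i f" if "(i', f') \<in> germ C X i f" for i' f'
    using germ_invariant[where h = h, OF X inv i f that] by blast
  then show ?thesis using germ_self[of i f X] by fast
qed

text \<open>
  This is the relation that generates the colimit. Germs at different indices are compared below by
  restricting them to a common further index.
\<close>

lemma germ_restrict:
  assumes X: "X \<in> Obj M" and a: "a \<in> hom (Shape X) i' i" and f: "f \<in> hom C (onObj X i) B"
  shows "germ C X i' (f \<cdot> onArr X a) = germ C X i f"
proof -
  let ?r = "colim_step C X \<union> (colim_step C X)\<inverse>"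
  have "((i, f), (i', f \<cdot> onArr X a)) \<in> colim_step C X"
    unfolding colim_step_def using a f by (auto simp: homD)
  then have "((i, f), (i', f \<cdot> onArr X a)) \<in> ?r\<^sup>*" "((i', f \<cdot> onArr X a), (i, f)) \<in> ?r\<^sup>*"
    by auto
  then show ?thesis
    unfolding germ_def colim_eq_def by (auto intro: rtrancl_trans)
qed

lemma colim_homI:
  "i \<in> Obj (Shape X) \<Longrightarrow> f \<in> hom C (onObj X i) B \<Longrightarrow> germ C X i f \<in> colim_hom C X B"
  unfolding colim_hom_def germ_def by (rule quotientI) simp

lemma colim_homE:
  assumes "c \<in> colim_hom C X B"
  obtains i f where "i \<in> Obj (Shape X)" "f \<in> hom C (onObj X i) B" "c = germ C X i f"
  using assms unfolding colim_hom_def germ_def by (auto elim!: quotientE)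

lemma germ_push_germ:
  assumes X: "X \<in> Obj M" and i: "i \<in> Obj (Shape X)" and f: "f \<in> hom C (onObj X i) A"
    and g: "g \<in> hom C A B"
  shows "germ_push C X g (germ C X i f) = germ C X i (g \<cdot> f)"
  unfolding germ_push_def
proof (rule germ_UN[OF X i f])
  fix i i' a f
  assume a: "a \<in> hom (Shape X) i' i" and f: "f \<in> hom C (onObj X i) A"
  show "germ C X i' (g \<cdot> f \<cdot> onArr X a) = germ C X i (g \<cdot> f)"
    using germ_restrict[OF X a Cmp_hom[OF f g]] Cmp_assoc[OF onArr_hom[OF X a] f g] by simp
qed

lemma germ_push_push:
  assumes X: "X \<in> Obj M" and c: "c \<in> colim_hom C X A" and f: "f \<in> hom C A B" and g: "g \<in> hom C B D"
  shows "germ_push C X g (germ_push C X f c) = germ_push C X (g \<cdot> f) c"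
proof -
  obtain i h where ih: "i \<in> Obj (Shape X)" "h \<in> hom C (onObj X i) A" "c = germ C X i h"
    using c by (rule colim_homE)
  show ?thesis
    unfolding ih(3)
    using germ_push_germ[OF X ih(1,2) f] germ_push_germ[OF X ih(1) Cmp_hom[OF ih(2) f] g]
      germ_push_germ[OF X ih(1,2) Cmp_hom[OF f g]] Cmp_assoc[OF ih(2) f g] by simp
qed

lemma germ_push_Idn:
  assumes X: "X \<in> Obj M" and c: "c \<in> colim_hom C X A"
  shows "germ_push C X (Idn C A) c = c"
proof -
  obtain i h where ih: "i \<in> Obj (Shape X)" "h \<in> hom C (onObj X i) A" "c = germ C X i h"
    using c by (rule colim_homE)
  show ?thesis
    unfolding ih(3)
    using germ_push_germ[OF X ih(1,2) Idn_hom] Idn_left[OF ih(2)] hom_Obj[OF ih(2)] by simp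
qed

lemma Comps_colim_hom:
  "\<phi> \<in> hom M X Y \<Longrightarrow> j \<in> Obj (Shape Y) \<Longrightarrow> Comps \<phi> j \<in> colim_hom C X (onObj Y j)"
  by (auto simp: hom_ProDet pro_arrow_def)

lemma Comps_push:
  "\<phi> \<in> hom M X Y \<Longrightarrow> b \<in> hom (Shape Y) j j' \<Longrightarrow> germ_push C X (onArr Y b) (Comps \<phi> j) = Comps \<phi> j'"
  by (auto simp: hom_ProDet pro_arrow_def)

lemma promor_eqI:
  assumes "\<phi> \<in> hom M X Y" "\<psi> \<in> hom M X Y" "\<And>j. j \<in> Obj (Shape Y) \<Longrightarrow> Comps \<phi> j = Comps \<psi> j"
  shows "\<phi> = \<psi>"
proof -
  have "Comps \<phi> = Comps \<psi>"
  proof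
    fix j show "Comps \<phi> j = Comps \<psi> j"
      using assms by (cases "j \<in> Obj (Shape Y)") (auto simp: hom_ProDet pro_arrow_def)
  qed
  then show ?thesis using assms(1,2) by (simp add: hom_ProDet)
qed

lemma mk_promor_simps [simp]:
  "Src (mk_promor X Y c) = X" "Tgt (mk_promor X Y c) = Y"
  "j \<in> Obj (Shape Y) \<Longrightarrow> Comps (mk_promor X Y c) j = c j"
  by (simp_all add: mk_promor_def)

lemma mk_promor_Comps: "mk_promor X Y (Comps (mk_promor X Y c)) = mk_promor X Y c"
  by (simp add: mk_promor_def fun_eq_iff)

lemma mk_promor_hom:
  assumes X: "X \<in> Obj M" and Y: "Y \<in> Obj M"
    and "\<And>j. j \<in> Obj (Shape Y) \<Longrightarrow> c j \<in> colim_hom C X (onObj Y j)"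
    and "\<And>j j' b. b \<in> hom (Shape Y) j j' \<Longrightarrow> germ_push C X (onArr Y b) (c j) = c j'"
  shows "mk_promor X Y c \<in> hom M X Y"
  using assms shape_hom_Obj[OF Y] by (auto simp: hom_ProDet pro_arrow_def mk_promor_def)

section \<open>Composition, tensor product and structure maps on components\<close>

lemma Comps_pro_id: "i \<in> Obj (Shape X) \<Longrightarrow> Comps (pro_id C X) i = germ C X i (Idn C (onObj X i))"
  by (simp add: pro_id_def)

lemma pro_id_hom:
  assumes X: "X \<in> Obj M"
  shows "pro_id C X \<in> hom M X X"
  unfolding pro_id_def
proof (rule mk_promor_hom[OF X X])
  fix j assume j: "j \<in> Obj (Shape X)"
  then show "germ C X j (Idn C (onObj X j)) \<in> colim_hom C X (onObj X j)"
    using X by (intro colim_homI Idn_hom onObj_Obj)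
next
  fix j j' b assume b: "b \<in> hom (Shape X) j j'"
  note O = shape_hom_Obj[OF X b]
  note h = onArr_hom[OF X b]
  show "germ_push C X (onArr X b) (germ C X j (Idn C (onObj X j))) = germ C X j' (Idn C (onObj X j'))"
    using germ_push_germ[OF X O(1) Idn_hom h] onObj_Obj[OF X] O
      germ_restrict[OF X b Idn_hom] Idn_right[OF h] Idn_left[OF h] by simp
qed

text \<open>
  Composition is defined as a union over all representatives of the outer component. It can be
  computed from one of them because the components of the inner morphism are compatible with the
  transition maps of the middle object.
\<close>

lemma Comps_pro_comp:
  assumes \<phi>: "\<phi> \<in> hom M X Y" and k: "k \<in> Obj (Shape (Tgt \<psi>))"
    and \<psi>k: "Comps \<psi> k = germ C Y j g" and j: "j \<in> Obj (Shape Y)" and g: "g \<in> hom C (onObj Y j) B"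
  shows "Comps (pro_comp C \<psi> \<phi>) k = germ_push C X g (Comps \<phi> j)"
proof -
  have X: "X \<in> Obj M" and Y: "Y \<in> Obj M" and s: "Src \<phi> = X" using \<phi> by (auto simp: hom_ProDet)
  have "(\<Union>(j, g)\<in>germ C Y j g. germ_push C X g (Comps \<phi> j)) = germ_push C X g (Comps \<phi> j)"
  proof (rule germ_UN[OF Y j g])
    fix j j' b g
    assume b: "b \<in> hom (Shape Y) j' j" and g: "g \<in> hom C (onObj Y j) B"
    show "germ_push C X (g \<cdot> onArr Y b) (Comps \<phi> j') = germ_push C X g (Comps \<phi> j)"
      using germ_push_push[OF X Comps_colim_hom[OF \<phi> shape_hom_Obj(1)[OF Y b]] onArr_hom[OF Y b] g]
      unfolding Comps_push[OF \<phi> b] by (rule sym)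
  qed
  moreover have "Comps (pro_comp C \<psi> \<phi>) k = (\<Union>(j, g)\<in>Comps \<psi> k. germ_push C (Src \<phi>) g (Comps \<phi> j))"
    using k by (simp add: pro_comp_def)
  ultimately show ?thesis unfolding \<psi>k s by (rule trans[rotated])
qed

lemma Comps_pro_comp_germ:
  assumes "\<phi> \<in> hom M X Y" "k \<in> Obj (Shape (Tgt \<psi>))"
    and "Comps \<psi> k = germ C Y j g" "j \<in> Obj (Shape Y)" "g \<in> hom C (onObj Y j) B"
    and "Comps \<phi> j = germ C X i f" "i \<in> Obj (Shape X)" "f \<in> hom C (onObj X i) (onObj Y j)"
  shows "Comps (pro_comp C \<psi> \<phi>) k = germ C X i (g \<cdot> f)"
  using Comps_pro_comp[OF assms(1-5)] germ_push_germ[OF ProDet_hom_Obj(1)[OF assms(1)] assms(7,8,5)]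
    assms(6) by simp

lemma pro_comp_hom:
  assumes \<phi>: "\<phi> \<in> hom M X Y" and \<psi>: "\<psi> \<in> hom M Y Z"
  shows "pro_comp C \<psi> \<phi> \<in> hom M X Z"
proof -
  have X: "X \<in> Obj M" and Y: "Y \<in> Obj M" and Z: "Z \<in> Obj M" and s: "Src \<phi> = X" "Tgt \<psi> = Z"
    using \<phi> \<psi> by (auto simp: hom_ProDet)
  let ?c = "Comps (pro_comp C \<psi> \<phi>)"
  have rep: "\<exists>i f. i \<in> Obj (Shape X) \<and> f \<in> hom C (onObj X i) (onObj Z k) \<and> ?c k = germ C X i f \<and>
      (\<forall>k' b. b \<in> hom (Shape Z) k k' \<longrightarrow> ?c k' = germ C X i (onArr Z b \<cdot> f))"
    if k: "k \<in> Obj (Shape Z)" for k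
  proof -
    obtain j g where g: "j \<in> Obj (Shape Y)" "g \<in> hom C (onObj Y j) (onObj Z k)" "Comps \<psi> k = germ C Y j g"
      using Comps_colim_hom[OF \<psi> k] by (rule colim_homE)
    obtain i f where f: "i \<in> Obj (Shape X)" "f \<in> hom C (onObj X i) (onObj Y j)" "Comps \<phi> j = germ C X i f"
      using Comps_colim_hom[OF \<phi> g(1)] by (rule colim_homE)
    have "?c k = germ C X i (g \<cdot> f)"
      by (rule Comps_pro_comp_germ[OF \<phi> _ g(3,1,2) f(3,1,2)]) (use k s in simp)
    moreover have "?c k' = germ C X i (onArr Z b \<cdot> g \<cdot> f)" if b: "b \<in> hom (Shape Z) k k'" for k' b
    proof -
      note k' = shape_hom_Obj(2)[OF Z b]
      have "Comps \<psi> k' = germ C Y j (onArr Z b \<cdot> g)"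
        using Comps_push[OF \<psi> b] germ_push_germ[OF Y g(1,2) onArr_hom[OF Z b]] g(3) by simp
      then show ?thesis
        using Comps_pro_comp_germ[OF \<phi> _ _ g(1) Cmp_hom[OF g(2) onArr_hom[OF Z b]] f(3,1,2), of k' \<psi>]
          k' s Cmp_assoc[OF f(2) g(2) onArr_hom[OF Z b]] by simp
    qed
    ultimately show ?thesis using f(1) Cmp_hom[OF f(2) g(2)] by blast
  qed
  have "mk_promor X Z ?c \<in> hom M X Z"
  proof (rule mk_promor_hom[OF X Z])
    fix k assume "k \<in> Obj (Shape Z)"
    from rep[OF this] show "?c k \<in> colim_hom C X (onObj Z k)" using colim_homI by force
  next
    fix k k' b assume b: "b \<in> hom (Shape Z) k k'"
    from rep[OF shape_hom_Obj(1)[OF Z b]] b obtain i f where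
      "i \<in> Obj (Shape X)" "f \<in> hom C (onObj X i) (onObj Z k)" "?c k = germ C X i f"
      "?c k' = germ C X i (onArr Z b \<cdot> f)" by blast
    then show "germ_push C X (onArr Z b) (?c k) = ?c k'"
      using germ_push_germ[OF X _ _ onArr_hom[OF Z b]] by simp
  qed
  moreover have "mk_promor X Z ?c = pro_comp C \<psi> \<phi>"
    unfolding pro_comp_def s by (rule mk_promor_Comps)
  ultimately show ?thesis by simp
qed


lemma pro_tenO_simps [simp]:
  "Shape (pro_tenO C X Y) = prod_cat (Shape X) (Shape Y)"
  "onObj (pro_tenO C X Y) (upair i k) = onObj X i \<otimes> onObj Y k"
  "onArr (pro_tenO C X Y) (upair a b) = onArr X a \<odot> onArr Y b"
  for i k a b :: 'u
  by (simp_all add: pro_tenO_def)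

lemma pro_tenO_Obj:
  assumes X: "X \<in> Obj M" and Y: "Y \<in> Obj M"
  shows "pro_tenO C X Y \<in> Obj M"
proof -
  note J = ProDet_Obj_small[OF X] and K = ProDet_Obj_small[OF Y]
  note E = prod_cat_hom_cases
  show ?thesis
  proof (rule ProDet_ObjI)
    show "Sm (Obj (Shape (pro_tenO C X Y)))" "Sm (Arr (Shape (pro_tenO C X Y)))"
      using Sm_upairs[OF J(1) K(1)] Sm_upairs[OF J(2) K(2)] by (simp_all add: prod_cat_def)
    show "cofiltered (Shape (pro_tenO C X Y))" using cofiltered_prod_cat[OF J(3) K(3)] by simp
  next
    fix c assume "c \<in> Obj (Shape (pro_tenO C X Y))"
    then show "onObj (pro_tenO C X Y) c \<in> Obj C"
      "onArr (pro_tenO C X Y) (Idn (Shape (pro_tenO C X Y)) c) = Idn C (onObj (pro_tenO C X Y) c)"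
      using onObj_Obj[OF X] onObj_Obj[OF Y]
      by (auto elim!: prod_cat_ObjE simp: prod_cat_simps onArr_Idn X Y tenA_Idn intro!: tenO_Obj)
  next
    fix c x y assume "c \<in> hom (Shape (pro_tenO C X Y)) x y"
    then have c: "c \<in> hom (prod_cat (Shape X) (Shape Y)) x y" by simp
    from c show "onArr (pro_tenO C X Y) c \<in> hom C (onObj (pro_tenO C X Y) x) (onObj (pro_tenO C X Y) y)"
      by (rule E) (simp add: tenA_hom onArr_hom[OF X] onArr_hom[OF Y])
    from c show "deterministic C (onArr (pro_tenO C X Y) c)"
      by (rule E)
        (use onArr_hom[OF X] onArr_hom[OF Y] onArr_det[OF X] onArr_det[OF Y] deterministic_tenA in fastforce)
  next
    fix c d x y z assume "c \<in> hom (Shape (pro_tenO C X Y)) x y" "d \<in> hom (Shape (pro_tenO C X Y)) y z"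
    then have c: "c \<in> hom (prod_cat (Shape X) (Shape Y)) x y"
      and d: "d \<in> hom (prod_cat (Shape X) (Shape Y)) y z" by simp_all
    obtain a b i k i' k' where 1: "x = upair i k" "y = upair i' k'" "c = upair a b"
      "a \<in> hom (Shape X) i i'" "b \<in> hom (Shape Y) k k'" using E[OF c] .
    obtain a' b' j l i'' k'' where 2: "y = upair j l" "z = upair i'' k''" "d = upair a' b'"
      "a' \<in> hom (Shape X) j i''" "b' \<in> hom (Shape Y) l k''" using E[OF d] .
    have jl: "j = i'" "l = k'" using 1(2) 2(1) by auto
    note 2 = 2(2-5)[unfolded jl]
    show "onArr (pro_tenO C X Y) (d \<cdot>\<^bsub>Shape (pro_tenO C X Y)\<^esub> c)
        = onArr (pro_tenO C X Y) d \<cdot> onArr (pro_tenO C X Y) c"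
      using tenA_Cmp[OF onArr_hom[OF X 1(4)] onArr_hom[OF X 2(3)] onArr_hom[OF Y 1(5)] onArr_hom[OF Y 2(4)]]
        onArr_Cmp[OF X 1(4) 2(3)] onArr_Cmp[OF Y 1(5) 2(4)]
      by (simp add: 1(3) 2(2) prod_cat_simps)
  qed
qed

lemma pro_tenA_simps [simp]:
  "Src (pro_tenA C \<phi> \<psi>) = pro_tenO C (Src \<phi>) (Src \<psi>)"
  "Tgt (pro_tenA C \<phi> \<psi>) = pro_tenO C (Tgt \<phi>) (Tgt \<psi>)"
  by (simp_all add: pro_tenA_def)

text \<open>
  The union over pairs of representatives collapses in one variable at a time; each time the other
  variable is held fixed by an identity arrow of its index category.
\<close>

lemma Comps_pro_tenA:
  assumes X: "X \<in> Obj M" and Y: "Y \<in> Obj M" and s: "Src \<phi> = X" "Src \<psi> = Y"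
    and jl: "j \<in> Obj (Shape (Tgt \<phi>))" "l \<in> Obj (Shape (Tgt \<psi>))"
    and f: "Comps \<phi> j = germ C X i f" "i \<in> Obj (Shape X)" "f \<in> hom C (onObj X i) A"
    and g: "Comps \<psi> l = germ C Y k g" "k \<in> Obj (Shape Y)" "g \<in> hom C (onObj Y k) B"
  shows "Comps (pro_tenA C \<phi> \<psi>) (upair j l) = germ C (pro_tenO C X Y) (upair i k) (f \<odot> g)"
proof -
  let ?T = "pro_tenO C X Y"
  have T: "?T \<in> Obj M" by (rule pro_tenO_Obj[OF X Y])
  have inner: "(\<Union>(k, g)\<in>germ C Y k g. germ C ?T (upair i k) (f \<odot> g)) = germ C ?T (upair i k) (f \<odot> g)"
    if i: "i \<in> Obj (Shape X)" and f: "f \<in> hom C (onObj X i) A" for i f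
  proof (rule germ_UN[OF Y g(2,3)])
    fix k k' b g assume b: "b \<in> hom (Shape Y) k' k" and g: "g \<in> hom C (onObj Y k) B"
    have "Idn (Shape X) i \<in> hom (Shape X) i i"
      using category.Idn_hom[OF ProDet_Obj_small(4)[OF X]] i by simp
    then have "upair (Idn (Shape X) i) b \<in> hom (Shape ?T) (upair i k') (upair i k)"
      using b prod_cat_homI by simp
    from germ_restrict[OF T this, of "f \<odot> g" "A \<otimes> B"]
    show "germ C ?T (upair i k') (f \<odot> (g \<cdot> onArr Y b)) = germ C ?T (upair i k) (f \<odot> g)"
      using tenA_Cmp[OF Idn_hom f onArr_hom[OF Y b] g] hom_Obj[OF f] tenA_hom[OF f g]
        Idn_right[OF f] by (simp add: onArr_Idn[OF X i])
  qed
  have "(\<Union>(i, f)\<in>germ C X i f. (\<lambda>i f. \<Union>(k, g)\<in>germ C Y k g. germ C ?T (upair i k) (f \<odot> g)) i f)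
      = (\<Union>(k, g)\<in>germ C Y k g. germ C ?T (upair i k) (f \<odot> g))"
  proof (rule germ_UN[OF X f(2,3)])
    fix i i' a f assume a: "a \<in> hom (Shape X) i' i" and f: "f \<in> hom C (onObj X i) A"
    note O = shape_hom_Obj[OF X a] and ha = onArr_hom[OF X a]
    have "Idn (Shape Y) k \<in> hom (Shape Y) k k"
      using category.Idn_hom[OF ProDet_Obj_small(4)[OF Y]] g by simp
    then have "upair a (Idn (Shape Y) k) \<in> hom (Shape ?T) (upair i' k) (upair i k)"
      using a prod_cat_homI by simp
    from germ_restrict[OF T this, of "f \<odot> g" "A \<otimes> B"]
    have "germ C ?T (upair i' k) ((f \<cdot> onArr X a) \<odot> g) = germ C ?T (upair i k) (f \<odot> g)"
      using tenA_Cmp[OF ha f Idn_hom g(3)] hom_Obj[OF g(3)] tenA_hom[OF f g(3)]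
        Idn_right[OF g(3)] by (simp add: onArr_Idn[OF Y g(2)])
    then show "(\<Union>(k, g)\<in>germ C Y k g. germ C ?T (upair i' k) ((f \<cdot> onArr X a) \<odot> g))
        = (\<Union>(k, g)\<in>germ C Y k g. germ C ?T (upair i k) (f \<odot> g))"
      using inner[OF O(2) f] inner[OF O(1) Cmp_hom[OF ha f]] by simp
  qed
  then show ?thesis
    using inner[OF f(2,3)] jl s f(1) g(1) by (simp add: pro_tenA_def prod_cat_simps)
qed

lemma pro_tenA_hom:
  assumes \<phi>: "\<phi> \<in> hom M X X'" and \<psi>: "\<psi> \<in> hom M Y Y'"
  shows "pro_tenA C \<phi> \<psi> \<in> hom M (pro_tenO C X Y) (pro_tenO C X' Y')"
proof -
  note XX = ProDet_hom_Obj[OF \<phi>] and YY = ProDet_hom_Obj[OF \<psi>]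
  have s: "Src \<phi> = X" "Src \<psi> = Y" "Tgt \<phi> = X'" "Tgt \<psi> = Y'" using \<phi> \<psi> by (auto simp: hom_ProDet)
  let ?T = "pro_tenO C X Y" and ?T' = "pro_tenO C X' Y'" and ?\<theta> = "pro_tenA C \<phi> \<psi>"
  have T: "?T \<in> Obj M" "?T' \<in> Obj M" using pro_tenO_Obj XX YY by auto
  have rep: "\<exists>i f k g. i \<in> Obj (Shape X) \<and> f \<in> hom C (onObj X i) (onObj X' j) \<and>
      k \<in> Obj (Shape Y) \<and> g \<in> hom C (onObj Y k) (onObj Y' l) \<and>
      Comps \<phi> j = germ C X i f \<and> Comps \<psi> l = germ C Y k g"
    if "j \<in> Obj (Shape X')" "l \<in> Obj (Shape Y')" for j l
    using Comps_colim_hom[OF \<phi> that(1)] Comps_colim_hom[OF \<psi> that(2)] by (metis colim_homE)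
  have "mk_promor ?T ?T' (Comps ?\<theta>) \<in> hom M ?T ?T'"
  proof (rule mk_promor_hom[OF T])
    fix c assume "c \<in> Obj (Shape ?T')"
    then obtain j l where c: "c = upair j l" "j \<in> Obj (Shape X')" "l \<in> Obj (Shape Y')"
      by (auto elim: prod_cat_ObjE)
    from rep[OF c(2,3)] obtain i f k g where r: "i \<in> Obj (Shape X)" "f \<in> hom C (onObj X i) (onObj X' j)"
      "k \<in> Obj (Shape Y)" "g \<in> hom C (onObj Y k) (onObj Y' l)"
      "Comps \<phi> j = germ C X i f" "Comps \<psi> l = germ C Y k g" by blast
    have "Comps ?\<theta> c = germ C ?T (upair i k) (f \<odot> g)"
      using Comps_pro_tenA[OF XX(1) YY(1) s(1,2) _ _ r(5,1,2) r(6,3,4)] s c by simp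
    then show "Comps ?\<theta> c \<in> colim_hom C ?T (onObj ?T' c)"
      using colim_homI[of "upair i k" ?T "f \<odot> g"] r c tenA_hom[OF r(2,4)] by (simp add: prod_cat_simps)
  next
    fix c c' b assume "b \<in> hom (Shape ?T') c c'"
    then have "b \<in> hom (prod_cat (Shape X') (Shape Y')) c c'" by simp
    from prod_cat_hom_cases[OF this]
    obtain a d j l j' l' where b: "c = upair j l" "c' = upair j' l'" "b = upair a d"
      "a \<in> hom (Shape X') j j'" "d \<in> hom (Shape Y') l l'" .
    note Oj = shape_hom_Obj[OF XX(2) b(4)] and Ol = shape_hom_Obj[OF YY(2) b(5)]
    note ha = onArr_hom[OF XX(2) b(4)] and hd = onArr_hom[OF YY(2) b(5)]
    from rep[OF Oj(1) Ol(1)] obtain i f k g where r: "i \<in> Obj (Shape X)" "f \<in> hom C (onObj X i) (onObj X' j)"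
      "k \<in> Obj (Shape Y)" "g \<in> hom C (onObj Y k) (onObj Y' l)"
      "Comps \<phi> j = germ C X i f" "Comps \<psi> l = germ C Y k g" by blast
    have "Comps \<phi> j' = germ C X i (onArr X' a \<cdot> f)" "Comps \<psi> l' = germ C Y k (onArr Y' d \<cdot> g)"
      using Comps_push[OF \<phi> b(4)] Comps_push[OF \<psi> b(5)] r
        germ_push_germ[OF XX(1) r(1,2) ha] germ_push_germ[OF YY(1) r(3,4) hd] by auto
    then have "Comps ?\<theta> c' = germ C ?T (upair i k) ((onArr X' a \<cdot> f) \<odot> (onArr Y' d \<cdot> g))"
      using Comps_pro_tenA[OF XX(1) YY(1) s(1,2) _ _ _ r(1) Cmp_hom[OF r(2) ha] _ r(3) Cmp_hom[OF r(4) hd]]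
        s Oj Ol b by simp
    moreover have "Comps ?\<theta> c = germ C ?T (upair i k) (f \<odot> g)"
      using Comps_pro_tenA[OF XX(1) YY(1) s(1,2) _ _ r(5,1,2) r(6,3,4)] s Oj Ol b by simp
    ultimately show "germ_push C ?T (onArr ?T' b) (Comps ?\<theta> c) = Comps ?\<theta> c'"
      using germ_push_germ[OF T(1), of "upair i k" "f \<odot> g", OF _ _ tenA_hom[OF ha hd]]
        r(1,3) tenA_hom[OF r(2,4)] tenA_Cmp[OF r(2) ha r(4) hd] b(3) by (simp add: prod_cat_simps)
  qed
  moreover have "mk_promor ?T ?T' (Comps ?\<theta>) = ?\<theta>"
    unfolding pro_tenA_def s by (rule mk_promor_Comps)
  ultimately show ?thesis by simp
qed

lemma pro_unt_simps [simp]: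
  "Shape (pro_unt C) = (one_cat :: ('u, 'u) cat)" "onObj (pro_unt C) (i :: 'u) = unt C"
  "onArr (pro_unt C) (a :: 'u) = Idn C (unt C)"
  by (simp_all add: pro_unt_def)

lemma one_cat_simps [simp]:
  "i \<in> Obj one_cat \<longleftrightarrow> i = undefined" "a \<in> hom one_cat i j \<longleftrightarrow> a = undefined \<and> i = undefined \<and> j = undefined"
  "Idn one_cat i = undefined" "b \<cdot>\<^bsub>one_cat\<^esub> a = undefined"
  for a b i j :: 'u
  by (auto simp: one_cat_def hom_def)

lemma pro_unt_Obj: "pro_unt C \<in> Obj M"
proof (rule ProDet_ObjI)
  have "Arr (one_cat :: ('u, 'u) cat) = {undefined}" "Obj (one_cat :: ('u, 'u) cat) = {undefined}"
    by (simp_all add: one_cat_def)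
  then show "Sm (Obj (Shape (pro_unt C)))" "Sm (Arr (Shape (pro_unt C)))"
    using Sm_singleton by simp_all
  have "category (one_cat :: ('u, 'u) cat)"
    by unfold_locales (simp_all, simp_all add: one_cat_def)
  then have "cofiltered (one_cat :: ('u, 'u) cat)"
    by (rule cofilteredI[of _ undefined]) auto
  then show "cofiltered (Shape (pro_unt C :: ('u, 'o, 'm) diagram))" by simp
qed (use unt_Obj Idn_left[OF Idn_hom] in \<open>auto intro!: Idn_hom deterministic_Idn\<close>)

lemma pro_lunit_simps [simp]:
  "Src (pro_lunit C X) = pro_tenO C (pro_unt C) X" "Tgt (pro_lunit C X) = X"
  "i \<in> Obj (Shape X) \<Longrightarrow> Comps (pro_lunit C X) i
    = germ C (pro_tenO C (pro_unt C) X) (upair undefined i) (lunit C (onObj X i))"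
  by (simp_all add: pro_lunit_def)

lemma pro_lunit_hom:
  assumes X: "X \<in> Obj M"
  shows "pro_lunit C X \<in> hom M (pro_tenO C (pro_unt C) X) X"
proof -
  let ?T = "pro_tenO C (pro_unt C) X"
  have T: "?T \<in> Obj M" by (rule pro_tenO_Obj[OF pro_unt_Obj X])
  have l: "lunit C (onObj X i) \<in> hom C (onObj ?T (upair undefined i)) (onObj X i)"
    if "i \<in> Obj (Shape X)" for i
    using lunit_hom[OF onObj_Obj[OF X that]] by simp
  show ?thesis
    unfolding pro_lunit_def
  proof (rule mk_promor_hom[OF T X])
    fix j assume "j \<in> Obj (Shape X)"
    then show "germ C ?T (upair undefined j) (lunit C (onObj X j)) \<in> colim_hom C ?T (onObj X j)"
      using l by (intro colim_homI) (auto simp: prod_cat_simps)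
  next
    fix j j' b assume b: "b \<in> hom (Shape X) j j'"
    note O = shape_hom_Obj[OF X b] and hb = onArr_hom[OF X b]
    have "upair undefined b \<in> hom (Shape ?T) (upair undefined j) (upair undefined j')"
      using b by (auto intro: prod_cat_homI)
    from germ_restrict[OF T this l[OF O(2)]]
    show "germ_push C ?T (onArr X b) (germ C ?T (upair undefined j) (lunit C (onObj X j)))
        = germ C ?T (upair undefined j') (lunit C (onObj X j'))"
      using germ_push_germ[OF T _ l[OF O(1)] hb] lunit_natural[OF hb] O
      by (simp add: prod_cat_simps)
  qed
qed


lemma cofiltered_span:
  assumes "X \<in> Obj M" "i \<in> Obj (Shape X)" "j \<in> Obj (Shape X)"
  obtains k a b where "k \<in> Obj (Shape X)" "a \<in> hom (Shape X) k i" "b \<in> hom (Shape X) k j"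
  using cofilteredE_span[OF ProDet_Obj_small(3)[OF assms(1)] assms(2,3)] .

lemma cofiltered_equalize:
  assumes "X \<in> Obj M" "a \<in> hom (Shape X) i j" "b \<in> hom (Shape X) i j"
  obtains k c where "c \<in> hom (Shape X) k i" "a \<cdot>\<^bsub>Shape X\<^esub> c = b \<cdot>\<^bsub>Shape X\<^esub> c"
  using cofilteredE_equalize[OF ProDet_Obj_small(3)[OF assms(1)] assms(2,3)] .

text \<open>
  The components at any two indices agree on a common refinement, since discarding absorbs the
  transition maps.
\<close>

lemma Comps_pro_del:
  assumes X: "X \<in> Obj M" and i: "i \<in> Obj (Shape X)"
  shows "Comps (pro_del C X) undefined = germ C X i (del C (onObj X i))"
proof -
  have const: "germ C X j (del C (onObj X j)) = germ C X i (del C (onObj X i))" if j: "j \<in> Obj (Shape X)" for j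
  proof -
    obtain k a b where k: "k \<in> Obj (Shape X)" "a \<in> hom (Shape X) k i" "b \<in> hom (Shape X) k j"
      using cofiltered_span[OF X i j] .
    note d = del_hom[OF onObj_Obj[OF X i]] del_hom[OF onObj_Obj[OF X j]]
    show ?thesis
      using germ_restrict[OF X k(2) d(1)] germ_restrict[OF X k(3) d(2)]
        del_natural[OF onArr_hom[OF X k(2)]] del_natural[OF onArr_hom[OF X k(3)]] by simp
  qed
  have "(\<Union>j\<in>Obj (Shape X). germ C X j (del C (onObj X j))) = germ C X i (del C (onObj X i))"
    by (rule SUP_eq_const[OF _ const]) (use i in auto)
  then show ?thesis by (simp add: pro_del_def)
qed

lemma pro_del_hom:
  assumes X: "X \<in> Obj M"
  shows "pro_del C X \<in> hom M X (pro_unt C)"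
proof -
  obtain i where i: "i \<in> Obj (Shape X)"
    using ProDet_Obj_small(3)[OF X] by (auto simp: cofiltered_def)
  note d = del_hom[OF onObj_Obj[OF X i]]
  have D: "Comps (pro_del C X) undefined = germ C X i (del C (onObj X i))"
    by (rule Comps_pro_del[OF X i])
  have "mk_promor X (pro_unt C) (Comps (pro_del C X)) \<in> hom M X (pro_unt C)"
    by (rule mk_promor_hom[OF X pro_unt_Obj])
      (use colim_homI[OF i d] germ_push_germ[OF X i d Idn_hom[OF unt_Obj]] Idn_left[OF d] D in auto)
  moreover have "mk_promor X (pro_unt C) (Comps (pro_del C X)) = pro_del C X"
    unfolding pro_del_def by (rule mk_promor_Comps)
  ultimately show ?thesis by simp
qed

text \<open>
  The component of the copy map does not depend on the choice of a common refinement, since any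
  two spans over the same pair of indices become equal on a further refinement, and copying
  commutes with the deterministic transition maps.
\<close>

lemma Comps_pro_copy:
  assumes X: "X \<in> Obj M" and a: "a \<in> hom (Shape X) k i" and b: "b \<in> hom (Shape X) k i'"
  shows "Comps (pro_copy C X) (upair i i')
    = germ C X k ((onArr X a \<odot> onArr X b) \<cdot> copy C (onObj X k))"
proof -
  let ?S = "Shape X"
  let ?G = "\<lambda>k a b. germ C X k ((onArr X a \<odot> onArr X b) \<cdot> copy C (onObj X k))"
  have refine: "?G l (a \<cdot>\<^bsub>?S\<^esub> c) (b \<cdot>\<^bsub>?S\<^esub> c) = ?G k a b"
    if a: "a \<in> hom ?S k i" and b: "b \<in> hom ?S k i'" and c: "c \<in> hom ?S l k" for k a b c l
  proof -
    note ha = onArr_hom[OF X a] and hb = onArr_hom[OF X b] and hc = onArr_hom[OF X c]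
    note cp = copy_hom[OF onObj_Obj[OF X shape_hom_Obj(1)[OF X a]]]
      copy_hom[OF onObj_Obj[OF X shape_hom_Obj(1)[OF X c]]]
    have "((onArr X a \<odot> onArr X b) \<cdot> copy C (onObj X k)) \<cdot> onArr X c
        = (onArr X (a \<cdot>\<^bsub>?S\<^esub> c) \<odot> onArr X (b \<cdot>\<^bsub>?S\<^esub> c)) \<cdot> copy C (onObj X l)"
      using Cmp_assoc[OF hc cp(1) tenA_hom[OF ha hb]] deterministicD[OF onArr_det[OF X c] hc]
        Cmp_assoc[OF cp(2) tenA_hom[OF hc hc] tenA_hom[OF ha hb]] tenA_Cmp[OF hc ha hc hb]
        onArr_Cmp[OF X c a] onArr_Cmp[OF X c b] by simp
    then show ?thesis using germ_restrict[OF X c Cmp_hom[OF cp(1) tenA_hom[OF ha hb]]] by simp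
  qed
  have const: "?G k' a' b' = ?G k a b" if a': "a' \<in> hom ?S k' i" and b': "b' \<in> hom ?S k' i'" for k' a' b'
  proof -
    interpret S: category ?S by (rule ProDet_Obj_small(4)[OF X])
    obtain l c c' where c: "c \<in> hom ?S l k" "c' \<in> hom ?S l k'"
      using cofiltered_span[OF X shape_hom_Obj(1)[OF X a] shape_hom_Obj(1)[OF X a']] .
    obtain l1 d where d: "d \<in> hom ?S l1 l" "(a \<cdot>\<^bsub>?S\<^esub> c) \<cdot>\<^bsub>?S\<^esub> d = (a' \<cdot>\<^bsub>?S\<^esub> c') \<cdot>\<^bsub>?S\<^esub> d"
      using cofiltered_equalize[OF X S.Cmp_hom[OF c(1) a] S.Cmp_hom[OF c(2) a']] .
    obtain l2 e where e: "e \<in> hom ?S l2 l1"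
      "((b \<cdot>\<^bsub>?S\<^esub> c) \<cdot>\<^bsub>?S\<^esub> d) \<cdot>\<^bsub>?S\<^esub> e = ((b' \<cdot>\<^bsub>?S\<^esub> c') \<cdot>\<^bsub>?S\<^esub> d) \<cdot>\<^bsub>?S\<^esub> e"
      using cofiltered_equalize[OF X S.Cmp_hom[OF d(1) S.Cmp_hom[OF c(1) b]]
          S.Cmp_hom[OF d(1) S.Cmp_hom[OF c(2) b']]] .
    note nn = S.Cmp_hom[OF c(1) a] S.Cmp_hom[OF c(1) b]
    have eq: "?G l2 (((a \<cdot>\<^bsub>?S\<^esub> c) \<cdot>\<^bsub>?S\<^esub> d) \<cdot>\<^bsub>?S\<^esub> e) (((b \<cdot>\<^bsub>?S\<^esub> c) \<cdot>\<^bsub>?S\<^esub> d) \<cdot>\<^bsub>?S\<^esub> e) = ?G k a b"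
      unfolding refine[OF S.Cmp_hom[OF d(1) nn(1)] S.Cmp_hom[OF d(1) nn(2)] e(1)]
        refine[OF nn d(1)] refine[OF a b c(1)] ..
    note n' = S.Cmp_hom[OF c(2) a'] S.Cmp_hom[OF c(2) b']
    have m': "?G l2 (((a' \<cdot>\<^bsub>?S\<^esub> c') \<cdot>\<^bsub>?S\<^esub> d) \<cdot>\<^bsub>?S\<^esub> e) (((b' \<cdot>\<^bsub>?S\<^esub> c') \<cdot>\<^bsub>?S\<^esub> d) \<cdot>\<^bsub>?S\<^esub> e) = ?G k' a' b'"
      unfolding refine[OF S.Cmp_hom[OF d(1) n'(1)] S.Cmp_hom[OF d(1) n'(2)] e(1)]
        refine[OF n' d(1)] refine[OF a' b' c(2)] ..
    show ?thesis using eq m' unfolding d(2) e(2) by simp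
  qed
  have "(\<Union>k\<in>Obj ?S. \<Union>a\<in>hom ?S k i. \<Union>b\<in>hom ?S k i'. ?G k a b) = ?G k a b"
  proof (rule equalityI)
    show "(\<Union>k\<in>Obj ?S. \<Union>a\<in>hom ?S k i. \<Union>b\<in>hom ?S k i'. ?G k a b) \<subseteq> ?G k a b"
      by (intro UN_least equalityD1[OF const])
    show "?G k a b \<subseteq> (\<Union>k\<in>Obj ?S. \<Union>a\<in>hom ?S k i. \<Union>b\<in>hom ?S k i'. ?G k a b)"
      by (rule subsetI) (intro UN_I[OF shape_hom_Obj(1)[OF X a]] UN_I[OF a] UN_I[OF b])
  qed
  then show ?thesis
    using shape_hom_Obj[OF X a] shape_hom_Obj[OF X b] by (simp add: pro_copy_def prod_cat_simps)
qed

lemma pro_copy_hom: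
  assumes X: "X \<in> Obj M"
  shows "pro_copy C X \<in> hom M X (pro_tenO C X X)"
proof -
  let ?T = "pro_tenO C X X" and ?S = "Shape X"
  have T: "?T \<in> Obj M" by (rule pro_tenO_Obj[OF X X])
  interpret S: category ?S by (rule ProDet_Obj_small(4)[OF X])
  have "mk_promor X ?T (Comps (pro_copy C X)) \<in> hom M X ?T"
  proof (rule mk_promor_hom[OF X T])
    fix c assume "c \<in> Obj (Shape ?T)"
    then obtain i i' where c: "c = upair i i'" "i \<in> Obj ?S" "i' \<in> Obj ?S"
      by (auto elim: prod_cat_ObjE)
    obtain k a b where k: "k \<in> Obj ?S" "a \<in> hom ?S k i" "b \<in> hom ?S k i'"
      using cofiltered_span[OF X c(2,3)] .
    show "Comps (pro_copy C X) c \<in> colim_hom C X (onObj ?T c)"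
      unfolding c(1) Comps_pro_copy[OF X k(2,3)]
      using k onObj_Obj[OF X] onArr_hom[OF X]
      by (intro colim_homI) (auto intro!: Cmp_hom[OF copy_hom tenA_hom])
  next
    fix c c' d assume "d \<in> hom (Shape ?T) c c'"
    then have "d \<in> hom (prod_cat ?S ?S) c c'" by simp
    from prod_cat_hom_cases[OF this]
    obtain b b' i i' j j' where d: "c = upair i i'" "c' = upair j j'" "d = upair b b'"
      "b \<in> hom ?S i j" "b' \<in> hom ?S i' j'" .
    obtain k a a' where k: "k \<in> Obj ?S" "a \<in> hom ?S k i" "a' \<in> hom ?S k i'"
      using cofiltered_span[OF X shape_hom_Obj(1)[OF X d(4)] shape_hom_Obj(1)[OF X d(5)]] .
    note cp = copy_hom[OF onObj_Obj[OF X k(1)]]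
    note h = onArr_hom[OF X d(4)] onArr_hom[OF X d(5)] onArr_hom[OF X k(2)] onArr_hom[OF X k(3)]
    show "germ_push C X (onArr ?T d) (Comps (pro_copy C X) c) = Comps (pro_copy C X) c'"
      unfolding d(1,2) Comps_pro_copy[OF X k(2,3)]
        Comps_pro_copy[OF X S.Cmp_hom[OF k(2) d(4)] S.Cmp_hom[OF k(3) d(5)]]
      using germ_push_germ[OF X k(1) Cmp_hom[OF cp tenA_hom[OF h(3,4)]] tenA_hom[OF h(1,2)]] d(3)
        Cmp_assoc[OF cp tenA_hom[OF h(3,4)] tenA_hom[OF h(1,2)]] tenA_Cmp[OF h(3,1,4,2)]
        onArr_Cmp[OF X k(2) d(4)] onArr_Cmp[OF X k(3) d(5)] by simp
  qed
  moreover have "mk_promor X ?T (Comps (pro_copy C X)) = pro_copy C X"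
    unfolding pro_copy_def by (rule mk_promor_Comps)
  ultimately show ?thesis by simp
qed

text \<open>
  At a pair of indices of the target, both sides of the determinism equation are computed from a
  deterministic representative over a common refinement of the two indices.
\<close>

lemma deterministic_ProDet:
  assumes \<phi>: "\<phi> \<in> hom M X Y"
    and rep: "\<And>j. j \<in> Obj (Shape Y) \<Longrightarrow> \<exists>i\<in>Obj (Shape X). \<exists>f\<in>hom C (onObj X i) (onObj Y j).
      deterministic C f \<and> Comps \<phi> j = germ C X i f"
  shows "deterministic M \<phi>"
proof -
  have XY: "X \<in> Obj M" "Y \<in> Obj M" "Src \<phi> = X" "Tgt \<phi> = Y" using \<phi> by (auto simp: hom_ProDet)
  note T = pro_tenO_Obj[OF XY(1,1)] pro_tenO_Obj[OF XY(2,2)]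
  note \<phi>\<phi> = pro_tenA_hom[OF \<phi> \<phi>]
  note cX = pro_copy_hom[OF XY(1)] and cY = pro_copy_hom[OF XY(2)]
  have "pro_comp C (pro_copy C Y) \<phi> = pro_comp C (pro_tenA C \<phi> \<phi>) (pro_copy C X)"
  proof (rule promor_eqI[OF pro_comp_hom[OF \<phi> cY] pro_comp_hom[OF cX \<phi>\<phi>]])
    fix c assume c': "c \<in> Obj (Shape (pro_tenO C Y Y))"
    then obtain j j' where c: "c = upair j j'" "j \<in> Obj (Shape Y)" "j' \<in> Obj (Shape Y)"
      by (auto elim: prod_cat_ObjE)
    obtain k a b where k: "k \<in> Obj (Shape Y)" "a \<in> hom (Shape Y) k j" "b \<in> hom (Shape Y) k j'"
      using cofiltered_span[OF XY(2) c(2,3)] .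
    obtain i f where f: "i \<in> Obj (Shape X)" "f \<in> hom C (onObj X i) (onObj Y k)"
      "deterministic C f" "Comps \<phi> k = germ C X i f" using rep[OF k(1)] by blast
    note ha = onArr_hom[OF XY(2) k(2)] and hb = onArr_hom[OF XY(2) k(3)]
    note cpi = copy_hom[OF onObj_Obj[OF XY(1) f(1)]] and cpk = copy_hom[OF onObj_Obj[OF XY(2) k(1)]]
    have "Tgt (pro_copy C Y) = pro_tenO C Y Y" by (simp add: pro_copy_def)
    then have "Comps (pro_comp C (pro_copy C Y) \<phi>) c
        = germ C X i (((onArr Y a \<odot> onArr Y b) \<cdot> copy C (onObj Y k)) \<cdot> f)"
      using Comps_pro_comp_germ[OF \<phi> _ Comps_pro_copy[OF XY(2) k(2,3)] k(1)
          Cmp_hom[OF cpk tenA_hom[OF ha hb]] f(4,1,2)] c c' by simp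
    also have "\<dots> = germ C X i (((onArr Y a \<cdot> f) \<odot> (onArr Y b \<cdot> f)) \<cdot> copy C (onObj X i))"
      using Cmp_assoc[OF f(2) cpk tenA_hom[OF ha hb]] deterministicD[OF f(3,2)]
        Cmp_assoc[OF cpi tenA_hom[OF f(2,2)] tenA_hom[OF ha hb]] tenA_Cmp[OF f(2) ha f(2) hb] by simp
    finally have L: "Comps (pro_comp C (pro_copy C Y) \<phi>) c
        = germ C X i (((onArr Y a \<cdot> f) \<odot> (onArr Y b \<cdot> f)) \<cdot> copy C (onObj X i))" .
    have "Comps \<phi> j = germ C X i (onArr Y a \<cdot> f)" "Comps \<phi> j' = germ C X i (onArr Y b \<cdot> f)"
      using Comps_push[OF \<phi> k(2)] Comps_push[OF \<phi> k(3)] f(4)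
        germ_push_germ[OF XY(1) f(1,2) ha] germ_push_germ[OF XY(1) f(1,2) hb] by auto
    then have "Comps (pro_tenA C \<phi> \<phi>) c
        = germ C (pro_tenO C X X) (upair i i) ((onArr Y a \<cdot> f) \<odot> (onArr Y b \<cdot> f))"
      using Comps_pro_tenA[OF XY(1,1,3,3) _ _ _ f(1) Cmp_hom[OF f(2) ha] _ f(1) Cmp_hom[OF f(2) hb]]
        XY(4) c by simp
    moreover have "Comps (pro_copy C X) (upair i i) = germ C X i (copy C (onObj X i))"
    proof -
      have "Idn (Shape X) i \<in> hom (Shape X) i i"
        using category.Idn_hom[OF ProDet_Obj_small(4)[OF XY(1)] f(1)] .
      then show ?thesis
        using Comps_pro_copy[OF XY(1), of "Idn (Shape X) i" i i "Idn (Shape X) i" i]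
          onArr_Idn[OF XY(1) f(1)] tenA_Idn onObj_Obj[OF XY(1) f(1)] Idn_left[OF cpi] by simp
    qed
    ultimately have "Comps (pro_comp C (pro_tenA C \<phi> \<phi>) (pro_copy C X)) c
        = germ C X i (((onArr Y a \<cdot> f) \<odot> (onArr Y b \<cdot> f)) \<cdot> copy C (onObj X i))"
      using Comps_pro_comp_germ[OF cX, of c "pro_tenA C \<phi> \<phi>" "upair i i"
          "(onArr Y a \<cdot> f) \<odot> (onArr Y b \<cdot> f)" "onObj Y j \<otimes> onObj Y j'" i "copy C (onObj X i)"]
        f(1) cpi c' XY(4) tenA_hom[OF Cmp_hom[OF f(2) ha] Cmp_hom[OF f(2) hb]]
      by (simp add: prod_cat_simps)
    then show "Comps (pro_comp C (pro_copy C Y) \<phi>) c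
        = Comps (pro_comp C (pro_tenA C \<phi> \<phi>) (pro_copy C X)) c" using L by simp
  qed
  then show ?thesis using \<phi> XY by (simp add: deterministic_def homD)
qed

end

section \<open>Limits of levelwise systems\<close>

text \<open>
  A diagram of pro-objects \<open>P j\<close> whose transition maps \<open>t a\<close> come from maps of diagrams: \<open>p a\<close>
  sends an index \<open>c\<close> of the source to one of the target, and \<open>m a c\<close> represents the component of \<open>t a\<close> at
  \<open>p a c\<close>. Surjectivity of \<open>p a\<close> ensures that all components of \<open>t a\<close> are of this form.
\<close>

locale level_system = pro_markov C Sm + J: category J
  for C :: "('o, 'm, 'x) markov_scheme" (structure) and Sm :: "'u set \<Rightarrow> bool"
    and J :: "('j, 'a) cat" +
  fixes P :: "'j \<Rightarrow> ('u, 'o, 'm) diagram" and t :: "'a \<Rightarrow> ('u, 'o, 'm) promor"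
    and p :: "'a \<Rightarrow> 'u \<Rightarrow> 'u" and m :: "'a \<Rightarrow> 'u \<Rightarrow> 'm"
  assumes P_Obj: "j \<in> Obj J \<Longrightarrow> P j \<in> Obj M"
    and p_Obj: "a \<in> hom J i j \<Longrightarrow> c \<in> Obj (Shape (P i)) \<Longrightarrow> p a c \<in> Obj (Shape (P j))"
    and p_surj: "a \<in> hom J i j \<Longrightarrow> d \<in> Obj (Shape (P j)) \<Longrightarrow> \<exists>c\<in>Obj (Shape (P i)). p a c = d"
    and p_Idn: "j \<in> Obj J \<Longrightarrow> c \<in> Obj (Shape (P j)) \<Longrightarrow> p (Idn J j) c = c"
    and m_hom: "a \<in> hom J i j \<Longrightarrow> c \<in> Obj (Shape (P i)) \<Longrightarrow>
      m a c \<in> hom C (onObj (P i) c) (onObj (P j) (p a c))"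
    and m_Idn: "j \<in> Obj J \<Longrightarrow> c \<in> Obj (Shape (P j)) \<Longrightarrow> m (Idn J j) c = Idn C (onObj (P j) c)"
    and t_hom: "a \<in> hom J i j \<Longrightarrow> t a \<in> hom M (P i) (P j)"
    and Comps_t: "a \<in> hom J i j \<Longrightarrow> c \<in> Obj (Shape (P i)) \<Longrightarrow>
      Comps (t a) (p a c) = germ C (P i) c (m a c)"

text \<open>
  A pro-object \<open>L\<close> that is indexed by the pairs of a level \<open>j\<close> and an index \<open>c\<close> of \<open>P j\<close>, up to a
  bijective encoding \<open>e\<close> of these pairs. Its arrows are described only through their action: those
  from \<open>(i, c)\<close> to \<open>(j, d)\<close> act by a level map followed by a transition map of \<open>P j\<close>, and all such
  composites occur. This leaves the encoding of arrows open, so that the description applies to \<open>L\<close> and to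
  \<open>L \<otimes> Y\<close> alike.
\<close>

locale level_limit = level_system C Sm J P t p m
  for C :: "('o, 'm, 'x) markov_scheme" (structure) and Sm :: "'u set \<Rightarrow> bool"
    and J :: "('j, 'a) cat" and P t p m +
  fixes L :: "('u, 'o, 'm) diagram" and e :: "'j \<Rightarrow> 'u \<Rightarrow> 'u"
    and \<pi> :: "'j \<Rightarrow> ('u, 'o, 'm) promor"
  assumes L_Obj: "L \<in> Obj M"
    and e_Obj: "j \<in> Obj J \<Longrightarrow> c \<in> Obj (Shape (P j)) \<Longrightarrow> e j c \<in> Obj (Shape L)"
    and e_cover: "l \<in> Obj (Shape L) \<Longrightarrow> \<exists>j\<in>Obj J. \<exists>c\<in>Obj (Shape (P j)). l = e j c"
    and e_inj: "i \<in> Obj J \<Longrightarrow> c \<in> Obj (Shape (P i)) \<Longrightarrow> j \<in> Obj J \<Longrightarrow> d \<in> Obj (Shape (P j)) \<Longrightarrow>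
      e i c = e j d \<Longrightarrow> i = j \<and> c = d"
    and onObj_e: "j \<in> Obj J \<Longrightarrow> c \<in> Obj (Shape (P j)) \<Longrightarrow> onObj L (e j c) = onObj (P j) c"
    and L_arr_elim: "i \<in> Obj J \<Longrightarrow> c \<in> Obj (Shape (P i)) \<Longrightarrow> j \<in> Obj J \<Longrightarrow> d \<in> Obj (Shape (P j)) \<Longrightarrow>
      l \<in> hom (Shape L) (e i c) (e j d) \<Longrightarrow>
      \<exists>a\<in>hom J i j. \<exists>b\<in>hom (Shape (P j)) (p a c) d. onArr L l = onArr (P j) b \<cdot> m a c"
    and L_arr_intro: "a \<in> hom J i j \<Longrightarrow> c \<in> Obj (Shape (P i)) \<Longrightarrow> b \<in> hom (Shape (P j)) (p a c) d \<Longrightarrow>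
      \<exists>l\<in>hom (Shape L) (e i c) (e j d). onArr L l = onArr (P j) b \<cdot> m a c"
    and proj_hom: "j \<in> Obj J \<Longrightarrow> \<pi> j \<in> hom M L (P j)"
    and Comps_proj: "j \<in> Obj J \<Longrightarrow> c \<in> Obj (Shape (P j)) \<Longrightarrow>
      Comps (\<pi> j) c = germ C L (e j c) (Idn C (onObj (P j) c))"
begin

lemma germ_level_map:
  assumes a: "a \<in> hom J i j" and c: "c \<in> Obj (Shape (P i))"
  shows "germ C L (e i c) (m a c) = germ C L (e j (p a c)) (Idn C (onObj (P j) (p a c)))"
proof -
  have j: "j \<in> Obj J" and pc: "p a c \<in> Obj (Shape (P j))"
    using J.hom_Obj(2)[OF a] p_Obj[OF a c] by auto
  note O = onObj_Obj[OF P_Obj[OF j] pc]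
  have "Idn (Shape (P j)) (p a c) \<in> hom (Shape (P j)) (p a c) (p a c)"
    using category.Idn_hom[OF ProDet_Obj_small(4)[OF P_Obj[OF j]] pc] .
  from L_arr_intro[OF a c this] obtain l where
    l: "l \<in> hom (Shape L) (e i c) (e j (p a c))" "onArr L l = Idn C (onObj (P j) (p a c)) \<cdot> m a c"
    using onArr_Idn[OF P_Obj[OF j] pc] by auto
  have "Idn C (onObj (P j) (p a c)) \<in> hom C (onObj L (e j (p a c))) (onObj (P j) (p a c))"
    using Idn_hom[OF O] onObj_e[OF j pc] by simp
  from germ_restrict[OF L_Obj l(1) this] show ?thesis
    using l(2) Idn_left[OF m_hom[OF a c]] by simp
qed

lemma cone_proj: "is_cone J M P t L \<pi>"
  unfolding is_cone_def
proof (intro conjI ballI)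
  show "L \<in> Obj M" by (rule L_Obj)
next
  fix i assume "i \<in> Obj J" then show "\<pi> i \<in> hom M L (P i)" by (rule proj_hom)
next
  fix a assume "a \<in> Arr J"
  then have a: "a \<in> hom J (Dom J a) (Cod J a)" by (simp add: homI)
  let ?i = "Dom J a" and ?j = "Cod J a"
  note i = J.hom_Obj(1)[OF a] and j = J.hom_Obj(2)[OF a]
  have "pro_comp C (t a) (\<pi> ?i) = \<pi> ?j"
  proof (rule promor_eqI[OF pro_comp_hom[OF proj_hom[OF i] t_hom[OF a]] proj_hom[OF j]])
    fix d assume d: "d \<in> Obj (Shape (P ?j))"
    then obtain c where c: "c \<in> Obj (Shape (P ?i))" "p a c = d" using p_surj[OF a] by blast
    have T: "Tgt (t a) = P ?j" using t_hom[OF a] by (simp add: hom_ProDet)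
    have id: "Idn C (onObj (P ?i) c) \<in> hom C (onObj L (e ?i c)) (onObj (P ?i) c)"
      using Idn_hom onObj_Obj[OF P_Obj[OF i] c(1)] onObj_e[OF i c(1)] by simp
    have "Comps (pro_comp C (t a) (\<pi> ?i)) (p a c) = germ C L (e ?i c) (m a c \<cdot> Idn C (onObj (P ?i) c))"
      by (rule Comps_pro_comp_germ[OF proj_hom[OF i] _ Comps_t[OF a c(1)] c(1) m_hom[OF a c(1)]
            Comps_proj[OF i c(1)] e_Obj[OF i c(1)] id]) (use T c d in simp)
    also have "\<dots> = germ C L (e ?j (p a c)) (Idn C (onObj (P ?j) (p a c)))"
      using germ_level_map[OF a c(1)] Idn_right[OF m_hom[OF a c(1)]] by simp
    finally show "Comps (pro_comp C (t a) (\<pi> ?i)) d = Comps (\<pi> ?j) d"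
      using Comps_proj[OF j d] c(2) by simp
  qed
  then show "t a \<cdot>\<^bsub>M\<^esub> \<pi> (Dom J a) = \<pi> (Cod J a)" by simp
qed

text \<open>
  Since the projections consist of identities, composing with \<open>\<pi> j\<close> merely selects the components
  of a morphism into \<open>L\<close> at the indices that come from level \<open>j\<close>.
\<close>

lemma Comps_proj_comp:
  assumes u: "u \<in> hom M T L" and j: "j \<in> Obj J" and c: "c \<in> Obj (Shape (P j))"
  shows "Comps (pro_comp C (\<pi> j) u) c = Comps u (e j c)"
proof -
  have T: "T \<in> Obj M" and Tgt: "Tgt (\<pi> j) = P j" using u proj_hom[OF j] by (auto simp: hom_ProDet)
  have id: "Idn C (onObj (P j) c) \<in> hom C (onObj L (e j c)) (onObj (P j) c)"
    using Idn_hom onObj_Obj[OF P_Obj[OF j] c] onObj_e[OF j c] by simp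
  have "Comps (pro_comp C (\<pi> j) u) c = germ_push C T (Idn C (onObj (P j) c)) (Comps u (e j c))"
    by (rule Comps_pro_comp[OF u _ Comps_proj[OF j c] e_Obj[OF j c] id]) (use c Tgt in simp)
  then show ?thesis
    using germ_push_Idn[OF T Comps_colim_hom[OF u e_Obj[OF j c]]] onObj_e[OF j c] by simp
qed

text \<open>
  The component of the mediating morphism at \<open>(j, c)\<close> is forced to be that of the given cone leg \<open>\<tau> j\<close>
  at \<open>c\<close>. The cone equations give compatibility along level maps, and the legs being morphisms gives
  compatibility inside each level.
\<close>

theorem limit_cone: "is_limit_cone J M P t L \<pi>"
  unfolding is_limit_cone_def
proof (intro conjI allI impI)
  show "is_cone J M P t L \<pi>" by (rule cone_proj)
next
  fix T \<tau> assume cone: "is_cone J M P t T \<tau>"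
  then have T: "T \<in> Obj M" and \<tau>: "\<And>j. j \<in> Obj J \<Longrightarrow> \<tau> j \<in> hom M T (P j)"
    by (auto simp: is_cone_def)
  have t\<tau>: "pro_comp C (t a) (\<tau> i) = \<tau> j" if "a \<in> hom J i j" for a i j
    using cone that by (auto simp: is_cone_def hom_def)
  \<comment> \<open>the level and the index that an index of L stands for\<close>
  define lev where "lev l = (SOME (j, c). j \<in> Obj J \<and> c \<in> Obj (Shape (P j)) \<and> l = e j c)" for l
  have lev: "lev (e j c) = (j, c)" if "j \<in> Obj J" "c \<in> Obj (Shape (P j))" for j c
    unfolding lev_def by (rule some_equality) (use that e_inj in auto)
  define u where "u = mk_promor T L (\<lambda>l. Comps (\<tau> (fst (lev l))) (snd (lev l)))"
  have Comps_u: "Comps u (e j c) = Comps (\<tau> j) c" if "j \<in> Obj J" "c \<in> Obj (Shape (P j))" for j c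
    unfolding u_def using that e_Obj lev by simp
  have u: "u \<in> hom M T L"
    unfolding u_def
  proof (rule mk_promor_hom[OF T L_Obj])
    fix l assume "l \<in> Obj (Shape L)"
    then obtain j c where jc: "j \<in> Obj J" "c \<in> Obj (Shape (P j))" "l = e j c" using e_cover by blast
    then show "Comps (\<tau> (fst (lev l))) (snd (lev l)) \<in> colim_hom C T (onObj L l)"
      using Comps_colim_hom[OF \<tau>[OF jc(1)] jc(2)] onObj_e lev by simp
  next
    fix l l' x assume x: "x \<in> hom (Shape L) l l'"
    obtain i c where ic: "i \<in> Obj J" "c \<in> Obj (Shape (P i))" "l = e i c"
      using e_cover shape_hom_Obj(1)[OF L_Obj x] by blast
    obtain j d where jd: "j \<in> Obj J" "d \<in> Obj (Shape (P j))" "l' = e j d"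
      using e_cover shape_hom_Obj(2)[OF L_Obj x] by blast
    obtain a b where ab: "a \<in> hom J i j" "b \<in> hom (Shape (P j)) (p a c) d"
      "onArr L x = onArr (P j) b \<cdot> m a c"
      using L_arr_elim[OF ic(1,2) jd(1,2)] x ic(3) jd(3) by blast
    have Tg: "Tgt (t a) = P j" using t_hom[OF ab(1)] by (simp add: hom_ProDet)
    have "germ_push C T (m a c) (Comps (\<tau> i) c) = Comps (pro_comp C (t a) (\<tau> i)) (p a c)"
      by (rule Comps_pro_comp[OF \<tau>[OF ic(1)] _ Comps_t[OF ab(1) ic(2)] ic(2) m_hom[OF ab(1) ic(2)], symmetric])
        (use Tg p_Obj[OF ab(1) ic(2)] in simp)
    then have "germ_push C T (m a c) (Comps (\<tau> i) c) = Comps (\<tau> j) (p a c)"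
      unfolding t\<tau>[OF ab(1)] .
    then have "germ_push C T (onArr L x) (Comps (\<tau> i) c) = Comps (\<tau> j) d"
      using germ_push_push[OF T Comps_colim_hom[OF \<tau>[OF ic(1)] ic(2)] m_hom[OF ab(1) ic(2)]
          onArr_hom[OF P_Obj[OF jd(1)] ab(2)]] Comps_push[OF \<tau>[OF jd(1)] ab(2)] ab(3) by simp
    then show "germ_push C T (onArr L x) (Comps (\<tau> (fst (lev l))) (snd (lev l)))
        = Comps (\<tau> (fst (lev l'))) (snd (lev l'))"
      using ic jd lev by simp
  qed
  show "\<exists>!u. u \<in> hom M T L \<and> (\<forall>j\<in>Obj J. \<pi> j \<cdot>\<^bsub>M\<^esub> u = \<tau> j)"
  proof (rule ex1I[of _ u], intro conjI ballI u)
    fix j assume j: "j \<in> Obj J"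
    have "pro_comp C (\<pi> j) u = \<tau> j"
      by (rule promor_eqI[OF pro_comp_hom[OF u proj_hom[OF j]] \<tau>[OF j]])
        (use Comps_proj_comp[OF u j] Comps_u[OF j] in simp)
    then show "\<pi> j \<cdot>\<^bsub>M\<^esub> u = \<tau> j" by simp
  next
    fix v assume v: "v \<in> hom M T L \<and> (\<forall>j\<in>Obj J. \<pi> j \<cdot>\<^bsub>M\<^esub> v = \<tau> j)"
    show "v = u"
    proof (rule promor_eqI[of _ T L])
      fix l assume "l \<in> Obj (Shape L)"
      then obtain j c where jc: "j \<in> Obj J" "c \<in> Obj (Shape (P j))" "l = e j c" using e_cover by blast
      have "Comps v (e j c) = Comps (pro_comp C (\<pi> j) v) c" using Comps_proj_comp[OF conjunct1[OF v] jc(1,2)] by simp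
      also have "pro_comp C (\<pi> j) v = \<tau> j" using v jc(1) by simp
      finally show "Comps v l = Comps u l" using Comps_u jc by simp
    qed (use u v in auto)
  qed
qed

text \<open>
  The components of the projections are represented by identities, which are deterministic.
\<close>

lemma deterministic_proj:
  assumes j: "j \<in> Obj J"
  shows "deterministic M (\<pi> j)"
proof (rule deterministic_ProDet[OF proj_hom[OF j]])
  fix c assume c: "c \<in> Obj (Shape (P j))"
  note O = onObj_Obj[OF P_Obj[OF j] c]
  show "\<exists>l\<in>Obj (Shape L). \<exists>f\<in>hom C (onObj L l) (onObj (P j) c).
      deterministic C f \<and> Comps (\<pi> j) c = germ C L l f"
    using e_Obj[OF j c] Idn_hom[OF O] deterministic_Idn[OF O] Comps_proj[OF j c] onObj_e[OF j c]
    by (intro bexI[of _ "e j c"] bexI[of _ "Idn C (onObj (P j) c)"]) auto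
qed

text \<open>
  Tensoring with a fixed object \<open>Y\<close> multiplies all index categories by that of \<open>Y\<close>, and the
  presentation of the arrows of \<open>L\<close> persists by the interchange law.
\<close>

theorem level_limit_tenO:
  assumes Y: "Y \<in> Obj M"
  shows "level_limit C Sm J (\<lambda>j. pro_tenO C (P j) Y) (\<lambda>a. pro_tenA C (t a) (pro_id C Y))
    (\<lambda>a c. upair (p a (ufst c)) (usnd c)) (\<lambda>a c. m a (ufst c) \<odot> Idn C (onObj Y (usnd c)))
    (pro_tenO C L Y) (\<lambda>j c. upair (e j (ufst c)) (usnd c)) (\<lambda>j. pro_tenA C (\<pi> j) (pro_id C Y))"
proof -
  note idY = pro_id_hom[OF Y] and OY = onObj_Obj[OF Y]
  have sY: "Src (pro_id C Y) = Y" "Tgt (pro_id C Y) = Y" using idY by (simp_all add: hom_ProDet)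
  show ?thesis
  proof unfold_locales
    fix j assume j: "j \<in> Obj J"
    show "pro_tenO C (P j) Y \<in> Obj M" by (rule pro_tenO_Obj[OF P_Obj[OF j] Y])
    show "pro_tenA C (\<pi> j) (pro_id C Y) \<in> hom M (pro_tenO C L Y) (pro_tenO C (P j) Y)"
      by (rule pro_tenA_hom[OF proj_hom[OF j] idY])
  next
    show "pro_tenO C L Y \<in> Obj M" by (rule pro_tenO_Obj[OF L_Obj Y])
  next
    fix a i j c assume a: "a \<in> hom J i j" and c: "c \<in> Obj (Shape (pro_tenO C (P i) Y))"
    obtain d k where dk: "c = upair d k" "d \<in> Obj (Shape (P i))" "k \<in> Obj (Shape Y)"
      using c by (auto elim: prod_cat_ObjE)
    note i = J.hom_Obj(1)[OF a] and j = J.hom_Obj(2)[OF a]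
    show "upair (p a (ufst c)) (usnd c) \<in> Obj (Shape (pro_tenO C (P j) Y))"
      using dk p_Obj[OF a dk(2)] by (simp add: prod_cat_simps)
    show "m a (ufst c) \<odot> Idn C (onObj Y (usnd c))
        \<in> hom C (onObj (pro_tenO C (P i) Y) c) (onObj (pro_tenO C (P j) Y) (upair (p a (ufst c)) (usnd c)))"
      using tenA_hom[OF m_hom[OF a dk(2)] Idn_hom[OF OY[OF dk(3)]]] dk(1) by simp
    have Tg: "Src (t a) = P i" "Tgt (t a) = P j" using t_hom[OF a] by (simp_all add: hom_ProDet)
    have "Comps (pro_tenA C (t a) (pro_id C Y)) (upair (p a d) k)
        = germ C (pro_tenO C (P i) Y) (upair d k) (m a d \<odot> Idn C (onObj Y k))"
      by (rule Comps_pro_tenA[OF P_Obj[OF i] Y Tg(1) sY(1) _ _ Comps_t[OF a dk(2)] dk(2) m_hom[OF a dk(2)]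
            Comps_pro_id[OF dk(3)] dk(3) Idn_hom[OF OY[OF dk(3)]]])
        (use Tg sY p_Obj[OF a dk(2)] dk in simp_all)
    then show "Comps (pro_tenA C (t a) (pro_id C Y)) (upair (p a (ufst c)) (usnd c))
        = germ C (pro_tenO C (P i) Y) c (m a (ufst c) \<odot> Idn C (onObj Y (usnd c)))"
      using dk(1) by simp
  next
    fix a i j d assume a: "a \<in> hom J i j" and d: "d \<in> Obj (Shape (pro_tenO C (P j) Y))"
    obtain d' k where dk: "d = upair d' k" "d' \<in> Obj (Shape (P j))" "k \<in> Obj (Shape Y)"
      using d by (auto elim: prod_cat_ObjE)
    obtain c where "c \<in> Obj (Shape (P i))" "p a c = d'" using p_surj[OF a dk(2)] by blast
    then show "\<exists>c\<in>Obj (Shape (pro_tenO C (P i) Y)). upair (p a (ufst c)) (usnd c) = d"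
      using dk by (intro bexI[of _ "upair c k"]) (simp_all add: prod_cat_simps)
  next
    fix a i j assume a: "a \<in> hom J i j"
    show "pro_tenA C (t a) (pro_id C Y) \<in> hom M (pro_tenO C (P i) Y) (pro_tenO C (P j) Y)"
      by (rule pro_tenA_hom[OF t_hom[OF a] idY])
  next
    fix j c assume j: "j \<in> Obj J" and c: "c \<in> Obj (Shape (pro_tenO C (P j) Y))"
    obtain d k where dk: "c = upair d k" "d \<in> Obj (Shape (P j))" "k \<in> Obj (Shape Y)"
      using c by (auto elim: prod_cat_ObjE)
    note OP = onObj_Obj[OF P_Obj[OF j] dk(2)]
    show "upair (p (Idn J j) (ufst c)) (usnd c) = c" using dk p_Idn[OF j dk(2)] by simp
    show "m (Idn J j) (ufst c) \<odot> Idn C (onObj Y (usnd c)) = Idn C (onObj (pro_tenO C (P j) Y) c)"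
      using dk m_Idn[OF j dk(2)] tenA_Idn[OF OP OY[OF dk(3)]] by simp
    show "upair (e j (ufst c)) (usnd c) \<in> Obj (Shape (pro_tenO C L Y))"
      using dk e_Obj[OF j dk(2)] by (simp add: prod_cat_simps)
    show "onObj (pro_tenO C L Y) (upair (e j (ufst c)) (usnd c)) = onObj (pro_tenO C (P j) Y) c"
      using dk onObj_e[OF j dk(2)] by simp
    have Tg: "Src (\<pi> j) = L" "Tgt (\<pi> j) = P j" using proj_hom[OF j] by (simp_all add: hom_ProDet)
    have id: "Idn C (onObj (P j) d) \<in> hom C (onObj L (e j d)) (onObj (P j) d)"
      using Idn_hom[OF OP] onObj_e[OF j dk(2)] by simp
    have "Comps (pro_tenA C (\<pi> j) (pro_id C Y)) (upair d k)
        = germ C (pro_tenO C L Y) (upair (e j d) k) (Idn C (onObj (P j) d) \<odot> Idn C (onObj Y k))"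
      by (rule Comps_pro_tenA[OF L_Obj Y Tg(1) sY(1) _ _ Comps_proj[OF j dk(2)] e_Obj[OF j dk(2)] id
            Comps_pro_id[OF dk(3)] dk(3) Idn_hom[OF OY[OF dk(3)]]])
        (use Tg sY dk in simp_all)
    then show "Comps (pro_tenA C (\<pi> j) (pro_id C Y)) c
        = germ C (pro_tenO C L Y) (upair (e j (ufst c)) (usnd c)) (Idn C (onObj (pro_tenO C (P j) Y) c))"
      using dk(1) tenA_Idn[OF OP OY[OF dk(3)]] by simp
  next
    fix l assume "l \<in> Obj (Shape (pro_tenO C L Y))"
    then obtain l' k where lk: "l = upair l' k" "l' \<in> Obj (Shape L)" "k \<in> Obj (Shape Y)"
      by (auto elim: prod_cat_ObjE)
    obtain j c where "j \<in> Obj J" "c \<in> Obj (Shape (P j))" "l' = e j c" using e_cover[OF lk(2)] by blast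
    then show "\<exists>j\<in>Obj J. \<exists>c\<in>Obj (Shape (pro_tenO C (P j) Y)). l = upair (e j (ufst c)) (usnd c)"
      using lk by (intro bexI[of _ j] bexI[of _ "upair c k"]) (simp_all add: prod_cat_simps)
  next
    fix i c j d
    assume i: "i \<in> Obj J" and c: "c \<in> Obj (Shape (pro_tenO C (P i) Y))"
      and j: "j \<in> Obj J" and d: "d \<in> Obj (Shape (pro_tenO C (P j) Y))"
    obtain c' k where ck: "c = upair c' k" "c' \<in> Obj (Shape (P i))" "k \<in> Obj (Shape Y)"
      using c by (auto elim: prod_cat_ObjE)
    obtain d' k' where dk: "d = upair d' k'" "d' \<in> Obj (Shape (P j))" "k' \<in> Obj (Shape Y)"
      using d by (auto elim: prod_cat_ObjE)
    show "i = j \<and> c = d" if "upair (e i (ufst c)) (usnd c) = upair (e j (ufst d)) (usnd d)"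
      using that e_inj[OF i ck(2) j dk(2)] ck(1) dk(1) by simp
    fix l assume "l \<in> hom (Shape (pro_tenO C L Y)) (upair (e i (ufst c)) (usnd c)) (upair (e j (ufst d)) (usnd d))"
    then have "l \<in> hom (prod_cat (Shape L) (Shape Y)) (upair (e i c') k) (upair (e j d') k')"
      using ck(1) dk(1) by simp
    then obtain x y where xy: "l = upair x y" "x \<in> hom (Shape L) (e i c') (e j d')" "y \<in> hom (Shape Y) k k'"
      by (rule prod_cat_homE)
    obtain a b where ab: "a \<in> hom J i j" "b \<in> hom (Shape (P j)) (p a c') d'"
      "onArr L x = onArr (P j) b \<cdot> m a c'"
      using L_arr_elim[OF i ck(2) j dk(2) xy(2)] by blast
    note hy = onArr_hom[OF Y xy(3)]
    have "onArr (pro_tenO C L Y) l = (onArr (P j) b \<odot> onArr Y y) \<cdot> (m a c' \<odot> Idn C (onObj Y k))"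
      using xy(1) ab(3) Idn_right[OF hy]
        tenA_Cmp[OF m_hom[OF ab(1) ck(2)] onArr_hom[OF P_Obj[OF j] ab(2)] Idn_hom[OF OY[OF ck(3)]] hy] by simp
    then show "\<exists>a\<in>hom J i j. \<exists>b\<in>hom (Shape (pro_tenO C (P j) Y)) (upair (p a (ufst c)) (usnd c)) d.
        onArr (pro_tenO C L Y) l = onArr (pro_tenO C (P j) Y) b \<cdot> (m a (ufst c) \<odot> Idn C (onObj Y (usnd c)))"
      using ab(1) prod_cat_homI[OF ab(2) xy(3)] ck(1) dk(1)
      by (intro bexI[of _ a] bexI[of _ "upair b y"]) simp_all
  next
    fix a i j c b d
    assume a: "a \<in> hom J i j" and c: "c \<in> Obj (Shape (pro_tenO C (P i) Y))"
      and b: "b \<in> hom (Shape (pro_tenO C (P j) Y)) (upair (p a (ufst c)) (usnd c)) d"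
    note j = J.hom_Obj(2)[OF a]
    obtain c' k where ck: "c = upair c' k" "c' \<in> Obj (Shape (P i))" "k \<in> Obj (Shape Y)"
      using c by (auto elim: prod_cat_ObjE)
    have "b \<in> hom (prod_cat (Shape (P j)) (Shape Y)) (upair (p a c') k) d" using b ck(1) by simp
    from prod_cat_hom_cases[OF this]
    obtain x y d' k' where xy: "d = upair d' k'" "b = upair x y" "x \<in> hom (Shape (P j)) (p a c') d'"
      "y \<in> hom (Shape Y) k k'" by (metis upair_eq_iff)
    obtain l where l: "l \<in> hom (Shape L) (e i c') (e j d')" "onArr L l = onArr (P j) x \<cdot> m a c'"
      using L_arr_intro[OF a ck(2) xy(3)] by blast
    note hy = onArr_hom[OF Y xy(4)]
    have "onArr (pro_tenO C L Y) (upair l y) = (onArr (P j) x \<odot> onArr Y y) \<cdot> (m a c' \<odot> Idn C (onObj Y k))"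
      using l(2) Idn_right[OF hy]
        tenA_Cmp[OF m_hom[OF a ck(2)] onArr_hom[OF P_Obj[OF j] xy(3)] Idn_hom[OF OY[OF ck(3)]] hy] by simp
    then show "\<exists>l\<in>hom (Shape (pro_tenO C L Y)) (upair (e i (ufst c)) (usnd c)) (upair (e j (ufst d)) (usnd d)).
        onArr (pro_tenO C L Y) l = onArr (pro_tenO C (P j) Y) b \<cdot> (m a (ufst c) \<odot> Idn C (onObj Y (usnd c)))"
      using prod_cat_homI[OF l(1) xy(4)] ck(1) xy(1,2)
      by (intro bexI[of _ "upair l y"]) simp_all
  qed
qed

end

section \<open>The limit of a fibred system\<close>

text \<open>
  The level maps of indices extend to functors, with \<open>q a\<close> the action of \<open>a\<close> on arrows, and the maps
  \<open>m a\<close> are natural; both are strictly functorial in \<open>a\<close>, so that the total category composes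
  associatively on the nose. The lifting property of \<open>q a\<close>, together with the surjectivity of
  \<open>p a\<close>, makes the total category cofiltered. The codes place levels and arrows between levels inside the
  universe from which index categories are taken.
\<close>

locale fibred_system = level_system C Sm J P t p m
  for C :: "('o, 'm, 'x) markov_scheme" (structure) and Sm :: "'u set \<Rightarrow> bool"
    and J :: "('j, 'a) cat" and P t p m +
  fixes q :: "'a \<Rightarrow> 'u \<Rightarrow> 'u" and codeO :: "'j \<Rightarrow> 'u" and codeA :: "'a \<Rightarrow> 'u"
  assumes cofiltered_J: "cofiltered J"
    and q_hom: "a \<in> hom J i j \<Longrightarrow> x \<in> hom (Shape (P i)) c d \<Longrightarrow> q a x \<in> hom (Shape (P j)) (p a c) (p a d)"
    and q_Idn: "a \<in> hom J i j \<Longrightarrow> c \<in> Obj (Shape (P i)) \<Longrightarrow>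
      q a (Idn (Shape (P i)) c) = Idn (Shape (P j)) (p a c)"
    and q_Cmp: "a \<in> hom J i j \<Longrightarrow> x \<in> hom (Shape (P i)) c d \<Longrightarrow> y \<in> hom (Shape (P i)) d d' \<Longrightarrow>
      q a (y \<cdot>\<^bsub>Shape (P i)\<^esub> x) = q a y \<cdot>\<^bsub>Shape (P j)\<^esub> q a x"
    and q_Idn_index: "j \<in> Obj J \<Longrightarrow> x \<in> hom (Shape (P j)) c d \<Longrightarrow> q (Idn J j) x = x"
    and p_Cmp_index: "a \<in> hom J i j \<Longrightarrow> b \<in> hom J j k \<Longrightarrow> c \<in> Obj (Shape (P i)) \<Longrightarrow>
      p (b \<cdot>\<^bsub>J\<^esub> a) c = p b (p a c)"
    and q_Cmp_index: "a \<in> hom J i j \<Longrightarrow> b \<in> hom J j k \<Longrightarrow> x \<in> hom (Shape (P i)) c d \<Longrightarrow>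
      q (b \<cdot>\<^bsub>J\<^esub> a) x = q b (q a x)"
    and q_lift: "a \<in> hom J i j \<Longrightarrow> c \<in> Obj (Shape (P i)) \<Longrightarrow> y \<in> hom (Shape (P j)) d (p a c) \<Longrightarrow>
      \<exists>c'. \<exists>x\<in>hom (Shape (P i)) c' c. q a x = y"
    and m_natural: "a \<in> hom J i j \<Longrightarrow> x \<in> hom (Shape (P i)) c d \<Longrightarrow>
      m a d \<cdot> onArr (P i) x = onArr (P j) (q a x) \<cdot> m a c"
    and m_Cmp_index: "a \<in> hom J i j \<Longrightarrow> b \<in> hom J j k \<Longrightarrow> c \<in> Obj (Shape (P i)) \<Longrightarrow>
      m (b \<cdot>\<^bsub>J\<^esub> a) c = m b (p a c) \<cdot> m a c"
    and m_det: "a \<in> hom J i j \<Longrightarrow> c \<in> Obj (Shape (P i)) \<Longrightarrow> deterministic C (m a c)"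
    and codeO_inj: "inj_on codeO (Obj J)" and codeO_small: "Sm (codeO ` Obj J)"
    and codeA_inj: "inj_on codeA (Arr J)" and codeA_small: "Sm (codeA ` Arr J)"
begin

text \<open>
  An object of the total category is a level \<open>j\<close> with an index \<open>c\<close> at that level. An arrow from
  \<open>(i, c)\<close> to \<open>(j, d)\<close> is an arrow \<open>a\<close> from \<open>i\<close> to \<open>j\<close> with an arrow from \<open>p a c\<close> to \<open>d\<close>; it is
  stored together with its source index, from which its endpoints can be recovered.
\<close>

definition incl :: "'j \<Rightarrow> 'u \<Rightarrow> 'u" where
  "incl j c = upair (codeO j) c"

definition total_arr :: "'a \<Rightarrow> 'u \<Rightarrow> 'u \<Rightarrow> 'u" where
  "total_arr a c x = upair (upair (codeA a) c) x"

text \<open>The following three functions decode objects and arrows of the total category.\<close>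

definition level_of :: "'u \<Rightarrow> 'j" where
  "level_of l = inv_into (Obj J) codeO (ufst l)"

definition base :: "'u \<Rightarrow> 'a" where
  "base f = inv_into (Arr J) codeA (ufst (ufst f))"

definition start :: "'u \<Rightarrow> 'u" where
  "start f = usnd (ufst f)"

definition total :: "('u, 'u) cat" where
  "total =
     \<lparr>Obj = {incl j c | j c. j \<in> Obj J \<and> c \<in> Obj (Shape (P j))},
      Arr = {total_arr a c x | a c x. \<exists>i j d. a \<in> hom J i j \<and> c \<in> Obj (Shape (P i)) \<and>
        x \<in> hom (Shape (P j)) (p a c) d},
      Dom = (\<lambda>f. incl (Dom J (base f)) (start f)),
      Cod = (\<lambda>f. incl (Cod J (base f)) (Cod (Shape (P (Cod J (base f)))) (usnd f))),
      Idn = (\<lambda>l. total_arr (Idn J (level_of l)) (usnd l) (Idn (Shape (P (level_of l))) (usnd l))),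
      Cmp = (\<lambda>g f. total_arr (base g \<cdot>\<^bsub>J\<^esub> base f) (start f)
        (usnd g \<cdot>\<^bsub>Shape (P (Cod J (base g)))\<^esub> q (base g) (usnd f)))\<rparr>"

definition total_diagram :: "('u, 'o, 'm) diagram" where
  "total_diagram =
     \<lparr>Shape = total,
      onObj = (\<lambda>l. onObj (P (level_of l)) (usnd l)),
      onArr = (\<lambda>f. onArr (P (Cod J (base f))) (usnd f) \<cdot> m (base f) (start f))\<rparr>"

lemma incl_inj:
  "i \<in> Obj J \<Longrightarrow> j \<in> Obj J \<Longrightarrow> incl i c = incl j d \<longleftrightarrow> i = j \<and> c = d"
  using codeO_inj by (auto simp: incl_def inj_on_def)

lemma incl_simps [simp]: "j \<in> Obj J \<Longrightarrow> level_of (incl j c) = j" "usnd (incl j c) = c"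
  using codeO_inj by (simp_all add: level_of_def incl_def)

lemma total_arr_simps [simp]:
  "a \<in> hom J i j \<Longrightarrow> base (total_arr a c x) = a" "start (total_arr a c x) = c" "usnd (total_arr a c x) = x"
  using codeA_inj by (simp_all add: base_def start_def total_arr_def homD)

lemma total_homI:
  assumes a: "a \<in> hom J i j" and c: "c \<in> Obj (Shape (P i))" and x: "x \<in> hom (Shape (P j)) (p a c) d"
  shows "total_arr a c x \<in> hom total (incl i c) (incl j d)"
proof (rule homI)
  show "total_arr a c x \<in> Arr total" using assms unfolding total_def by simp blast
qed (use assms in \<open>simp_all add: total_def homD\<close>)

lemma total_homE:
  assumes "f \<in> hom total l l'"
  obtains a i j c d x where "a \<in> hom J i j" "c \<in> Obj (Shape (P i))" "x \<in> hom (Shape (P j)) (p a c) d"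
    "f = total_arr a c x" "l = incl i c" "l' = incl j d"
proof -
  have "f \<in> Arr total" using assms by (simp add: homD)
  then obtain a i j c d x where 1: "a \<in> hom J i j" "c \<in> Obj (Shape (P i))"
    "x \<in> hom (Shape (P j)) (p a c) d" "f = total_arr a c x" by (auto simp: total_def)
  have "l = incl i c" "l' = incl j d"
    using assms total_homI[OF 1(1-3)] 1(4) by (auto simp: hom_def)
  then show ?thesis using that 1 by blast
qed

lemma total_homE_incl:
  assumes f: "f \<in> hom total (incl i c) l'" and i: "i \<in> Obj J"
  obtains a j d x where "a \<in> hom J i j" "c \<in> Obj (Shape (P i))" "x \<in> hom (Shape (P j)) (p a c) d"
    "f = total_arr a c x" "l' = incl j d"
proof -
  obtain a i' j c' d x where 1: "a \<in> hom J i' j" "c' \<in> Obj (Shape (P i'))" "x \<in> hom (Shape (P j)) (p a c') d"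
    "f = total_arr a c' x" "incl i c = incl i' c'" "l' = incl j d" using f by (rule total_homE)
  have "i' = i" "c' = c" using 1(5) incl_inj[OF i J.hom_Obj(1)[OF 1(1)]] by auto
  then show ?thesis using that 1 by blast
qed

lemma total_Obj: "incl j c \<in> Obj total" if "j \<in> Obj J" "c \<in> Obj (Shape (P j))"
  using that by (auto simp: total_def)

lemma total_ObjE:
  assumes "l \<in> Obj total"
  obtains j c where "j \<in> Obj J" "c \<in> Obj (Shape (P j))" "l = incl j c"
  using assms by (auto simp: total_def)

lemma total_Idn:
  "j \<in> Obj J \<Longrightarrow> Idn total (incl j c) = total_arr (Idn J j) c (Idn (Shape (P j)) c)"
  by (simp add: total_def)

lemma total_Cmp:
  assumes "a \<in> hom J i j" "b \<in> hom J j k"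
  shows "total_arr b d y \<cdot>\<^bsub>total\<^esub> total_arr a c x = total_arr (b \<cdot>\<^bsub>J\<^esub> a) c (y \<cdot>\<^bsub>Shape (P k)\<^esub> q b x)"
  using assms by (simp add: total_def homD)

lemma shape_category: "j \<in> Obj J \<Longrightarrow> category (Shape (P j))"
  using ProDet_Obj_small(4)[OF P_Obj] .

lemma category_total: "category total"
proof
  fix f assume "f \<in> Arr total"
  then have "f \<in> hom total (Dom total f) (Cod total f)" by (simp add: homI)
  then obtain a i j c d x where 1: "a \<in> hom J i j" "c \<in> Obj (Shape (P i))"
    "x \<in> hom (Shape (P j)) (p a c) d" "Dom total f = incl i c" "Cod total f = incl j d"
    by (rule total_homE)
  note j = J.hom_Obj[OF 1(1)]
  show "Dom total f \<in> Obj total" "Cod total f \<in> Obj total"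
    using 1 j total_Obj category.hom_Obj(2)[OF shape_category[OF j(2)] 1(3)] by auto
next
  fix l assume "l \<in> Obj total"
  then obtain j c where jc: "j \<in> Obj J" "c \<in> Obj (Shape (P j))" "l = incl j c" by (rule total_ObjE)
  have "Idn (Shape (P j)) c \<in> hom (Shape (P j)) (p (Idn J j) c) c"
    using category.Idn_hom[OF shape_category[OF jc(1)] jc(2)] p_Idn[OF jc(1,2)] by simp
  then show "Idn total l \<in> hom total l l"
    using total_homI[OF J.Idn_hom[OF jc(1)] jc(2)] total_Idn[OF jc(1)] jc(3) by simp
next
  fix f g l l' l''
  assume f: "f \<in> hom total l l'" and g: "g \<in> hom total l' l''"
  obtain a i j c d x where 1: "a \<in> hom J i j" "c \<in> Obj (Shape (P i))"
    "x \<in> hom (Shape (P j)) (p a c) d" "f = total_arr a c x" "l = incl i c" "l' = incl j d"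
    using f by (rule total_homE)
  note j = J.hom_Obj(2)[OF 1(1)]
  obtain b k d' y where 2: "b \<in> hom J j k" "d \<in> Obj (Shape (P j))"
    "y \<in> hom (Shape (P k)) (p b d) d'" "g = total_arr b d y" "l'' = incl k d'"
    using g unfolding 1(6) by (rule total_homE_incl[OF _ j])
  note k = J.hom_Obj(2)[OF 2(1)]
  have "y \<cdot>\<^bsub>Shape (P k)\<^esub> q b x \<in> hom (Shape (P k)) (p (b \<cdot>\<^bsub>J\<^esub> a) c) d'"
    using category.Cmp_hom[OF shape_category[OF k] q_hom[OF 2(1) 1(3)] 2(3)]
      p_Cmp_index[OF 1(1) 2(1) 1(2)] by simp
  then show "g \<cdot>\<^bsub>total\<^esub> f \<in> hom total l l''"
    unfolding 1(4,5) 2(4,5) total_Cmp[OF 1(1) 2(1)]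
    by (rule total_homI[OF J.Cmp_hom[OF 1(1) 2(1)] 1(2)])
next
  fix f l l' assume f: "f \<in> hom total l l'"
  obtain a i j c d x where 1: "a \<in> hom J i j" "c \<in> Obj (Shape (P i))"
    "x \<in> hom (Shape (P j)) (p a c) d" "f = total_arr a c x" "l = incl i c" "l' = incl j d"
    using f by (rule total_homE)
  note i = J.hom_Obj(1)[OF 1(1)] and j = J.hom_Obj(2)[OF 1(1)]
  note c = category.hom_Obj[OF shape_category[OF j] 1(3)]
  show "Idn total l' \<cdot>\<^bsub>total\<^esub> f = f"
    unfolding 1(4,6) total_Idn[OF j] total_Cmp[OF 1(1) J.Idn_hom[OF j]]
    using J.Idn_left[OF 1(1)] q_Idn_index[OF j 1(3)] category.Idn_left[OF shape_category[OF j] 1(3)]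
    by simp
  show "f \<cdot>\<^bsub>total\<^esub> Idn total l = f"
    unfolding 1(4,5) total_Idn[OF i] total_Cmp[OF J.Idn_hom[OF i] 1(1)]
    using J.Idn_right[OF 1(1)] q_Idn[OF 1(1,2)] category.Idn_right[OF shape_category[OF j] 1(3)]
    by simp
next
  fix f g h l l' l'' l'''
  assume f: "f \<in> hom total l l'" and g: "g \<in> hom total l' l''" and h: "h \<in> hom total l'' l'''"
  obtain a i j c d x where 1: "a \<in> hom J i j" "c \<in> Obj (Shape (P i))"
    "x \<in> hom (Shape (P j)) (p a c) d" "f = total_arr a c x" "l = incl i c" "l' = incl j d"
    using f by (rule total_homE)
  obtain b k d' y where 2: "b \<in> hom J j k" "d \<in> Obj (Shape (P j))"
    "y \<in> hom (Shape (P k)) (p b d) d'" "g = total_arr b d y" "l'' = incl k d'"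
    using g unfolding 1(6) by (rule total_homE_incl[OF _ J.hom_Obj(2)[OF 1(1)]])
  obtain b' n d'' z where 3: "b' \<in> hom J k n" "d' \<in> Obj (Shape (P k))"
    "z \<in> hom (Shape (P n)) (p b' d') d''" "h = total_arr b' d' z" "l''' = incl n d''"
    using h unfolding 2(5) by (rule total_homE_incl[OF _ J.hom_Obj(2)[OF 2(1)]])
  have qx: "q b x \<in> hom (Shape (P k)) (p b (p a c)) (p b d)" by (rule q_hom[OF 2(1) 1(3)])
  have "z \<cdot>\<^bsub>Shape (P n)\<^esub> q b' (y \<cdot>\<^bsub>Shape (P k)\<^esub> q b x)
      = (z \<cdot>\<^bsub>Shape (P n)\<^esub> q b' y) \<cdot>\<^bsub>Shape (P n)\<^esub> q (b' \<cdot>\<^bsub>J\<^esub> b) x"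
    using q_Cmp[OF 3(1) qx 2(3)] q_Cmp_index[OF 2(1) 3(1) 1(3)]
      category.Cmp_assoc[OF shape_category[OF J.hom_Obj(2)[OF 3(1)]] q_hom[OF 3(1) qx] q_hom[OF 3(1) 2(3)] 3(3)]
    by simp
  then show "(h \<cdot>\<^bsub>total\<^esub> g) \<cdot>\<^bsub>total\<^esub> f = h \<cdot>\<^bsub>total\<^esub> (g \<cdot>\<^bsub>total\<^esub> f)"
    unfolding 1(4) 2(4) 3(4) total_Cmp[OF 1(1) 2(1)] total_Cmp[OF 2(1) 3(1)]
      total_Cmp[OF 1(1) J.Cmp_hom[OF 2(1) 3(1)]] total_Cmp[OF J.Cmp_hom[OF 1(1) 2(1)] 3(1)]
    using J.Cmp_assoc[OF 1(1) 2(1) 3(1)] by simp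
qed

text \<open>
  Two indices at possibly different levels are refined by pulling both back to a common level along
  the surjections \<open>p a\<close>. For two parallel arrows the levels are equalized first, and the
  remaining pair of arrows in one index category is equalized by an arrow that lifts along \<open>q a\<close>.
\<close>

lemma cofiltered_total: "cofiltered total"
proof -
  obtain j0 where j0: "j0 \<in> Obj J" using cofiltered_J by (auto simp: cofiltered_def)
  obtain c0 where c0: "c0 \<in> Obj (Shape (P j0))"
    using ProDet_Obj_small(3)[OF P_Obj[OF j0]] by (auto simp: cofiltered_def)
  show ?thesis
  proof (rule cofilteredI[OF category_total total_Obj[OF j0 c0]])
    fix l l' assume l: "l \<in> Obj total" and l': "l' \<in> Obj total"
    obtain i c where ic: "i \<in> Obj J" "c \<in> Obj (Shape (P i))" "l = incl i c" using l by (rule total_ObjE)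
    obtain j d where jd: "j \<in> Obj J" "d \<in> Obj (Shape (P j))" "l' = incl j d" using l' by (rule total_ObjE)
    obtain k a b where k: "k \<in> Obj J" "a \<in> hom J k i" "b \<in> hom J k j"
      using cofilteredE_span[OF cofiltered_J ic(1) jd(1)] .
    obtain c' where c': "c' \<in> Obj (Shape (P k))" "p a c' = c" using p_surj[OF k(2) ic(2)] by blast
    obtain d' where d': "d' \<in> Obj (Shape (P k))" "p b d' = d" using p_surj[OF k(3) jd(2)] by blast
    obtain n x y where n: "n \<in> Obj (Shape (P k))" "x \<in> hom (Shape (P k)) n c'" "y \<in> hom (Shape (P k)) n d'"
      using cofilteredE_span[OF ProDet_Obj_small(3)[OF P_Obj[OF k(1)]] c'(1) d'(1)] .
    have "total_arr a n (q a x) \<in> hom total (incl k n) l" "total_arr b n (q b y) \<in> hom total (incl k n) l'"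
      using total_homI[OF k(2) n(1)] q_hom[OF k(2) n(2)] total_homI[OF k(3) n(1)] q_hom[OF k(3) n(3)]
        c'(2) d'(2) ic(3) jd(3) by auto
    then show "\<exists>n f g. f \<in> hom total n l \<and> g \<in> hom total n l'" by blast
  next
    fix l l' f g assume f: "f \<in> hom total l l'" and g: "g \<in> hom total l l'"
    obtain a i j c d x where 1: "a \<in> hom J i j" "c \<in> Obj (Shape (P i))"
      "x \<in> hom (Shape (P j)) (p a c) d" "f = total_arr a c x" "l = incl i c" "l' = incl j d"
      using f by (rule total_homE)
    note i = J.hom_Obj(1)[OF 1(1)] and j = J.hom_Obj(2)[OF 1(1)]
    obtain b j' d' y where bb: "b \<in> hom J i j'" "y \<in> hom (Shape (P j')) (p b c) d'"
      "g = total_arr b c y" "l' = incl j' d'"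
      using g unfolding 1(5) by (rule total_homE_incl[OF _ i])
    have "j' = j" "d' = d" using bb(4) 1(6) incl_inj[OF j J.hom_Obj(2)[OF bb(1)]] by auto
    then have 2: "b \<in> hom J i j" "y \<in> hom (Shape (P j)) (p b c) d" "g = total_arr b c y" using bb by auto
    obtain k z where z: "k \<in> Obj J" "z \<in> hom J k i" "a \<cdot>\<^bsub>J\<^esub> z = b \<cdot>\<^bsub>J\<^esub> z"
      using cofilteredE_equalize[OF cofiltered_J 1(1) 2(1)] .
    let ?w = "a \<cdot>\<^bsub>J\<^esub> z"
    have w: "?w \<in> hom J k j" by (rule J.Cmp_hom[OF z(2) 1(1)])
    obtain c' where c': "c' \<in> Obj (Shape (P k))" "p z c' = c" using p_surj[OF z(2) 1(2)] by blast
    have pw: "p a c = p ?w c'" "p b c = p ?w c'"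
      using p_Cmp_index[OF z(2) 1(1) c'(1)] p_Cmp_index[OF z(2) 2(1) c'(1)] c'(2) z(3) by auto
    obtain n v where v: "v \<in> hom (Shape (P j)) n (p ?w c')"
      "x \<cdot>\<^bsub>Shape (P j)\<^esub> v = y \<cdot>\<^bsub>Shape (P j)\<^esub> v"
      using cofilteredE_equalize[OF ProDet_Obj_small(3)[OF P_Obj[OF j]] 1(3)[unfolded pw(1)]
          2(2)[unfolded pw(2)]] by metis
    \<comment> \<open>lift the equalizing arrow v along the functor of the composite a z\<close>
    obtain n' v' where v': "v' \<in> hom (Shape (P k)) n' c'" "q ?w v' = v" using q_lift[OF w c'(1) v(1)] by blast
    have n': "n' \<in> Obj (Shape (P k))" using category.hom_Obj(1)[OF shape_category[OF z(1)] v'(1)] .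
    let ?h = "total_arr z n' (q z v')"
    have h: "?h \<in> hom total (incl k n') l"
      using total_homI[OF z(2) n'] q_hom[OF z(2) v'(1)] c'(2) 1(5) by simp
    have "f \<cdot>\<^bsub>total\<^esub> ?h = g \<cdot>\<^bsub>total\<^esub> ?h"
      unfolding 1(4) 2(3) total_Cmp[OF z(2) 1(1)] total_Cmp[OF z(2) 2(1)]
      using q_Cmp_index[OF z(2) 1(1) v'(1)] q_Cmp_index[OF z(2) 2(1) v'(1)] v'(2) v(2) z(3) by simp
    then show "\<exists>k. \<exists>h\<in>hom total k l. f \<cdot>\<^bsub>total\<^esub> h = g \<cdot>\<^bsub>total\<^esub> h" using h by blast
  qed
qed

lemma total_small: "Sm (Obj total)" "Sm (Arr total)"
proof -
  have un: "Sm (\<Union>u\<in>codeO ` Obj J. G (inv_into (Obj J) codeO u))"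
    if "\<And>j. j \<in> Obj J \<Longrightarrow> Sm (G j)" for G :: "'j \<Rightarrow> 'u set"
    by (rule Sm_UN[OF codeO_small]) (use that codeO_inj in auto)
  have mem: "x \<in> (\<Union>u\<in>codeO ` Obj J. G (inv_into (Obj J) codeO u))"
    if "j \<in> Obj J" "x \<in> G j" for j x and G :: "'j \<Rightarrow> 'u set"
    using that codeO_inj by (intro UN_I[of "codeO j"]) auto
  have O: "Sm (\<Union>u\<in>codeO ` Obj J. Obj (Shape (P (inv_into (Obj J) codeO u))))"
    by (rule un) (rule ProDet_Obj_small(1)[OF P_Obj])
  have A: "Sm (\<Union>u\<in>codeO ` Obj J. Arr (Shape (P (inv_into (Obj J) codeO u))))"
    by (rule un) (rule ProDet_Obj_small(2)[OF P_Obj])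
  show "Sm (Obj total)"
    by (rule Sm_subset[OF Sm_upairs[OF codeO_small O]])
      (use mem[where G = "\<lambda>j. Obj (Shape (P j))"] in \<open>auto simp: total_def incl_def\<close>)
  show "Sm (Arr total)"
  proof (rule Sm_subset[OF Sm_upairs[OF Sm_upairs[OF codeA_small O] A]], rule subsetI)
    fix f assume "f \<in> Arr total"
    then obtain a i j c d x where 1: "a \<in> hom J i j" "c \<in> Obj (Shape (P i))"
      "x \<in> hom (Shape (P j)) (p a c) d" "f = total_arr a c x" by (auto simp: total_def)
    have "codeA a \<in> codeA ` Arr J" using 1(1) by (simp add: homD)
    then show "f \<in> {upair y x | y x. y \<in> {upair a c | a c. a \<in> codeA ` Arr J \<and>
        c \<in> (\<Union>u\<in>codeO ` Obj J. Obj (Shape (P (inv_into (Obj J) codeO u))))} \<and>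
        x \<in> (\<Union>u\<in>codeO ` Obj J. Arr (Shape (P (inv_into (Obj J) codeO u))))}"
      using 1(4) mem[where G = "\<lambda>j. Obj (Shape (P j))", OF J.hom_Obj(1)[OF 1(1)] 1(2)]
        mem[where G = "\<lambda>j. Arr (Shape (P j))", OF J.hom_Obj(2)[OF 1(1)] homD(1)[OF 1(3)]]
      unfolding total_arr_def by blast
  qed
qed

lemma total_diagram_simps [simp]:
  "Shape total_diagram = total"
  "j \<in> Obj J \<Longrightarrow> onObj total_diagram (incl j c) = onObj (P j) c"
  by (simp_all add: total_diagram_def)

lemma onArr_total:
  "a \<in> hom J i j \<Longrightarrow> onArr total_diagram (total_arr a c x) = onArr (P j) x \<cdot> m a c"
  by (simp add: total_diagram_def homD)

text \<open>
  Preservation of composition moves a transition map past a level map, which is the naturality of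
  \<open>m\<close>.
\<close>

lemma total_diagram_Obj: "total_diagram \<in> Obj M"
proof (rule ProDet_ObjI)
  show "Sm (Obj (Shape total_diagram))" "Sm (Arr (Shape total_diagram))"
    "cofiltered (Shape total_diagram)"
    using total_small cofiltered_total by simp_all
next
  fix l assume "l \<in> Obj (Shape total_diagram)"
  then have "l \<in> Obj total" by simp
  then obtain j c where jc: "j \<in> Obj J" "c \<in> Obj (Shape (P j))" "l = incl j c" by (rule total_ObjE)
  note O = onObj_Obj[OF P_Obj[OF jc(1)] jc(2)]
  show "onObj total_diagram l \<in> Obj C" using O jc by simp
  show "onArr total_diagram (Idn (Shape total_diagram) l) = Idn C (onObj total_diagram l)"
    using jc total_Idn onArr_total[OF J.Idn_hom[OF jc(1)]] m_Idn[OF jc(1,2)]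
      onArr_Idn[OF P_Obj[OF jc(1)] jc(2)] Idn_left[OF Idn_hom[OF O]] by simp
next
  fix f l l' assume "f \<in> hom (Shape total_diagram) l l'"
  then have "f \<in> hom total l l'" by simp
  then obtain a i j c d x where 1: "a \<in> hom J i j" "c \<in> Obj (Shape (P i))"
    "x \<in> hom (Shape (P j)) (p a c) d" "f = total_arr a c x" "l = incl i c" "l' = incl j d"
    by (rule total_homE)
  note i = J.hom_Obj(1)[OF 1(1)] and j = J.hom_Obj(2)[OF 1(1)]
  note hm = m_hom[OF 1(1,2)] and hx = onArr_hom[OF P_Obj[OF j] 1(3)]
  show "onArr total_diagram f \<in> hom C (onObj total_diagram l) (onObj total_diagram l')"
    using Cmp_hom[OF hm hx] 1 i j onArr_total[OF 1(1)] by simp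
  show "deterministic C (onArr total_diagram f)"
    using deterministic_Cmp[OF m_det[OF 1(1,2)] hm onArr_det[OF P_Obj[OF j] 1(3)] hx]
      1(4) onArr_total[OF 1(1)] by simp
next
  fix f g l l' l''
  assume "f \<in> hom (Shape total_diagram) l l'" "g \<in> hom (Shape total_diagram) l' l''"
  then have f: "f \<in> hom total l l'" and g: "g \<in> hom total l' l''" by simp_all
  obtain a i j c d x where 1: "a \<in> hom J i j" "c \<in> Obj (Shape (P i))"
    "x \<in> hom (Shape (P j)) (p a c) d" "f = total_arr a c x" "l = incl i c" "l' = incl j d"
    using f by (rule total_homE)
  note j = J.hom_Obj(2)[OF 1(1)]
  obtain b k d' y where 2: "b \<in> hom J j k" "d \<in> Obj (Shape (P j))"
    "y \<in> hom (Shape (P k)) (p b d) d'" "g = total_arr b d y" "l'' = incl k d'"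
    using g unfolding 1(6) by (rule total_homE_incl[OF _ j])
  note k = J.hom_Obj(2)[OF 2(1)]
  note pc = p_Obj[OF 1(1,2)]
  note hx = onArr_hom[OF P_Obj[OF j] 1(3)] and hy = onArr_hom[OF P_Obj[OF k] 2(3)]
    and qx = q_hom[OF 2(1) 1(3)] and ma = m_hom[OF 1(1,2)]
  note hq = onArr_hom[OF P_Obj[OF k] qx] and mb = m_hom[OF 2(1) pc] and mbd = m_hom[OF 2(1,2)]
  have "onArr total_diagram (g \<cdot>\<^bsub>total\<^esub> f)
      = (onArr (P k) y \<cdot> onArr (P k) (q b x)) \<cdot> (m b (p a c) \<cdot> m a c)"
    unfolding 1(4) 2(4) total_Cmp[OF 1(1) 2(1)] onArr_total[OF J.Cmp_hom[OF 1(1) 2(1)]]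
      onArr_Cmp[OF P_Obj[OF k] qx 2(3)] m_Cmp_index[OF 1(1) 2(1) 1(2)] ..
  also have "\<dots> = onArr (P k) y \<cdot> ((onArr (P k) (q b x) \<cdot> m b (p a c)) \<cdot> m a c)"
    using Cmp_assoc[OF Cmp_hom[OF ma mb] hq hy] Cmp_assoc[OF ma mb hq] by simp
  also have "\<dots> = onArr (P k) y \<cdot> ((m b d \<cdot> onArr (P j) x) \<cdot> m a c)"
    using m_natural[OF 2(1) 1(3)] by simp
  also have "\<dots> = (onArr (P k) y \<cdot> m b d) \<cdot> (onArr (P j) x \<cdot> m a c)"
    using Cmp_assoc[OF ma hx mbd] Cmp_assoc[OF Cmp_hom[OF ma hx] mbd hy] by simp
  finally show "onArr total_diagram (g \<cdot>\<^bsub>Shape total_diagram\<^esub> f)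
      = onArr total_diagram g \<cdot> onArr total_diagram f"
    using onArr_total[OF 1(1)] onArr_total[OF 2(1)] 1(4) 2(4) by simp
qed

definition total_proj :: "'j \<Rightarrow> ('u, 'o, 'm) promor" where
  "total_proj j = mk_promor total_diagram (P j)
     (\<lambda>c. germ C total_diagram (incl j c) (Idn C (onObj (P j) c)))"

text \<open>
  The arrows of the total category are by construction those that \<open>level_limit\<close> asks for. The
  projections are compatible with the transition maps of \<open>P j\<close> because these are
  the actions of arrows of the total category that lie over the identity of \<open>j\<close>.
\<close>

theorem level_limit_total: "level_limit C Sm J P t p m total_diagram incl total_proj"
proof unfold_locales
  show "total_diagram \<in> Obj M" by (rule total_diagram_Obj)
next
  fix j assume j: "j \<in> Obj J"
  show "total_proj j \<in> hom M total_diagram (P j)"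
    unfolding total_proj_def
  proof (rule mk_promor_hom[OF total_diagram_Obj P_Obj[OF j]])
    fix c assume c: "c \<in> Obj (Shape (P j))"
    show "germ C total_diagram (incl j c) (Idn C (onObj (P j) c)) \<in> colim_hom C total_diagram (onObj (P j) c)"
      by (rule colim_homI) (use total_Obj[OF j c] Idn_hom[OF onObj_Obj[OF P_Obj[OF j] c]] j in simp_all)
  next
    fix c d x assume x: "x \<in> hom (Shape (P j)) c d"
    note O = shape_hom_Obj[OF P_Obj[OF j] x] and hx = onArr_hom[OF P_Obj[OF j] x]
    have id: "Idn C (onObj (P j) c) \<in> hom C (onObj total_diagram (incl j c)) (onObj (P j) c)"
      if "c \<in> Obj (Shape (P j))" for c
      using Idn_hom[OF onObj_Obj[OF P_Obj[OF j] that]] j by simp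
    have x': "total_arr (Idn J j) c x \<in> hom (Shape total_diagram) (incl j c) (incl j d)"
      using total_homI[OF J.Idn_hom[OF j] O(1)] x p_Idn[OF j O(1)] by simp
    have "onArr total_diagram (total_arr (Idn J j) c x) = onArr (P j) x"
      using onArr_total[OF J.Idn_hom[OF j]] m_Idn[OF j O(1)] Idn_right[OF hx] by simp
    then show "germ_push C total_diagram (onArr (P j) x) (germ C total_diagram (incl j c) (Idn C (onObj (P j) c)))
        = germ C total_diagram (incl j d) (Idn C (onObj (P j) d))"
      using germ_push_germ[OF total_diagram_Obj _ id[OF O(1)] hx] total_Obj[OF j O(1)]
        germ_restrict[OF total_diagram_Obj x' id[OF O(2)]] Idn_left[OF hx] Idn_right[OF hx] by simp
  qed
next
  fix j c assume j: "j \<in> Obj J" and c: "c \<in> Obj (Shape (P j))"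
  show "incl j c \<in> Obj (Shape total_diagram)" using total_Obj[OF j c] by simp
  show "onObj total_diagram (incl j c) = onObj (P j) c" using j by simp
  show "Comps (total_proj j) c = germ C total_diagram (incl j c) (Idn C (onObj (P j) c))"
    using c by (simp add: total_proj_def)
next
  fix l assume "l \<in> Obj (Shape total_diagram)"
  then have "l \<in> Obj total" by simp
  then show "\<exists>j\<in>Obj J. \<exists>c\<in>Obj (Shape (P j)). l = incl j c" by (rule total_ObjE) blast
next
  fix i c j d assume ij: "i \<in> Obj J" "j \<in> Obj J"
  show "i = j \<and> c = d" if "incl i c = incl j d" using that incl_inj[OF ij] by simp
  fix l assume "l \<in> hom (Shape total_diagram) (incl i c) (incl j d)"
  then have "l \<in> hom total (incl i c) (incl j d)" by simp
  then obtain a j' d' x where 1: "a \<in> hom J i j'" "c \<in> Obj (Shape (P i))" "x \<in> hom (Shape (P j')) (p a c) d'"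
    "l = total_arr a c x" "incl j d = incl j' d'" by (rule total_homE_incl[OF _ ij(1)])
  have "j' = j" "d' = d" using 1(5) incl_inj[OF ij(2) J.hom_Obj(2)[OF 1(1)]] by auto
  then show "\<exists>a\<in>hom J i j. \<exists>b\<in>hom (Shape (P j)) (p a c) d. onArr total_diagram l = onArr (P j) b \<cdot> m a c"
    using 1 onArr_total[OF 1(1)] by blast
next
  fix a i j c b d assume 1: "a \<in> hom J i j" "c \<in> Obj (Shape (P i))" "b \<in> hom (Shape (P j)) (p a c) d"
  show "\<exists>l\<in>hom (Shape total_diagram) (incl i c) (incl j d). onArr total_diagram l = onArr (P j) b \<cdot> m a c"
    using total_homI[OF 1] onArr_total[OF 1(1)] by (intro bexI[of _ "total_arr a c b"]) simp_all
qed

end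

section \<open>Finite tensor products and marginalization levelwise\<close>

text \<open>
  An index of a finite tensor product is an iterated pair. The following function forgets the
  coordinates outside \<open>F\<close>; the same formula acts on the indices and on the arrows between them.
\<close>

primrec sub_index :: "'i set \<Rightarrow> 'i list \<Rightarrow> 'u \<Rightarrow> 'u" where
  "sub_index F [] c = c"
| "sub_index F (i # is) c =
     (if i \<in> F then upair (ufst c) (sub_index F is (usnd c)) else sub_index F is (usnd c))"

context pro_markov
begin

text \<open>
  The marginalization map of the objects of \<open>\<C>\<close> found at an index. It imitates the recursion of
  \<open>marg_list\<close>, so that the two can be compared by induction along the list.
\<close>

primrec sub_map :: "('i \<Rightarrow> ('u, 'o, 'm) diagram) \<Rightarrow> 'i set \<Rightarrow> 'i list \<Rightarrow> 'u \<Rightarrow> 'm" where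
  "sub_map X F [] c = Idn C (unt C)"
| "sub_map X F (i # is) c =
     (if i \<in> F then Idn C (onObj (X i) (ufst c)) \<odot> sub_map X F is (usnd c)
      else lunit C (onObj (ten_list M X (filter (\<lambda>j. j \<in> F) is)) (sub_index F is (usnd c))) \<cdot>
        (del C (onObj (X i) (ufst c)) \<odot> sub_map X F is (usnd c)))"

lemma ten_list_Obj: "(\<And>i. i \<in> set is \<Longrightarrow> X i \<in> Obj M) \<Longrightarrow> ten_list M X is \<in> Obj M"
  by (induction "is") (simp_all add: pro_unt_Obj pro_tenO_Obj)

lemma ten_list_filter_Obj:
  "(\<And>i. i \<in> set is \<Longrightarrow> X i \<in> Obj M) \<Longrightarrow> ten_list M X (filter Q is) \<in> Obj M"
  by (rule ten_list_Obj) auto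

lemma ten_list_Cons_homE:
  assumes "x \<in> hom (Shape (ten_list M X (i # is))) c d"
  obtains a b k l k' l' where "c = upair k l" "d = upair k' l'" "x = upair a b"
    "a \<in> hom (Shape (X i)) k k'" "b \<in> hom (Shape (ten_list M X is)) l l'"
  using assms by (auto elim: prod_cat_hom_cases)

lemma ten_list_Cons_ObjE:
  assumes "c \<in> Obj (Shape (ten_list M X (i # is)))"
  obtains k l where "c = upair k l" "k \<in> Obj (Shape (X i))" "l \<in> Obj (Shape (ten_list M X is))"
  using assms by (auto elim: prod_cat_ObjE)

lemma sub_index_Obj:
  "c \<in> Obj (Shape (ten_list M X is)) \<Longrightarrow>
    sub_index F is c \<in> Obj (Shape (ten_list M X (filter (\<lambda>j. j \<in> F) is)))"
  by (induction "is" arbitrary: c) (auto elim!: prod_cat_ObjE simp: prod_cat_simps)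

lemma sub_index_hom:
  assumes "x \<in> hom (Shape (ten_list M X is)) c d"
  shows "sub_index F is x \<in> hom (Shape (ten_list M X (filter (\<lambda>j. j \<in> F) is)))
    (sub_index F is c) (sub_index F is d)"
  using assms
proof (induction "is" arbitrary: x c d)
  case Nil
  then show ?case by simp
next
  case (Cons i "is")
  obtain a b k l k' l' where 1: "c = upair k l" "d = upair k' l'" "x = upair a b"
    "a \<in> hom (Shape (X i)) k k'" "b \<in> hom (Shape (ten_list M X is)) l l'"
    by (rule ten_list_Cons_homE[OF Cons.prems])
  have "sub_index F is b \<in> hom (Shape (ten_list M X (filter (\<lambda>j. j \<in> F) is)))
    (sub_index F is l) (sub_index F is l')" by (rule Cons.IH[OF 1(5)])
  then show ?case using 1(1-3) prod_cat_homI[OF 1(4)] by simp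
qed

lemma sub_index_Idn:
  assumes "c \<in> Obj (Shape (ten_list M X is))"
  shows "sub_index F is (Idn (Shape (ten_list M X is)) c)
    = Idn (Shape (ten_list M X (filter (\<lambda>j. j \<in> F) is))) (sub_index F is c)"
  using assms
  by (induction "is" arbitrary: c) (auto elim!: prod_cat_ObjE simp: prod_cat_simps)

lemma sub_index_Cmp:
  assumes "x \<in> hom (Shape (ten_list M X is)) c d" "y \<in> hom (Shape (ten_list M X is)) d d'"
  shows "sub_index F is (y \<cdot>\<^bsub>Shape (ten_list M X is)\<^esub> x)
    = sub_index F is y \<cdot>\<^bsub>Shape (ten_list M X (filter (\<lambda>j. j \<in> F) is))\<^esub> sub_index F is x"
  using assms
proof (induction "is" arbitrary: x y c d d')
  case Nil
  then show ?case by simp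
next
  case (Cons i "is")
  obtain a b k l k' l' where 1: "c = upair k l" "d = upair k' l'" "x = upair a b"
    "a \<in> hom (Shape (X i)) k k'" "b \<in> hom (Shape (ten_list M X is)) l l'"
    by (rule ten_list_Cons_homE[OF Cons.prems(1)])
  obtain a' b' n n' k'' l'' where 2: "d = upair n n'" "d' = upair k'' l''" "y = upair a' b'"
    "a' \<in> hom (Shape (X i)) n k''" "b' \<in> hom (Shape (ten_list M X is)) n' l''"
    by (rule ten_list_Cons_homE[OF Cons.prems(2)])
  have "n' = l'" using 1(2) 2(1) by simp
  then show ?case using Cons.IH[OF 1(5)] 2(5) 1(3) 2(3) by (simp add: prod_cat_simps)
qed

lemma sub_index_superset_Obj:
  "c \<in> Obj (Shape (ten_list M X is)) \<Longrightarrow> set is \<subseteq> F \<Longrightarrow> sub_index F is c = c"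
  by (induction "is" arbitrary: c) (auto elim!: prod_cat_ObjE)

lemma sub_index_superset_hom:
  assumes "x \<in> hom (Shape (ten_list M X is)) c d" "set is \<subseteq> F"
  shows "sub_index F is x = x"
  using assms
proof (induction "is" arbitrary: x c d)
  case Nil
  then show ?case by simp
next
  case (Cons i "is")
  obtain a b k l k' l' where "c = upair k l" "d = upair k' l'" "x = upair a b"
    "a \<in> hom (Shape (X i)) k k'" "b \<in> hom (Shape (ten_list M X is)) l l'"
    by (rule ten_list_Cons_homE[OF Cons.prems(1)])
  then show ?case using Cons.IH[of b l l'] Cons.prems(2) by simp
qed

lemma sub_index_sub_index:
  "G \<subseteq> F \<Longrightarrow> sub_index G (filter (\<lambda>j. j \<in> F) is) (sub_index F is c) = sub_index G is c"
  for c :: 'u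
  by (induction "is" arbitrary: c) auto

text \<open>
  The forgotten coordinates may be filled in arbitrarily, since index categories are nonempty.
\<close>

lemma sub_index_surj:
  assumes "\<And>i. i \<in> set is \<Longrightarrow> X i \<in> Obj M"
    and "d \<in> Obj (Shape (ten_list M X (filter (\<lambda>j. j \<in> F) is)))"
  shows "\<exists>c\<in>Obj (Shape (ten_list M X is)). sub_index F is c = d"
  using assms
proof (induction "is" arbitrary: d)
  case Nil
  then show ?case by simp
next
  case (Cons i "is")
  show ?case
  proof (cases "i \<in> F")
    case True
    obtain k l where d: "d = upair k l" "k \<in> Obj (Shape (X i))"
      "l \<in> Obj (Shape (ten_list M X (filter (\<lambda>j. j \<in> F) is)))"
      using Cons.prems(2) True by (auto elim: prod_cat_ObjE)
    obtain c where "c \<in> Obj (Shape (ten_list M X is))" "sub_index F is c = l"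
      using Cons.IH[OF _ d(3)] Cons.prems(1) by auto
    then show ?thesis
      using d(1,2) True by (intro bexI[of _ "upair k c"]) (simp_all add: prod_cat_simps)
  next
    case False
    obtain k where k: "k \<in> Obj (Shape (X i))"
      using ProDet_Obj_small(3)[OF Cons.prems(1)[of i]] by (auto simp: cofiltered_def)
    obtain c where "c \<in> Obj (Shape (ten_list M X is))" "sub_index F is c = d"
      using Cons.IH[of d] Cons.prems False by auto
    then show ?thesis
      using k False by (intro bexI[of _ "upair k c"]) (simp_all add: prod_cat_simps)
  qed
qed

text \<open>
  An arrow between the remaining coordinates is extended by identities in the forgotten ones.
\<close>

lemma sub_index_lift:
  assumes "\<And>i. i \<in> set is \<Longrightarrow> X i \<in> Obj M" "c \<in> Obj (Shape (ten_list M X is))"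
    and "y \<in> hom (Shape (ten_list M X (filter (\<lambda>j. j \<in> F) is))) d (sub_index F is c)"
  shows "\<exists>c'. \<exists>x\<in>hom (Shape (ten_list M X is)) c' c. sub_index F is x = y"
  using assms
proof (induction "is" arbitrary: c y d)
  case Nil
  then show ?case by simp
next
  case (Cons i "is")
  obtain k l where c: "c = upair k l" "k \<in> Obj (Shape (X i))" "l \<in> Obj (Shape (ten_list M X is))"
    using Cons.prems(2) by (rule ten_list_Cons_ObjE)
  have Xi: "X i \<in> Obj M" using Cons.prems(1) by simp
  show ?case
  proof (cases "i \<in> F")
    case True
    have y': "y \<in> hom (Shape (ten_list M X (i # filter (\<lambda>j. j \<in> F) is))) d (upair k (sub_index F is l))"
      using Cons.prems(3) True c(1) by simp
    obtain a b n n' k' l' where 1: "d = upair n n'" "upair k (sub_index F is l) = upair k' l'" "y = upair a b"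
      "a \<in> hom (Shape (X i)) n k'"
      "b \<in> hom (Shape (ten_list M X (filter (\<lambda>j. j \<in> F) is))) n' l'"
      by (rule ten_list_Cons_homE[OF y'])
    then have y: "y = upair a b" "a \<in> hom (Shape (X i)) n k"
      "b \<in> hom (Shape (ten_list M X (filter (\<lambda>j. j \<in> F) is))) n' (sub_index F is l)"
      by simp_all
    obtain c' x where "x \<in> hom (Shape (ten_list M X is)) c' l" "sub_index F is x = b"
      using Cons.IH[OF _ c(3) y(3)] Cons.prems(1) by auto
    then show ?thesis
      using prod_cat_homI[OF y(2)] y(1) c(1) True
      by (intro exI[of _ "upair n c'"] bexI[of _ "upair a x"]) simp_all
  next
    case False
    have "y \<in> hom (Shape (ten_list M X (filter (\<lambda>j. j \<in> F) is))) d (sub_index F is l)"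
      using Cons.prems(3) False c(1) by simp
    from Cons.IH[OF _ c(3) this] Cons.prems(1)
    obtain c' x where "x \<in> hom (Shape (ten_list M X is)) c' l" "sub_index F is x = y" by auto
    then show ?thesis
      using prod_cat_homI[OF category.Idn_hom[OF ProDet_Obj_small(4)[OF Xi] c(2)]] c(1) False
      by (intro exI[of _ "upair k c'"] bexI[of _ "upair (Idn (Shape (X i)) k) x"]) simp_all
  qed
qed

lemma sub_map_hom:
  assumes "\<And>i. i \<in> set is \<Longrightarrow> X i \<in> Obj M" "c \<in> Obj (Shape (ten_list M X is))"
  shows "sub_map X F is c \<in> hom C (onObj (ten_list M X is) c)
    (onObj (ten_list M X (filter (\<lambda>j. j \<in> F) is)) (sub_index F is c))"
  using assms
proof (induction "is" arbitrary: c)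
  case Nil
  then show ?case using Idn_hom[OF unt_Obj] by simp
next
  case (Cons i "is")
  obtain k l where c: "c = upair k l" "k \<in> Obj (Shape (X i))" "l \<in> Obj (Shape (ten_list M X is))"
    using Cons.prems(2) by (rule ten_list_Cons_ObjE)
  have Ok: "onObj (X i) k \<in> Obj C" using onObj_Obj[OF Cons.prems(1)[of i] c(2)] by simp
  have IH: "sub_map X F is l \<in> hom C (onObj (ten_list M X is) l)
    (onObj (ten_list M X (filter (\<lambda>j. j \<in> F) is)) (sub_index F is l))"
    using Cons.IH[OF _ c(3)] Cons.prems(1) by simp
  show ?case
    using tenA_hom[OF Idn_hom[OF Ok] IH]
      Cmp_hom[OF tenA_hom[OF del_hom[OF Ok] IH] lunit_hom[OF hom_Obj(2)[OF IH]]] c(1) by simp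
qed

lemma sub_map_det:
  assumes "\<And>i. i \<in> set is \<Longrightarrow> X i \<in> Obj M" "c \<in> Obj (Shape (ten_list M X is))"
  shows "deterministic C (sub_map X F is c)"
  using assms
proof (induction "is" arbitrary: c)
  case Nil
  then show ?case using deterministic_Idn[OF unt_Obj] by simp
next
  case (Cons i "is")
  obtain k l where c: "c = upair k l" "k \<in> Obj (Shape (X i))" "l \<in> Obj (Shape (ten_list M X is))"
    using Cons.prems(2) by (rule ten_list_Cons_ObjE)
  have Ok: "onObj (X i) k \<in> Obj C" using onObj_Obj[OF Cons.prems(1)[of i] c(2)] by simp
  have h: "sub_map X F is l \<in> hom C (onObj (ten_list M X is) l)
    (onObj (ten_list M X (filter (\<lambda>j. j \<in> F) is)) (sub_index F is l))"
    by (rule sub_map_hom[OF _ c(3)]) (use Cons.prems(1) in simp)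
  have IH: "deterministic C (sub_map X F is l)"
    using Cons.IH[OF _ c(3)] Cons.prems(1) by simp
  note d = tenA_hom[OF del_hom[OF Ok] h] and O = hom_Obj(2)[OF h]
  show ?case
    using deterministic_tenA[OF deterministic_Idn[OF Ok] Idn_hom[OF Ok] IH h] c(1)
      deterministic_Cmp[OF deterministic_tenA[OF deterministic_del[OF Ok] del_hom[OF Ok] IH h] d
        deterministic_lunit[OF O] lunit_hom[OF O]] by simp
qed

lemma sub_map_superset:
  assumes "\<And>i. i \<in> set is \<Longrightarrow> X i \<in> Obj M" "c \<in> Obj (Shape (ten_list M X is))" "set is \<subseteq> F"
  shows "sub_map X F is c = Idn C (onObj (ten_list M X is) c)"
  using assms
proof (induction "is" arbitrary: c)
  case Nil
  then show ?case by simp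
next
  case (Cons i "is")
  obtain k l where c: "c = upair k l" "k \<in> Obj (Shape (X i))" "l \<in> Obj (Shape (ten_list M X is))"
    using Cons.prems(2) by (rule ten_list_Cons_ObjE)
  have "onObj (X i) k \<in> Obj C" "onObj (ten_list M X is) l \<in> Obj C"
    using onObj_Obj[OF Cons.prems(1)[of i] c(2)] onObj_Obj[OF ten_list_Obj c(3)] Cons.prems(1) by auto
  then show ?case
    using Cons.IH[OF _ c(3)] Cons.prems(1,3) c(1) tenA_Idn by simp
qed

text \<open>
  Discarding the first factor commutes with operations on the second one.
\<close>

lemma lunit_del_natural:
  assumes X: "X \<in> Obj C" and g: "g \<in> hom C Y Y'" and h: "h \<in> hom C Y' Z"
  shows "h \<cdot> (lunit C Y' \<cdot> (del C X \<odot> g)) = lunit C Z \<cdot> (del C X \<odot> (h \<cdot> g))"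
proof -
  have d: "del C X \<in> hom C X (unt C)" by (rule del_hom[OF X])
  have iu: "Idn C (unt C) \<in> hom C (unt C) (unt C)" using Idn_hom[OF unt_Obj] .
  have "h \<cdot> (lunit C Y' \<cdot> (del C X \<odot> g)) = (lunit C Z \<cdot> (Idn C (unt C) \<odot> h)) \<cdot> (del C X \<odot> g)"
    using Cmp_assoc[OF tenA_hom[OF d g] lunit_hom[OF hom_Obj(1)[OF h]] h] lunit_natural[OF h] by simp
  also have "\<dots> = lunit C Z \<cdot> ((Idn C (unt C) \<odot> h) \<cdot> (del C X \<odot> g))"
    by (rule Cmp_assoc[OF tenA_hom[OF d g] tenA_hom[OF iu h] lunit_hom[OF hom_Obj(2)[OF h]]])
  also have "(Idn C (unt C) \<odot> h) \<cdot> (del C X \<odot> g) = del C X \<odot> (h \<cdot> g)"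
    using tenA_Cmp[OF d iu g h] Idn_left[OF d] by simp
  finally show ?thesis .
qed

lemma sub_map_natural:
  assumes "\<And>i. i \<in> set is \<Longrightarrow> X i \<in> Obj M" "x \<in> hom (Shape (ten_list M X is)) c d"
  shows "sub_map X F is d \<cdot> onArr (ten_list M X is) x
    = onArr (ten_list M X (filter (\<lambda>j. j \<in> F) is)) (sub_index F is x) \<cdot> sub_map X F is c"
  using assms
proof (induction "is" arbitrary: x c d)
  case Nil
  then show ?case by simp
next
  case (Cons i "is")
  obtain a b k l k' l' where 1: "c = upair k l" "d = upair k' l'" "x = upair a b"
    "a \<in> hom (Shape (X i)) k k'" "b \<in> hom (Shape (ten_list M X is)) l l'"
    by (rule ten_list_Cons_homE[OF Cons.prems(2)])
  let ?T = "ten_list M X is" and ?T' = "ten_list M X (filter (\<lambda>j. j \<in> F) is)"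
  have Xi: "X i \<in> Obj M" and Xs: "\<And>j. j \<in> set is \<Longrightarrow> X j \<in> Obj M" using Cons.prems(1) by auto
  have T: "?T \<in> Obj M" "?T' \<in> Obj M" using ten_list_Obj Xs ten_list_filter_Obj by blast+
  note ha = onArr_hom[OF Xi 1(4)] and hb = onArr_hom[OF T(1) 1(5)]
    and hs = onArr_hom[OF T(2) sub_index_hom[OF 1(5)]]
    and ml = sub_map_hom[OF Xs shape_hom_Obj(1)[OF T(1) 1(5)]]
    and ml' = sub_map_hom[OF Xs shape_hom_Obj(2)[OF T(1) 1(5)]]
  note ka = hom_Obj[OF ha]
  have IH: "sub_map X F is l' \<cdot> onArr ?T b = onArr ?T' (sub_index F is b) \<cdot> sub_map X F is l"
    using Cons.IH[OF Xs 1(5)] .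
  show ?case
  proof (cases "i \<in> F")
    case True
    then show ?thesis
      using square_tenA[OF Idn_hom[OF ka(1)] Idn_hom[OF ka(2)] ha ha ml ml' hb hs square_Idn[OF ha] IH]
        1(1-3) by simp
  next
    case False
    note dk = del_hom[OF ka(1)] and dk' = del_hom[OF ka(2)]
    have "(lunit C (onObj ?T' (sub_index F is l')) \<cdot> (del C (onObj (X i) k') \<odot> sub_map X F is l')) \<cdot>
        (onArr (X i) a \<odot> onArr ?T b)
      = lunit C (onObj ?T' (sub_index F is l')) \<cdot>
        ((del C (onObj (X i) k') \<cdot> onArr (X i) a) \<odot> (sub_map X F is l' \<cdot> onArr ?T b))"
      using Cmp_assoc[OF tenA_hom[OF ha hb] tenA_hom[OF dk' ml'] lunit_hom[OF hom_Obj(2)[OF ml']]]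
        tenA_Cmp[OF ha dk' hb ml'] by simp
    also have "\<dots> = onArr ?T' (sub_index F is b) \<cdot>
        (lunit C (onObj ?T' (sub_index F is l)) \<cdot> (del C (onObj (X i) k) \<odot> sub_map X F is l))"
      using lunit_del_natural[OF ka(1) ml hs] IH del_natural[OF ha] by simp
    finally show ?thesis using 1(1-3) False by simp
  qed
qed

lemma sub_map_sub_map:
  assumes "\<And>i. i \<in> set is \<Longrightarrow> X i \<in> Obj M" "c \<in> Obj (Shape (ten_list M X is))" and G: "G \<subseteq> F"
  shows "sub_map X G (filter (\<lambda>j. j \<in> F) is) (sub_index F is c) \<cdot> sub_map X F is c = sub_map X G is c"
  using assms(1,2)
proof (induction "is" arbitrary: c)
  case Nil
  then show ?case using Idn_left[OF Idn_hom[OF unt_Obj]] by simp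
next
  case (Cons i "is")
  obtain k l where c: "c = upair k l" "k \<in> Obj (Shape (X i))" "l \<in> Obj (Shape (ten_list M X is))"
    using Cons.prems(2) by (rule ten_list_Cons_ObjE)
  have Xs: "\<And>j. j \<in> set is \<Longrightarrow> X j \<in> Obj M" using Cons.prems(1) by auto
  have XFs: "\<And>j. j \<in> set (filter (\<lambda>j. j \<in> F) is) \<Longrightarrow> X j \<in> Obj M" using Xs by auto
  have Ok: "onObj (X i) k \<in> Obj C" using onObj_Obj[OF Cons.prems(1)[of i] c(2)] by simp
  note idk = Idn_hom[OF Ok] and dk = del_hom[OF Ok]
  have ff: "filter (\<lambda>j. j \<in> G) (filter (\<lambda>j. j \<in> F) is) = filter (\<lambda>j. j \<in> G) is"
    using G by (auto intro: filter_cong)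
  note mF = sub_map_hom[OF Xs c(3), of F]
  have mG: "sub_map X G (filter (\<lambda>j. j \<in> F) is) (sub_index F is l)
      \<in> hom C (onObj (ten_list M X (filter (\<lambda>j. j \<in> F) is)) (sub_index F is l))
          (onObj (ten_list M X (filter (\<lambda>j. j \<in> G) is)) (sub_index G is l))"
    using sub_map_hom[OF XFs sub_index_Obj[OF c(3), of F], where F = G] sub_index_sub_index[OF G] ff by simp
  have IH: "sub_map X G (filter (\<lambda>j. j \<in> F) is) (sub_index F is l) \<cdot> sub_map X F is l = sub_map X G is l"
    by (rule Cons.IH[OF Xs c(3)])
  consider "i \<in> G" "i \<in> F" | "i \<notin> G" "i \<in> F" | "i \<notin> G" "i \<notin> F" using G by blast
  then show ?case
  proof cases
    case 1
    then show ?thesis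
      using tenA_Cmp[OF idk idk mF mG] Idn_left[OF idk] IH c(1) by simp
  next
    case 2
    note O = hom_Obj(2)[OF mG]
    have "(lunit C (onObj (ten_list M X (filter (\<lambda>j. j \<in> G) is)) (sub_index G is l)) \<cdot>
        (del C (onObj (X i) k) \<odot> sub_map X G (filter (\<lambda>j. j \<in> F) is) (sub_index F is l))) \<cdot>
        (Idn C (onObj (X i) k) \<odot> sub_map X F is l)
      = lunit C (onObj (ten_list M X (filter (\<lambda>j. j \<in> G) is)) (sub_index G is l)) \<cdot>
        (del C (onObj (X i) k) \<odot> sub_map X G is l)"
      using Cmp_assoc[OF tenA_hom[OF idk mF] tenA_hom[OF dk mG] lunit_hom[OF O]]
        tenA_Cmp[OF idk dk mF mG] Idn_right[OF dk] IH by simp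
    then show ?thesis using 2 c(1) sub_index_sub_index[OF G] ff by simp
  next
    case 3
    then show ?thesis using lunit_del_natural[OF Ok mF mG] IH c(1) by simp
  qed
qed

text \<open>
  Every constituent of the marginalization map (identities, discarding, left unitors, their tensor
  products and composites) has an explicit representative at each index, and these representatives
  combine by the same recursion. Being a morphism is proved along with this, since
  components of composites are computed only for morphisms.
\<close>

lemma marg_list_level:
  assumes "\<And>i. i \<in> set is \<Longrightarrow> X i \<in> Obj M"
  shows "marg_list M X F is \<in> hom M (ten_list M X is) (ten_list M X (filter (\<lambda>j. j \<in> F) is)) \<and>
    (\<forall>c\<in>Obj (Shape (ten_list M X is)). Comps (marg_list M X F is) (sub_index F is c)
      = germ C (ten_list M X is) c (sub_map X F is c))"
  using assms
proof (induction "is")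
  case Nil
  then show ?case using pro_id_hom[OF pro_unt_Obj] by (simp add: Comps_pro_id)
next
  case (Cons i "is")
  let ?T = "ten_list M X is" and ?T' = "ten_list M X (filter (\<lambda>j. j \<in> F) is)" and ?g = "marg_list M X F is"
  have Xi: "X i \<in> Obj M" and Xs: "\<And>j. j \<in> set is \<Longrightarrow> X j \<in> Obj M" using Cons.prems by auto
  have T: "?T \<in> Obj M" "?T' \<in> Obj M" using ten_list_Obj Xs ten_list_filter_Obj by blast+
  have g: "?g \<in> hom M ?T ?T'"
    and gc: "\<And>c. c \<in> Obj (Shape ?T) \<Longrightarrow> Comps ?g (sub_index F is c) = germ C ?T c (sub_map X F is c)"
    using Cons.IH[OF Xs] by auto
  have gs: "Src ?g = ?T" "Tgt ?g = ?T'" using g by (simp_all add: hom_ProDet)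
  have ml: "sub_map X F is c \<in> hom C (onObj ?T c) (onObj ?T' (sub_index F is c))"
    if "c \<in> Obj (Shape ?T)" for c
    by (rule sub_map_hom[OF Xs that])
  show ?case
  proof (cases "i \<in> F")
    case True
    have "pro_tenA C (pro_id C (X i)) ?g \<in> hom M (pro_tenO C (X i) ?T) (pro_tenO C (X i) ?T')"
      by (rule pro_tenA_hom[OF pro_id_hom[OF Xi] g])
    moreover have "Comps (pro_tenA C (pro_id C (X i)) ?g) (upair k (sub_index F is l))
        = germ C (pro_tenO C (X i) ?T) (upair k l) (Idn C (onObj (X i) k) \<odot> sub_map X F is l)"
      if kl: "k \<in> Obj (Shape (X i))" "l \<in> Obj (Shape ?T)" for k l
      by (rule Comps_pro_tenA[OF Xi T(1) _ gs(1) _ _ Comps_pro_id[OF kl(1)] kl(1)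
            Idn_hom[OF onObj_Obj[OF Xi kl(1)]] gc[OF kl(2)] kl(2) ml[OF kl(2)]])
        (use kl gs sub_index_Obj[OF kl(2)] in \<open>simp_all add: pro_id_def\<close>)
    ultimately show ?thesis
      using True by (auto elim!: prod_cat_ObjE)
  next
    case False
    let ?d = "pro_tenA C (pro_del C (X i)) ?g"
    have d: "?d \<in> hom M (pro_tenO C (X i) ?T) (pro_tenO C (pro_unt C) ?T')"
      by (rule pro_tenA_hom[OF pro_del_hom[OF Xi] g])
    have "pro_comp C (pro_lunit C ?T') ?d \<in> hom M (pro_tenO C (X i) ?T) ?T'"
      by (rule pro_comp_hom[OF d pro_lunit_hom[OF T(2)]])
    moreover have "Comps (pro_comp C (pro_lunit C ?T') ?d) (sub_index F is l)
        = germ C (pro_tenO C (X i) ?T) (upair k l)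
            (lunit C (onObj ?T' (sub_index F is l)) \<cdot> (del C (onObj (X i) k) \<odot> sub_map X F is l))"
      if kl: "k \<in> Obj (Shape (X i))" "l \<in> Obj (Shape ?T)" for k l
    proof -
      note Ok = onObj_Obj[OF Xi kl(1)] and s = sub_index_Obj[OF kl(2), of F]
      have "Comps ?d (upair undefined (sub_index F is l))
          = germ C (pro_tenO C (X i) ?T) (upair k l) (del C (onObj (X i) k) \<odot> sub_map X F is l)"
        by (rule Comps_pro_tenA[OF Xi T(1) _ gs(1) _ _ Comps_pro_del[OF Xi kl(1)] kl(1)
              del_hom[OF Ok] gc[OF kl(2)] kl(2) ml[OF kl(2)]])
          (use kl gs s in \<open>simp_all add: pro_del_def\<close>)
      then show ?thesis
        using Comps_pro_comp_germ[OF d, of "sub_index F is l" "pro_lunit C ?T'"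
            "upair undefined (sub_index F is l)" "lunit C (onObj ?T' (sub_index F is l))"
            "onObj ?T' (sub_index F is l)" "upair k l" "del C (onObj (X i) k) \<odot> sub_map X F is l"]
          s kl lunit_hom[OF onObj_Obj[OF T(2) s]] tenA_hom[OF del_hom[OF Ok] ml[OF kl(2)]]
        by (simp add: prod_cat_simps)
    qed
    ultimately show ?thesis
      using False by (auto elim!: prod_cat_ObjE)
  qed
qed

end

section \<open>Kolmogorov products\<close>

text \<open>
  A new element is inserted between the elements below it and the remaining ones, which lie above it
  by totality.
\<close>

lemma ex_sorted_list:
  assumes r: "linear_order_on I r" and F: "finite F" "F \<subseteq> I"
  shows "\<exists>xs. set xs = F \<and> distinct xs \<and> sorted_wrt (\<lambda>i j. (i, j) \<in> r) xs"
  using F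
proof (induction F rule: finite_induct)
  case empty
  then show ?case by simp
next
  case (insert x F)
  obtain xs where xs: "set xs = F" "distinct xs" "sorted_wrt (\<lambda>i j. (i, j) \<in> r) xs"
    using insert by auto
  have tr: "trans r" and tot: "total_on I r"
    using r by (auto simp: linear_order_on_def partial_order_on_def preorder_on_def)
  let ?A = "filter (\<lambda>y. (y, x) \<in> r) xs" and ?B = "filter (\<lambda>y. (y, x) \<notin> r) xs"
  have above: "(x, y) \<in> r" if "y \<in> set ?B" for y
  proof -
    have "y \<in> F" "(y, x) \<notin> r" using that xs(1) by auto
    moreover have "y \<noteq> x" "y \<in> I" "x \<in> I" using insert.hyps insert.prems \<open>y \<in> F\<close> by auto
    ultimately show ?thesis using tot unfolding total_on_def by blast
  qed
  have "sorted_wrt (\<lambda>i j. (i, j) \<in> r) (?A @ x # ?B)"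
    unfolding sorted_wrt_append sorted_wrt.simps
  proof (intro conjI ballI)
    show "sorted_wrt (\<lambda>i j. (i, j) \<in> r) ?A" "sorted_wrt (\<lambda>i j. (i, j) \<in> r) ?B"
      using xs(3) by (rule sorted_wrt_filter)+
  next
    fix y assume "y \<in> set ?B" then show "(x, y) \<in> r" by (rule above)
  next
    fix y z assume y: "y \<in> set ?A" and z: "z \<in> set (x # ?B)"
    have yx: "(y, x) \<in> r" using y by simp
    show "(y, z) \<in> r"
    proof (cases "z = x")
      case False
      then have "z \<in> set ?B" using z by simp
      from transD[OF tr yx above[OF this]] show ?thesis .
    qed (use yx in simp)
  qed
  moreover have "set (?A @ x # ?B) = insert x F" using xs(1) by auto
  moreover have "distinct (?A @ x # ?B)" using xs(1,2) insert.hyps by auto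
  ultimately show ?case by blast
qed

lemma sorted_list_unique:
  assumes "antisym r" "set xs = set ys" "distinct xs" "distinct ys"
    and "sorted_wrt (\<lambda>i j. (i, j) \<in> r) xs" "sorted_wrt (\<lambda>i j. (i, j) \<in> r) ys"
  shows "xs = ys"
  using assms(2-)
proof (induction xs arbitrary: ys)
  case Nil
  then show ?case by simp
next
  case (Cons x xs)
  then obtain y ys' where ys: "ys = y # ys'" by (cases ys) auto
  have "x = y"
  proof (rule ccontr)
    assume "x \<noteq> y"
    then have "x \<in> set ys'" "y \<in> set xs" using Cons.prems(1) ys by auto
    then have "(y, x) \<in> r" "(x, y) \<in> r" using Cons.prems(4,5) ys by auto
    then show False using antisymD[OF assms(1)] \<open>x \<noteq> y\<close> by blast
  qed
  moreover have "set xs = set ys'" using Cons.prems(1-3) ys \<open>x = y\<close> by auto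
  ultimately show ?case using Cons.IH[of ys'] Cons.prems ys by simp
qed

lemma sorted_enum:
  assumes r: "linear_order_on I r" and F: "finite F" "F \<subseteq> I"
  shows "set (sorted_enum r F) = F" "distinct (sorted_enum r F)"
    "sorted_wrt (\<lambda>i j. (i, j) \<in> r) (sorted_enum r F)"
proof -
  have r': "antisym r" using r by (simp add: linear_order_on_def partial_order_on_def)
  have "\<exists>!xs. set xs = F \<and> distinct xs \<and> sorted_wrt (\<lambda>i j. (i, j) \<in> r) xs"
    by (rule ex_ex1I[OF ex_sorted_list[OF assms]]) (rule sorted_list_unique[OF r'], simp_all)
  from theI'[OF this] show "set (sorted_enum r F) = F" "distinct (sorted_enum r F)"
    "sorted_wrt (\<lambda>i j. (i, j) \<in> r) (sorted_enum r F)" by (simp_all add: sorted_enum_def)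
qed

text \<open>
  Filtering keeps a list sorted, and a sorted list is determined by its set of entries. This makes
  the bracketing of \<open>X\<^sup>F\<close> agree with what remains of \<open>X\<^bsup>F'\<^esup>\<close> after marginalization.
\<close>

lemma sorted_enum_subset:
  assumes r: "linear_order_on I r" and F: "finite F'" "F' \<subseteq> I" "F \<subseteq> F'"
  shows "filter (\<lambda>j. j \<in> F) (sorted_enum r F') = sorted_enum r F"
proof (rule sorted_list_unique)
  show "antisym r" using r by (simp add: linear_order_on_def partial_order_on_def)
  have F': "finite F" "F \<subseteq> I" using F finite_subset by auto
  note s = sorted_enum[OF r F(1,2)] sorted_enum[OF r F']
  show "set (filter (\<lambda>j. j \<in> F) (sorted_enum r F')) = set (sorted_enum r F)"
    "distinct (filter (\<lambda>j. j \<in> F) (sorted_enum r F'))" "distinct (sorted_enum r F)"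
    "sorted_wrt (\<lambda>i j. (i, j) \<in> r) (filter (\<lambda>j. j \<in> F) (sorted_enum r F'))"
    "sorted_wrt (\<lambda>i j. (i, j) \<in> r) (sorted_enum r F)"
    using s F(3) by (auto simp: sorted_wrt_filter)
qed

lemma fin_subsets_simps:
  "F \<in> Obj (fin_subsets I) \<longleftrightarrow> finite F \<and> F \<subseteq> I"
  "a \<in> hom (fin_subsets I) F' F \<longleftrightarrow> a = (F', F) \<and> finite F' \<and> F' \<subseteq> I \<and> F \<subseteq> F'"
  "Idn (fin_subsets I) F = (F, F)" "b \<cdot>\<^bsub>fin_subsets I\<^esub> a = (fst a, snd b)"
  by (auto simp: fin_subsets_def hom_def)

lemma fin_subsets_ArrE:
  assumes "a \<in> Arr (fin_subsets I)"
  obtains F' F where "a = (F', F)" "finite F'" "F' \<subseteq> I" "F \<subseteq> F'" "finite F" "F \<subseteq> I"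
proof -
  obtain F' F where 1: "a = (F', F)" "finite F'" "F' \<subseteq> I" "F \<subseteq> F'"
    using assms by (auto simp: fin_subsets_def)
  show ?thesis by (rule that[OF 1 finite_subset[OF 1(4,2)] order_trans[OF 1(4,3)]])
qed

lemma category_fin_subsets: "category (fin_subsets I)"
proof
  fix f assume "f \<in> Arr (fin_subsets I)"
  then show "Dom (fin_subsets I) f \<in> Obj (fin_subsets I)" "Cod (fin_subsets I) f \<in> Obj (fin_subsets I)"
    by (rule fin_subsets_ArrE, simp add: fin_subsets_def)+
next
  fix F assume "F \<in> Obj (fin_subsets I)"
  then show "Idn (fin_subsets I) F \<in> hom (fin_subsets I) F F" by (simp add: fin_subsets_simps)
next
  fix a b F G H assume "a \<in> hom (fin_subsets I) F G" "b \<in> hom (fin_subsets I) G H"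
  then show "b \<cdot>\<^bsub>fin_subsets I\<^esub> a \<in> hom (fin_subsets I) F H"
    unfolding fin_subsets_simps using order_trans[of H G F] by simp
qed (simp_all add: fin_subsets_simps)

lemma cofiltered_fin_subsets: "cofiltered (fin_subsets I)"
proof -
  have 1: "hom (fin_subsets I) (F \<union> G) F = {(F \<union> G, F)}" "hom (fin_subsets I) (F \<union> G) G = {(F \<union> G, G)}"
    if "finite F" "F \<subseteq> I" "finite G" "G \<subseteq> I" for F G
    using that by (auto simp: fin_subsets_simps)
  have 2: "Obj (fin_subsets I) \<noteq> {}" using fin_subsets_simps(1)[of "{}" I] by auto
  show ?thesis
    unfolding cofiltered_def
  proof (intro conjI ballI category_fin_subsets 2)
    fix F G assume "F \<in> Obj (fin_subsets I)" "G \<in> Obj (fin_subsets I)"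
    then show "\<exists>k\<in>Obj (fin_subsets I). hom (fin_subsets I) k F \<noteq> {} \<and> hom (fin_subsets I) k G \<noteq> {}"
      using 1 by (intro bexI[of _ "F \<union> G"]) (auto simp: fin_subsets_simps(1))
  next
    fix F G a b assume "F \<in> Obj (fin_subsets I)" "a \<in> hom (fin_subsets I) F G" "b \<in> hom (fin_subsets I) F G"
    then show "\<exists>k\<in>Obj (fin_subsets I). \<exists>c\<in>hom (fin_subsets I) k F.
        a \<cdot>\<^bsub>fin_subsets I\<^esub> c = b \<cdot>\<^bsub>fin_subsets I\<^esub> c"
      by (intro bexI[of _ F] bexI[of _ "(F, F)"]) (auto simp: fin_subsets_simps)
  qed
qed

context pro_markov
begin

text \<open>
  The list lemmas above are transported to finite subsets by replacing the sorted enumeration of a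
  subset with the filtered enumeration of a larger set. A finite subset is coded by the code of its
  sorted enumeration, an inclusion by the codes of both sets.
\<close>

lemma fibred_system_fin_ten:
  fixes I :: "'u set"
  assumes I: "Sm I" and r: "linear_order_on I r" and X: "\<And>i. i \<in> I \<Longrightarrow> X i \<in> Obj M"
  shows "\<exists>codeO codeA. fibred_system C Sm (fin_subsets I) (fin_ten M r X)
    (\<lambda>(F', F). marginalization M r X F' F)
    (\<lambda>(F', F). sub_index F (sorted_enum r F')) (\<lambda>(F', F). sub_map X F (sorted_enum r F'))
    (\<lambda>(F', F). sub_index F (sorted_enum r F')) codeO codeA"
proof -
  obtain code :: "'u list \<Rightarrow> 'u" where code: "inj code" "Sm (code ` lists I)"
    using ex_small_list_code[OF I] by blast
  define codeO where "codeO F = code (sorted_enum r F)" for F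
  define codeA where "codeA a = upair (codeO (fst a)) (codeO (snd a))" for a
  have codeO_inj: "F = G" if "codeO F = codeO G" "finite F" "F \<subseteq> I" "finite G" "G \<subseteq> I" for F G
    using that code(1) sorted_enum(1)[OF r] by (metis codeO_def injD)
  have codeO_small: "Sm (codeO ` Obj (fin_subsets I))"
    by (rule Sm_subset[OF code(2)])
      (use sorted_enum(1)[OF r] in \<open>auto simp: fin_subsets_simps codeO_def lists_eq_set\<close>)
  have sX: "X i \<in> Obj M" if "i \<in> set (sorted_enum r F)" "finite F" "F \<subseteq> I" for i F
    using that sorted_enum(1)[OF r] X by auto
  have P: "fin_ten M r X F = ten_list M X (filter (\<lambda>j. j \<in> F) (sorted_enum r F'))"
    if "finite F'" "F' \<subseteq> I" "F \<subseteq> F'" for F F'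
    using sorted_enum_subset[OF r that] by (simp add: fin_ten_def)
  have "fibred_system C Sm (fin_subsets I) (fin_ten M r X)
    (\<lambda>(F', F). marginalization M r X F' F)
    (\<lambda>(F', F). sub_index F (sorted_enum r F')) (\<lambda>(F', F). sub_map X F (sorted_enum r F'))
    (\<lambda>(F', F). sub_index F (sorted_enum r F')) codeO codeA"
  proof (intro fibred_system.intro level_system.intro fibred_system_axioms.intro level_system_axioms.intro)
    show "pro_markov C Sm" by unfold_locales
    show "category (fin_subsets I)" by (rule category_fin_subsets)
    show "cofiltered (fin_subsets I)" by (rule cofiltered_fin_subsets)
    show "Sm (codeO ` Obj (fin_subsets I))" by (rule codeO_small)
    show "inj_on codeO (Obj (fin_subsets I))"
      by (rule inj_onI) (simp add: fin_subsets_simps codeO_inj)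
    show "inj_on codeA (Arr (fin_subsets I))"
    proof (rule inj_onI)
      have fin: "finite (fst a)" "fst a \<subseteq> I" "finite (snd a)" "snd a \<subseteq> I"
        if "a \<in> Arr (fin_subsets I)" for a
        using that by (rule fin_subsets_ArrE, simp)+
      fix a b assume a: "a \<in> Arr (fin_subsets I)" and b: "b \<in> Arr (fin_subsets I)"
        and eq: "codeA a = codeA b"
      have "fst a = fst b" "snd a = snd b"
        by (rule codeO_inj, use eq fin[OF a] fin[OF b] in \<open>simp_all add: codeA_def\<close>)+
      then show "a = b" by (rule prod_eqI)
    qed
    show "Sm (codeA ` Arr (fin_subsets I))"
    proof (rule Sm_subset[OF Sm_upairs[OF codeO_small codeO_small]], rule image_subsetI)
      fix a assume "a \<in> Arr (fin_subsets I)"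
      then obtain F' F where "a = (F', F)" "F' \<in> Obj (fin_subsets I)" "F \<in> Obj (fin_subsets I)"
        by (rule fin_subsets_ArrE) (simp add: fin_subsets_simps)
      then show "codeA a \<in> {upair x y | x y. x \<in> codeO ` Obj (fin_subsets I) \<and> y \<in> codeO ` Obj (fin_subsets I)}"
        by (auto simp: codeA_def)
    qed
  next
    fix F assume F: "F \<in> Obj (fin_subsets I)"
    then have F': "finite F" "F \<subseteq> I" by (auto simp: fin_subsets_simps)
    let ?xs = "sorted_enum r F"
    have Xs: "X i \<in> Obj M" if "i \<in> set ?xs" for i using sX[OF that F'] .
    have sub: "set ?xs \<subseteq> F" using sorted_enum(1)[OF r F'] by simp
    show "fin_ten M r X F \<in> Obj M" unfolding fin_ten_def by (rule ten_list_Obj[OF Xs])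
    fix c assume c: "c \<in> Obj (Shape (fin_ten M r X F))"
    show "(case Idn (fin_subsets I) F of (F', F) \<Rightarrow> sub_index F (sorted_enum r F')) c = c"
      using sub_index_superset_Obj[OF _ sub] c by (simp add: fin_subsets_simps fin_ten_def)
    show "(case Idn (fin_subsets I) F of (F', F) \<Rightarrow> sub_map X F (sorted_enum r F')) c
        = Idn C (onObj (fin_ten M r X F) c)"
      using sub_map_superset[OF Xs _ sub] c by (simp add: fin_subsets_simps fin_ten_def)
  next
    fix F x c d assume F: "F \<in> Obj (fin_subsets I)" and x: "x \<in> hom (Shape (fin_ten M r X F)) c d"
    then have F': "finite F" "F \<subseteq> I" by (auto simp: fin_subsets_simps)
    have "set (sorted_enum r F) \<subseteq> F" using sorted_enum(1)[OF r F'] by simp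
    then show "(case Idn (fin_subsets I) F of (F', F) \<Rightarrow> sub_index F (sorted_enum r F')) x = x"
      using sub_index_superset_hom[OF x[unfolded fin_ten_def]] by (simp add: fin_subsets_simps)
  next
    fix a F' F assume a: "a \<in> hom (fin_subsets I) F' F"
    then have a': "a = (F', F)" and F: "finite F'" "F' \<subseteq> I" "F \<subseteq> F'" by (auto simp: fin_subsets_simps)
    let ?xs = "sorted_enum r F'"
    have Xs: "X i \<in> Obj M" if "i \<in> set ?xs" for i using sX[OF that F(1,2)] .
    note PF = P[OF F] and PF' = fin_ten_def[of M r X F']
    have marg: "marg_list M X F ?xs \<in> hom M (fin_ten M r X F') (fin_ten M r X F) \<and>
      (\<forall>c\<in>Obj (Shape (fin_ten M r X F')). Comps (marg_list M X F ?xs) (sub_index F ?xs c)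
        = germ C (fin_ten M r X F') c (sub_map X F ?xs c))"
      unfolding PF PF' by (rule marg_list_level[OF Xs])
    show "(case a of (F', F) \<Rightarrow> marginalization M r X F' F) \<in> hom M (fin_ten M r X F') (fin_ten M r X F)"
      using marg by (simp add: a' marginalization_def)
    {
      fix c assume c: "c \<in> Obj (Shape (fin_ten M r X F'))"
      note c' = c[unfolded PF']
      show "(case a of (F', F) \<Rightarrow> sub_index F (sorted_enum r F')) c \<in> Obj (Shape (fin_ten M r X F))"
        unfolding a' prod.case PF by (rule sub_index_Obj[OF c'])
      show "(case a of (F', F) \<Rightarrow> sub_map X F (sorted_enum r F')) c
          \<in> hom C (onObj (fin_ten M r X F') c)
            (onObj (fin_ten M r X F) ((case a of (F', F) \<Rightarrow> sub_index F (sorted_enum r F')) c))"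
        unfolding a' prod.case PF unfolding PF' by (rule sub_map_hom[OF Xs c'])
      show "Comps (case a of (F', F) \<Rightarrow> marginalization M r X F' F)
            ((case a of (F', F) \<Rightarrow> sub_index F (sorted_enum r F')) c)
          = germ C (fin_ten M r X F') c ((case a of (F', F) \<Rightarrow> sub_map X F (sorted_enum r F')) c)"
        using marg c by (simp add: a' marginalization_def)
      show "(case a of (F', F) \<Rightarrow> sub_index F (sorted_enum r F')) (Idn (Shape (fin_ten M r X F')) c)
          = Idn (Shape (fin_ten M r X F)) ((case a of (F', F) \<Rightarrow> sub_index F (sorted_enum r F')) c)"
        unfolding a' prod.case PF unfolding PF' by (rule sub_index_Idn[OF c'])
      show "deterministic C ((case a of (F', F) \<Rightarrow> sub_map X F (sorted_enum r F')) c)"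
        unfolding a' prod.case by (rule sub_map_det[OF Xs c'])
      fix y d assume y: "y \<in> hom (Shape (fin_ten M r X F)) d
        ((case a of (F', F) \<Rightarrow> sub_index F (sorted_enum r F')) c)"
      show "\<exists>c'. \<exists>x\<in>hom (Shape (fin_ten M r X F')) c' c.
          (case a of (F', F) \<Rightarrow> sub_index F (sorted_enum r F')) x = y"
        unfolding a' prod.case PF unfolding PF' by (rule sub_index_lift[OF Xs c' y[unfolded a' prod.case PF]])
    next
      fix d assume d: "d \<in> Obj (Shape (fin_ten M r X F))"
      show "\<exists>c\<in>Obj (Shape (fin_ten M r X F')).
          (case a of (F', F) \<Rightarrow> sub_index F (sorted_enum r F')) c = d"
        unfolding a' prod.case PF unfolding PF' by (rule sub_index_surj[OF Xs d[unfolded PF]])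
    next
      fix x c d assume x: "x \<in> hom (Shape (fin_ten M r X F')) c d"
      note x' = x[unfolded PF']
      show "(case a of (F', F) \<Rightarrow> sub_index F (sorted_enum r F')) x
        \<in> hom (Shape (fin_ten M r X F)) ((case a of (F', F) \<Rightarrow> sub_index F (sorted_enum r F')) c)
          ((case a of (F', F) \<Rightarrow> sub_index F (sorted_enum r F')) d)"
        unfolding a' prod.case PF by (rule sub_index_hom[OF x'])
      show "(case a of (F', F) \<Rightarrow> sub_map X F (sorted_enum r F')) d \<cdot> onArr (fin_ten M r X F') x
        = onArr (fin_ten M r X F) ((case a of (F', F) \<Rightarrow> sub_index F (sorted_enum r F')) x) \<cdot>
          (case a of (F', F) \<Rightarrow> sub_map X F (sorted_enum r F')) c"
        unfolding a' prod.case PF unfolding PF' by (rule sub_map_natural[OF Xs x'])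
      fix y d' assume y: "y \<in> hom (Shape (fin_ten M r X F')) d d'"
      show "(case a of (F', F) \<Rightarrow> sub_index F (sorted_enum r F')) (y \<cdot>\<^bsub>Shape (fin_ten M r X F')\<^esub> x)
        = (case a of (F', F) \<Rightarrow> sub_index F (sorted_enum r F')) y \<cdot>\<^bsub>Shape (fin_ten M r X F)\<^esub>
          (case a of (F', F) \<Rightarrow> sub_index F (sorted_enum r F')) x"
        unfolding a' prod.case PF unfolding PF' by (rule sub_index_Cmp[OF x' y[unfolded PF']])
    }
    fix b G assume "b \<in> hom (fin_subsets I) F G"
    then have b': "b = (F, G)" and G: "G \<subseteq> F" by (auto simp: fin_subsets_simps)
    have ba: "b \<cdot>\<^bsub>fin_subsets I\<^esub> a = (F', G)" by (simp add: a' b' fin_subsets_simps)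
    note sF = sorted_enum_subset[OF r F, symmetric]
    {
      fix c assume c: "c \<in> Obj (Shape (fin_ten M r X F'))"
      show "(case b \<cdot>\<^bsub>fin_subsets I\<^esub> a of (F', F) \<Rightarrow> sub_index F (sorted_enum r F')) c
        = (case b of (F', F) \<Rightarrow> sub_index F (sorted_enum r F'))
            ((case a of (F', F) \<Rightarrow> sub_index F (sorted_enum r F')) c)"
        unfolding ba unfolding a' b' prod.case sF by (rule sub_index_sub_index[OF G, symmetric])
      show "(case b \<cdot>\<^bsub>fin_subsets I\<^esub> a of (F', F) \<Rightarrow> sub_map X F (sorted_enum r F')) c
        = (case b of (F', F) \<Rightarrow> sub_map X F (sorted_enum r F'))
            ((case a of (F', F) \<Rightarrow> sub_index F (sorted_enum r F')) c) \<cdot>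
          (case a of (F', F) \<Rightarrow> sub_map X F (sorted_enum r F')) c"
        unfolding ba unfolding a' b' prod.case sF
        by (rule sub_map_sub_map[OF Xs c[unfolded PF'] G, symmetric])
    next
      fix x c d assume "x \<in> hom (Shape (fin_ten M r X F')) c d"
      show "(case b \<cdot>\<^bsub>fin_subsets I\<^esub> a of (F', F) \<Rightarrow> sub_index F (sorted_enum r F')) x
        = (case b of (F', F) \<Rightarrow> sub_index F (sorted_enum r F'))
            ((case a of (F', F) \<Rightarrow> sub_index F (sorted_enum r F')) x)"
        unfolding ba unfolding a' b' prod.case sF by (rule sub_index_sub_index[OF G, symmetric])
    }
  qed
  then show ?thesis by blast
qed

theorem ex_kolmogorov_product:
  fixes I :: "'u set"
  assumes I: "Sm I" and r: "linear_order_on I r" and X: "\<And>i. i \<in> I \<Longrightarrow> X i \<in> Obj M"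
  shows "\<exists>L \<pi>. kolmogorov_product M I r X L \<pi>"
proof -
  let ?t = "\<lambda>(F', F). marginalization M r X F' F"
    and ?p = "\<lambda>(F', F). sub_index F (sorted_enum r F')" and ?m = "\<lambda>(F', F). sub_map X F (sorted_enum r F')"
  obtain codeO codeA where
    sys: "fibred_system C Sm (fin_subsets I) (fin_ten M r X) ?t ?p ?m ?p codeO codeA"
    using fibred_system_fin_ten[of I r X, OF I r X] by blast
  obtain L e \<pi> where "level_limit C Sm (fin_subsets I) (fin_ten M r X) ?t ?p ?m L e \<pi>"
    using fibred_system.level_limit_total[OF sys] by blast
  then interpret level_limit C Sm "fin_subsets I" "fin_ten M r X" ?t ?p ?m L e \<pi> .
  have "is_limit_cone (fin_subsets I) M (\<lambda>F. fin_ten M r X F \<otimes>\<^bsub>M\<^esub> Y)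
      (\<lambda>(F', F). marginalization M r X F' F \<odot>\<^bsub>M\<^esub> Idn M Y) (L \<otimes>\<^bsub>M\<^esub> Y) (\<lambda>F. \<pi> F \<odot>\<^bsub>M\<^esub> Idn M Y)"
    if "Y \<in> Obj M" for Y
    using level_limit.limit_cone[OF level_limit_tenO[OF that]] by (simp add: case_prod_unfold)
  then have "kolmogorov_product M I r X L \<pi>"
    using limit_cone deterministic_proj
    by (simp add: kolmogorov_product_def infinite_tensor_product_def fin_subsets_simps)
  then show ?thesis by blast
qed

end

theorem theorem2:
  fixes Sm :: "'u set \<Rightarrow> bool"
    and C :: "('o, 'm) markov"
  assumes "smallness Sm"
    and "markov_category C"
  shows "\<forall>(I :: 'u set) (r :: 'u rel) X.
           Sm I \<longrightarrow> linear_order_on I r \<longrightarrow> (\<forall>i\<in>I. X i \<in> Obj (ProDet Sm C)) \<longrightarrow>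
           (\<exists>L \<pi>. kolmogorov_product (ProDet Sm C) I r X L \<pi>)"
proof -
  interpret pro_markov C Sm
    using assms by (simp add: pro_markov_def small_universe_def)
  show ?thesis using ex_kolmogorov_product by blast
qed

end
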